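(* Let $\mathsf{NQ.L}$ be any properly closed nested calculus. Each rule of $\mathsf{NQ.L}$ is height-preserving invertible in $\mathsf{NQ.L}$: whenever the conclusion of an instance of the rule is $\mathsf{NQ.L}$-derivable with height at most $n$, each premiss of that instance is $\mathsf{NQ.L}$-derivable with height at most $n$.
   Context: **Language.** Fix, for each $n$, an at most countable set of $n$-ary predicates $R^n_i$, and a denumerable set of variables. Formulas of $\mathcal L$: $A::=R_i^n(x_1,\dots,x_n)\mid x_1=x_2\mid\bot\mid A\supset A\mid\forall xA\mid\Box A$. Atomic formulas are those of shape $R_i^n(x_1,\dots,x_n)$ or $x_1=x_2$. $A(y/x)$ is capture-avoiding substitution (renaming bound variables if needed). **Axiom sets.** A frame is $\langle\mathcal W,\mathcal R,\mathcal D\rangle$ with $\mathcal W\neq\varnothing$, $\mathcal R\subseteq\mathcal W^2$, and $\mathcal D$ assigning to each $w\in\mathcal W$ a possibly empty set $\mathcal D_w$, with $\mathcal D_v\ne\varnothing$ for some $v$. Axiom names correspond to frame properties: $\mathbf D$: $\mathcal R$ serial; $\mathbf T$: reflexive; $\mathbf B$: symmetric; $\mathbf 4$: transitive; $\mathbf 5$: Euclidean ($w\mathcal Rv$ and $w\mathcal Ru$ imply $v\mathcal Ru$); $\mathbf{CBF}$: $w\mathcal Rv$ implies $\mathcal D_w\subseteq\mathcal D_v$; $\mathbf{BF}$: $w\mathcal Rv$ implies $\mathcal D_w\supseteq\mathcal D_v$; $\mathbf{UI}$: $\mathcal D_w=\mathcal D_v$ for all $w,v$. For $\mathsf L\subseteq\{\mathbf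 D,\mathbf T,\mathbf B,\mathbf 4,\mathbf 5,\mathbf{CBF},\mathbf{BF},\mathbf{UI}\}$, a $\mathsf{Q.L}$-frame is a frame with the properties of all members of $\mathsf L$. $\mathsf L$ is properly closed iff for every $Z\in\{\mathbf 4,\mathbf 5,\mathbf{CBF},\mathbf{BF}\}$, if all $\mathsf{Q.L}$-frames have the property of $Z$, then $Z\in\mathsf L$. **Nested sequents.** A sequent is $X;\Gamma\Rightarrow\Delta$ with $X$ (the signature) a finite multiset of variables and $\Gamma,\Delta$ finite multisets of formulas (an omitted signature is empty). A nested sequent is $X;\Gamma\Rightarrow\Delta,[\mathcal S_1],\dots,[\mathcal S_n]$ with $\mathcal S_i$ nested sequents: a finite tree of sequents with root $X;\Gamma\Rightarrow\Delta$ and the $\mathcal S_i$ as immediate subtrees (order irrelevant). A context $\mathcal S\{\cdot\}\cdots\{\cdot\}$ is a nested sequent with finitely many holes, each located at some node, in arbitrary relative positions (several holes may be at one node). Plugging $Y;\Pi\Rightarrow\Sigma,[\mathcal S'_1],\dots,[\mathcal S_k']$ into a hole at a node adds $Y,\Pi,\Sigma$ to the signature, antecedent, succedent of that node (multiset union) and adds the $\mathcal S'_j$ as further children; plugging $\emptyset$ removes the hole. The depth of a hole is the distance of its node from the root. When a bracketed component $[Y;\Pi\Rightarrow\Sigma]$ is displayed in both premiss and conclusion of a rule, that node may have further children, which stay attached to it; components displayed as newly created are leaves. **Rules** (premisses / conclusion). $\mathsf{NQ.K}$ consists of: - Initial sequents $\mathcal S\{X;P,\Gamma\Rightarrow\Delta,P\}$,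 $P$ atomic; and $L\bot$: $\mathcal S\{X;\bot,\Gamma\Rightarrow\Delta\}$ (no premisses). - $L{\supset}$: $\mathcal S\{X;\Gamma\Rightarrow\Delta,A\}$ and $\mathcal S\{X;B,\Gamma\Rightarrow\Delta\}$ / $\mathcal S\{X;A\supset B,\Gamma\Rightarrow\Delta\}$. $R{\supset}$: $\mathcal S\{X;A,\Gamma\Rightarrow\Delta,B\}$ / $\mathcal S\{X;\Gamma\Rightarrow\Delta,A\supset B\}$. - $L\forall$: $\mathcal S\{X,z;A(z/x),\forall xA,\Gamma\Rightarrow\Delta\}$ / $\mathcal S\{X,z;\forall xA,\Gamma\Rightarrow\Delta\}$. $R\forall$: $\mathcal S\{X,y;\Gamma\Rightarrow\Delta,A(y/x)\}$ / $\mathcal S\{X;\Gamma\Rightarrow\Delta,\forall xA\}$, $y$ (the eigenvariable) fresh, i.e. not occurring in the conclusion. - $L\Box$: $\mathcal S\{X;\Box A,\Gamma\Rightarrow\Delta,[Y;A,\Pi\Rightarrow\Sigma]\}$ / $\mathcal S\{X;\Box A,\Gamma\Rightarrow\Delta,[Y;\Pi\Rightarrow\Sigma]\}$. $R\Box$: $\mathcal S\{X;\Gamma\Rightarrow\Delta,[\emptyset;\Rightarrow A]\}$ / $\mathcal S\{X;\Gamma\Rightarrow\Delta,\Box A\}$. - $Ref$: $\mathcal S\{X;x=x,\Gamma\Rightarrow\Delta\}$ / $\mathcal S\{X;\Gamma\Rightarrow\Delta\}$. $Repl$ ($P$ atomic): $\mathcal S\{X;P(y/z),x=y,P(x/z),\Gamma\Rightarrow\Delta\}$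 / $\mathcal S\{X;x=y,P(x/z),\Gamma\Rightarrow\Delta\}$. $Repl_X$: $\mathcal S\{X,x,y;x=y,\Gamma\Rightarrow\Delta\}$ / $\mathcal S\{X,x;x=y,\Gamma\Rightarrow\Delta\}$. $Rig$: $\mathcal S\{X;x=y,\Gamma\Rightarrow\Delta\}\{Y;x=y,\Pi\Rightarrow\Sigma\}$ / $\mathcal S\{X;x=y,\Gamma\Rightarrow\Delta\}\{Y;\Pi\Rightarrow\Sigma\}$. $\mathsf{NQ.L}$ adds the rule of each member of $\mathsf L$: - $R_D$ ($\mathbf D$): $\mathcal S\{X;\Gamma\Rightarrow\Delta,[\emptyset;\Rightarrow]\}$ / $\mathcal S\{X;\Gamma\Rightarrow\Delta\}$. $R_T$ ($\mathbf T$): $\mathcal S\{X;A,\Box A,\Gamma\Rightarrow\Delta\}$ / $\mathcal S\{X;\Box A,\Gamma\Rightarrow\Delta\}$. $R_B$ ($\mathbf B$): $\mathcal S\{X;A,\Gamma\Rightarrow\Delta,[Y;\Box A,\Pi\Rightarrow\Sigma]\}$ / $\mathcal S\{X;\Gamma\Rightarrow\Delta,[Y;\Box A,\Pi\Rightarrow\Sigma]\}$. $R_4$ ($\mathbf 4$): $\mathcal S\{X;\Box A,\Gamma\Rightarrow\Delta,[Y;\Box A,\Pi\Rightarrow\Sigma]\}$ / $\mathcal S\{X;\Box A,\Gamma\Rightarrow\Delta,[Y;\Pi\Rightarrow\Sigma]\}$. $R_5$ ($\mathbf 5$): $\mathcal S\{X;\Box A,\Gamma\Rightarrow\Delta\}\{Y;\Box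 A,\Pi\Rightarrow\Sigma\}$ / $\mathcal S\{X;\Box A,\Gamma\Rightarrow\Delta\}\{Y;\Pi\Rightarrow\Sigma\}$, first hole of depth $\ge1$. - $R_{cbf}$ ($\mathbf{CBF}$): $\mathcal S\{X,x;\Gamma\Rightarrow\Delta,[Y,x;\Pi\Rightarrow\Sigma]\}$ / $\mathcal S\{X,x;\Gamma\Rightarrow\Delta,[Y;\Pi\Rightarrow\Sigma]\}$. $R_{bf}$ ($\mathbf{BF}$): $\mathcal S\{X,x;\Gamma\Rightarrow\Delta,[Y,x;\Pi\Rightarrow\Sigma]\}$ / $\mathcal S\{X;\Gamma\Rightarrow\Delta,[Y,x;\Pi\Rightarrow\Sigma]\}$. $R_{ui}$ ($\mathbf{UI}$): $\mathcal S\{X,x;\Gamma\Rightarrow\Delta\}$ / $\mathcal S\{X;\Gamma\Rightarrow\Delta\}$. - $R_{5dom}$: $\mathcal S\{X,x;\Gamma\Rightarrow\Delta\}\{Y,x;\Pi\Rightarrow\Sigma\}$ / $\mathcal S\{X,x;\Gamma\Rightarrow\Delta\}\{Y;\Pi\Rightarrow\Sigma\}$, both holes of depth $\ge1$; it is a rule of $\mathsf{NQ.L}$ iff $\mathbf 5\in\mathsf L$ and $\{\mathbf{CBF},\mathbf{BF}\}\cap\mathsf L\ne\emptyset$. $\mathsf{NQ.L}$ is properly closed iff $\mathsf L$ is properly closed and $R_{5dom}$ is included exactly as just stated. **Derivations.** An $\mathsf{NQ.L}$-derivation of $\mathcal S$ is a finite tree of nested sequents with root $\mathcal S$, built by the rules,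 with leaves initial sequents (or instances of $L\bot$). Only derivations of pure sequents are considered: no variable occurs both free and bound, and eigenvariables are pairwise distinct. Height is the number of nodes on a longest branch. $\mathcal S$ is derivable iff $\mathcal S$ or an alphabetical variant (bound renaming) of it has a derivation. *)

theory Defs
  imports "HOL-Library.Multiset" "HOL-Library.Countable_Set"
begin

section \<open>Formulas\<close>

type_synonym var = nat

text \<open>\<open>Rel i xs\<close> is $R^n_i(x_1,\dots,x_n)$ with $n$ the length of \<open>xs\<close>.\<close>

datatype fm =
    Rel nat "var list"
  | Eq var var
  | Bot
  | Imp fm fm
  | All var fm
  | Box fm

text \<open>A predicate vocabulary \<open>Pr\<close> gives, for each arity \<open>n\<close>, the at most countable set
  \<open>Pr n\<close> of the indices \<open>i\<close> of the \<open>n\<close>-ary predicates $R^n_i$.\<close>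

primrec in_lang :: "(nat \<Rightarrow> nat set) \<Rightarrow> fm \<Rightarrow> bool" where
  "in_lang Pr (Rel i xs) \<longleftrightarrow> i \<in> Pr (length xs)"
| "in_lang Pr (Eq x y) \<longleftrightarrow> True"
| "in_lang Pr Bot \<longleftrightarrow> True"
| "in_lang Pr (Imp A B) \<longleftrightarrow> in_lang Pr A \<and> in_lang Pr B"
| "in_lang Pr (All x A) \<longleftrightarrow> in_lang Pr A"
| "in_lang Pr (Box A) \<longleftrightarrow> in_lang Pr A"

fun atomic :: "fm \<Rightarrow> bool" where
  "atomic (Rel i xs) = True"
| "atomic (Eq x y) = True"
| "atomic _ = False"

primrec fv :: "fm \<Rightarrow> var set" where
  "fv (Rel i xs) = set xs"
| "fv (Eq x y) = {x, y}"
| "fv Bot = {}"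
| "fv (Imp A B) = fv A \<union> fv B"
| "fv (All x A) = fv A - {x}"
| "fv (Box A) = fv A"

primrec bv :: "fm \<Rightarrow> var set" where
  "bv (Rel i xs) = {}"
| "bv (Eq x y) = {}"
| "bv Bot = {}"
| "bv (Imp A B) = bv A \<union> bv B"
| "bv (All x A) = insert x (bv A)"
| "bv (Box A) = bv A"

text \<open>Capture-avoiding simultaneous substitution: a bound variable is renamed exactly when it
  would capture, and then to the least variable that does not.\<close>

primrec psubst :: "(var \<Rightarrow> var) \<Rightarrow> fm \<Rightarrow> fm" where
  "psubst \<sigma> (Rel i xs) = Rel i (map \<sigma> xs)"
| "psubst \<sigma> (Eq x y) = Eq (\<sigma> x) (\<sigma> y)"
| "psubst \<sigma> Bot = Bot"
| "psubst \<sigma> (Imp A B) = Imp (psubst \<sigma> A) (psubst \<sigma> B)"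
| "psubst \<sigma> (All x A) =
    (let F = \<sigma> ` (fv A - {x}); w = (if x \<in> F then (LEAST w. w \<notin> F) else x)
     in All w (psubst (\<sigma>(x := w)) A))"
| "psubst \<sigma> (Box A) = Box (psubst \<sigma> A)"

text \<open>\<open>subst A y x\<close> is $A(y/x)$: the variable \<open>y\<close> replaces the free occurrences of \<open>x\<close>.\<close>

definition subst :: "fm \<Rightarrow> var \<Rightarrow> var \<Rightarrow> fm" where
  "subst A y x = psubst (id(x := y)) A"

inductive alpha :: "fm \<Rightarrow> fm \<Rightarrow> bool" where
  alpha_rename: "y \<notin> fv A \<Longrightarrow> alpha (All x A) (All y (subst A y x))"
| alpha_refl: "alpha A A"
| alpha_sym: "alpha A B \<Longrightarrow> alpha B A"
| alpha_trans: "alpha A B \<Longrightarrow> alpha B C \<Longrightarrow> alpha A C"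
| alpha_Imp: "alpha A A' \<Longrightarrow> alpha B B' \<Longrightarrow> alpha (Imp A B) (Imp A' B')"
| alpha_All: "alpha A A' \<Longrightarrow> alpha (All x A) (All x A')"
| alpha_Box: "alpha A A' \<Longrightarrow> alpha (Box A) (Box A')"

section \<open>Frames\<close>

datatype ax = D_ax | T_ax | B_ax | Four_ax | Five_ax | CBF_ax | BF_ax | UI_ax

definition frame :: "'w set \<Rightarrow> ('w \<times> 'w) set \<Rightarrow> ('w \<Rightarrow> 'd set) \<Rightarrow> bool" where
  "frame W R D \<longleftrightarrow> W \<noteq> {} \<and> R \<subseteq> W \<times> W \<and> (\<exists>v\<in>W. D v \<noteq> {})"

fun frame_prop :: "ax \<Rightarrow> 'w set \<Rightarrow> ('w \<times> 'w) set \<Rightarrow> ('w \<Rightarrow> 'd set) \<Rightarrow> bool" where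
  "frame_prop D_ax W R D \<longleftrightarrow> (\<forall>w\<in>W. \<exists>v\<in>W. (w, v) \<in> R)"
| "frame_prop T_ax W R D \<longleftrightarrow> refl_on W R"
| "frame_prop B_ax W R D \<longleftrightarrow> sym R"
| "frame_prop Four_ax W R D \<longleftrightarrow> trans R"
| "frame_prop Five_ax W R D \<longleftrightarrow> (\<forall>w v u. (w, v) \<in> R \<longrightarrow> (w, u) \<in> R \<longrightarrow> (v, u) \<in> R)"
| "frame_prop CBF_ax W R D \<longleftrightarrow> (\<forall>w v. (w, v) \<in> R \<longrightarrow> D w \<subseteq> D v)"
| "frame_prop BF_ax W R D \<longleftrightarrow> (\<forall>w v. (w, v) \<in> R \<longrightarrow> D v \<subseteq> D w)"
| "frame_prop UI_ax W R D \<longleftrightarrow> (\<forall>w\<in>W. \<forall>v\<in>W. D w = D v)"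

definition QL_frame :: "ax set \<Rightarrow> 'w set \<Rightarrow> ('w \<times> 'w) set \<Rightarrow> ('w \<Rightarrow> 'd set) \<Rightarrow> bool" where
  "QL_frame L W R D \<longleftrightarrow> frame W R D \<and> (\<forall>Z\<in>L. frame_prop Z W R D)"

text \<open>Quantification over all frames is rendered by frames whose worlds and objects are natural
  numbers; lemma \<open>all_frames_if_nat_frames\<close> below shows that nothing is lost.\<close>

definition properly_closed :: "ax set \<Rightarrow> bool" where
  "properly_closed L \<longleftrightarrow>
    (\<forall>Z\<in>{Four_ax, Five_ax, CBF_ax, BF_ax}.
      (\<forall>(W :: nat set) R (D :: nat \<Rightarrow> nat set). QL_frame L W R D \<longrightarrow> frame_prop Z W R D) \<longrightarrow> Z \<in> L)"

lemma frame_prop_pullback: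
  fixes e :: "nat \<Rightarrow> 'w" and c :: "nat \<Rightarrow> 'd"
  assumes e: "range e \<subseteq> W" "\<And>n y. (e n, y) \<in> R \<Longrightarrow> \<exists>m. (e n, e m) \<in> R"
    and Y: "frame_prop Y W R D"
  shows "frame_prop Y UNIV {(m, n). (e m, e n) \<in> R} (\<lambda>n. {i. c i \<in> D (e n)})"
proof -
  have eW: "e n \<in> W" for n using e(1) by auto
  show ?thesis
  proof (cases Y)
    case D_ax
    have "\<exists>m. (e n, e m) \<in> R" for n
    proof -
      obtain y where "(e n, y) \<in> R" using Y D_ax eW[of n] by auto
      then show ?thesis by (rule e(2))
    qed
    then show ?thesis using D_ax by simp
  next
    case T_ax then show ?thesis using Y eW by (simp add: refl_on_def)
  next
    case B_ax
    then have "sym R" using Y by simp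
    then have "sym {(m, n). (e m, e n) \<in> R}" unfolding sym_def by blast
    then show ?thesis using B_ax by simp
  next
    case Four_ax
    then have "trans R" using Y by simp
    then have "trans {(m, n). (e m, e n) \<in> R}"
      unfolding trans_def by blast
    then show ?thesis using Four_ax by simp
  next
    case Five_ax
    then have "\<forall>w v u. (w, v) \<in> R \<longrightarrow> (w, u) \<in> R \<longrightarrow> (v, u) \<in> R"
      using Y by (simp only: frame_prop.simps)
    then show ?thesis unfolding Five_ax frame_prop.simps by blast
  next
    case CBF_ax then show ?thesis using Y by (simp only: frame_prop.simps) blast
  next
    case BF_ax then show ?thesis using Y by (simp only: frame_prop.simps) blast
  next
    case UI_ax
    then have all: "\<forall>w\<in>W. \<forall>v\<in>W. D w = D v" using Y by (simp only: frame_prop.simps)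
    have eq: "D (e m) = D (e n)" for m n using all[rule_format, OF eW eW] .
    show ?thesis unfolding UI_ax frame_prop.simps
    proof (intro ballI)
      fix m n
      show "{i. c i \<in> D (e m)} = {i. c i \<in> D (e n)}" by (subst eq[of m n]) (rule refl)
    qed
  qed
qed

lemma nat_frame_through:
  fixes W :: "'w set" and D :: "'w \<Rightarrow> 'd set"
  assumes nat: "\<forall>(W :: nat set) R (D :: nat \<Rightarrow> nat set). QL_frame L W R D \<longrightarrow> frame_prop Z W R D"
    and fr: "QL_frame L W R D" and V: "finite V" "V \<subseteq> W"
  shows "\<exists>(e :: nat \<Rightarrow> 'w) (c :: nat \<Rightarrow> 'd). V \<subseteq> range e \<and> d \<in> range c \<and>
    frame_prop Z UNIV {(m, n). (e m, e n) \<in> R} (\<lambda>n. {i. c i \<in> D (e n)})"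
proof -
  have RW: "R \<subseteq> W \<times> W" using fr by (simp add: QL_frame_def frame_def)
  obtain v0 d0 where v0: "v0 \<in> W" "d0 \<in> D v0"
    using fr unfolding QL_frame_def frame_def by blast
  define f where "f x = (if \<exists>y. (x, y) \<in> R then SOME y. (x, y) \<in> R else x)" for x
  have f: "(x, f x) \<in> R" if ex: "\<exists>y. (x, y) \<in> R" for x
  proof -
    have "f x = (SOME y. (x, y) \<in> R)" using ex by (simp add: f_def)
    then show ?thesis using someI_ex[OF ex] by simp
  qed
  have fW: "f x \<in> W" if "x \<in> W" for x
  proof (cases "\<exists>y. (x, y) \<in> R")
    case True
    show ?thesis using f[OF True] RW by auto
  next
    case False
    then show ?thesis using that by (simp add: f_def)
  qed
  have fnW: "(f ^^ n) a \<in> W" if "a \<in> W" for n a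
    using that by (induction n) (simp_all add: fW)
  define W' where "W' = (\<lambda>(a, n). (f ^^ n) a) ` (insert v0 V \<times> UNIV)"
  have W'I: "(f ^^ n) a \<in> W'" if "a \<in> insert v0 V" for a n
    unfolding W'_def by (rule image_eqI[of _ _ "(a, n)"]) (use that in simp_all)
  have W'E: "\<exists>a n. a \<in> insert v0 V \<and> x = (f ^^ n) a" if "x \<in> W'" for x
    using that unfolding W'_def by auto
  have VW': "insert v0 V \<subseteq> W'"
    using W'I[where n = 0] by auto
  have "countable W'"
    unfolding W'_def using V(1) by (simp add: countable_finite)
  define e where "e = from_nat_into W'"
  have e: "range e = W'"
    unfolding e_def using \<open>countable W'\<close> VW' by (intro range_from_nat_into) auto
  define c where "c i = (if i = 0 then d else d0)" for i :: nat
  let ?R = "{(m, n). (e m, e n) \<in> R}" and ?D = "\<lambda>n. {i. c i \<in> D (e n)}"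
  have sub: "range e \<subseteq> W"
  proof
    fix x assume "x \<in> range e"
    then obtain a n where "a \<in> insert v0 V" "x = (f ^^ n) a" using W'E unfolding e by blast
    then show "x \<in> W" using fnW v0(1) V(2) by blast
  qed
  have succ: "\<exists>m. (e n, e m) \<in> R" if "(e n, y) \<in> R" for n y
  proof -
    have "e n \<in> W'" using e by blast
    then obtain a k where "a \<in> insert v0 V" "e n = (f ^^ k) a" using W'E by blast
    then have "f (e n) \<in> W'" using W'I[of a "Suc k"] by simp
    then obtain m where "e m = f (e n)" using e by (metis imageE)
    moreover have "(e n, f (e n)) \<in> R" using that by (intro f exI)
    ultimately show ?thesis by metis
  qed
  have "frame_prop Y UNIV ?R ?D" if "Y \<in> L" for Y
  proof (rule frame_prop_pullback[OF sub succ])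
    show "frame_prop Y W R D" using fr that by (simp add: QL_frame_def)
  qed
  moreover have "frame UNIV ?R ?D"
  proof -
    obtain n where "e n = v0" using VW' e by (metis imageE insert_subset)
    then have "Suc 0 \<in> ?D n" using v0(2) by (simp add: c_def)
    then show ?thesis unfolding frame_def by blast
  qed
  ultimately have "frame_prop Z UNIV ?R ?D" using nat by (simp add: QL_frame_def)
  moreover have "d \<in> range c" by (rule range_eqI[of _ _ 0]) (simp add: c_def)
  moreover have "V \<subseteq> range e" using VW' e by simp
  ultimately show ?thesis by (intro exI[of _ e] exI[of _ c] conjI)
qed

lemma all_frames_if_nat_frames:
  fixes W :: "'w set" and D :: "'w \<Rightarrow> 'd set"
  assumes nat: "\<forall>(W :: nat set) R (D :: nat \<Rightarrow> nat set). QL_frame L W R D \<longrightarrow> frame_prop Z W R D"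
    and Z: "Z \<in> {Four_ax, Five_ax, CBF_ax, BF_ax}" and fr: "QL_frame L W R D"
  shows "frame_prop Z W R D"
proof -
  have RW: "R \<subseteq> W \<times> W" using fr by (simp add: QL_frame_def frame_def)
  have through: "\<exists>(e :: nat \<Rightarrow> 'w) (c :: nat \<Rightarrow> 'd) i j k l. e i = w \<and> e j = v \<and> e k = u \<and> c l = d \<and>
    frame_prop Z UNIV {(m, n). (e m, e n) \<in> R} (\<lambda>n. {i. c i \<in> D (e n)})"
    if "w \<in> W" "v \<in> W" "u \<in> W" for w v u d
  proof -
    have "{w, v, u} \<subseteq> W" using that by simp
    moreover have "finite {w, v, u}" by simp
    ultimately have "\<exists>(e :: nat \<Rightarrow> 'w) (c :: nat \<Rightarrow> 'd). {w, v, u} \<subseteq> range e \<and> d \<in> range c \<and>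
      frame_prop Z UNIV {(m, n). (e m, e n) \<in> R} (\<lambda>n. {i. c i \<in> D (e n)})"
      by (intro nat_frame_through[OF nat fr])
    then
    obtain e :: "nat \<Rightarrow> 'w" and c :: "nat \<Rightarrow> 'd" where *: "{w, v, u} \<subseteq> range e" "d \<in> range c"
      "frame_prop Z UNIV {(m, n). (e m, e n) \<in> R} (\<lambda>n. {i. c i \<in> D (e n)})"
      by (elim exE conjE) simp_all
    obtain i where i: "e i = w" using *(1) by (auto simp: image_iff)
    obtain j where j: "e j = v" using *(1) by (auto simp: image_iff)
    obtain k where k: "e k = u" using *(1) by (auto simp: image_iff)
    obtain l where l: "c l = d" using *(2) by (auto simp: image_iff)
    show ?thesis
      by (intro exI[of _ e] exI[of _ c] exI[of _ i] exI[of _ j] exI[of _ k] exI[of _ l] conjI i j k l *(3))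
  qed
  show ?thesis
  proof (cases Z)
    case Four_ax
    have "(w, u) \<in> R" if "(w, v) \<in> R" "(v, u) \<in> R" for w v u
    proof -
      have W: "w \<in> W" "v \<in> W" "u \<in> W" using that RW by auto
      obtain e :: "nat \<Rightarrow> 'w" and c :: "nat \<Rightarrow> 'd" and i j k l
        where e: "e i = w" "e j = v" "e k = u"
        and Z: "frame_prop Z UNIV {(m, n). (e m, e n) \<in> R} (\<lambda>n. {i. c i \<in> D (e n)})"
        using through[OF W, of undefined] by (elim exE conjE)
      have "(e i, e j) \<in> R \<longrightarrow> (e j, e k) \<in> R \<longrightarrow> (e i, e k) \<in> R"
        using Z unfolding Four_ax frame_prop.simps trans_def by blast
      then show ?thesis using e that by blast
    qed
    then show ?thesis unfolding Four_ax frame_prop.simps trans_def by blast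
  next
    case Five_ax
    have "(v, u) \<in> R" if "(w, v) \<in> R" "(w, u) \<in> R" for w v u
    proof -
      have W: "w \<in> W" "v \<in> W" "u \<in> W" using that RW by auto
      obtain e :: "nat \<Rightarrow> 'w" and c :: "nat \<Rightarrow> 'd" and i j k l
        where e: "e i = w" "e j = v" "e k = u"
        and Z: "frame_prop Z UNIV {(m, n). (e m, e n) \<in> R} (\<lambda>n. {i. c i \<in> D (e n)})"
        using through[OF W, of undefined] by (elim exE conjE)
      have "(e i, e j) \<in> R \<longrightarrow> (e i, e k) \<in> R \<longrightarrow> (e j, e k) \<in> R"
        using Z unfolding Five_ax frame_prop.simps by blast
      then show ?thesis using e that by blast
    qed
    then show ?thesis unfolding Five_ax frame_prop.simps by blast
  next
    case CBF_ax
    have "d \<in> D v" if "(w, v) \<in> R" "d \<in> D w" for w v d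
    proof -
      have W: "w \<in> W" "v \<in> W" using that RW by auto
      obtain e :: "nat \<Rightarrow> 'w" and c :: "nat \<Rightarrow> 'd" and i j k l
        where e: "e i = w" "e j = v" "c l = d"
        and Z: "frame_prop Z UNIV {(m, n). (e m, e n) \<in> R} (\<lambda>n. {i. c i \<in> D (e n)})"
        using through[OF W W(2), of d] by (elim exE conjE)
      have "(e i, e j) \<in> R \<longrightarrow> c l \<in> D (e i) \<longrightarrow> c l \<in> D (e j)"
        using Z unfolding CBF_ax frame_prop.simps by blast
      then show ?thesis using e that by blast
    qed
    then show ?thesis unfolding CBF_ax frame_prop.simps by blast
  next
    case BF_ax
    have "d \<in> D w" if "(w, v) \<in> R" "d \<in> D v" for w v d
    proof -
      have W: "w \<in> W" "v \<in> W" using that RW by auto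
      obtain e :: "nat \<Rightarrow> 'w" and c :: "nat \<Rightarrow> 'd" and i j k l
        where e: "e i = w" "e j = v" "c l = d"
        and Z: "frame_prop Z UNIV {(m, n). (e m, e n) \<in> R} (\<lambda>n. {i. c i \<in> D (e n)})"
        using through[OF W W(2), of d] by (elim exE conjE)
      have "(e i, e j) \<in> R \<longrightarrow> c l \<in> D (e j) \<longrightarrow> c l \<in> D (e i)"
        using Z unfolding BF_ax frame_prop.simps by blast
      then show ?thesis using e that by blast
    qed
    then show ?thesis unfolding BF_ax frame_prop.simps by blast
  qed (use Z in simp_all)
qed

section \<open>Nested sequents and contexts\<close>

datatype nseq = NS (sig: "var multiset") (ante: "fm multiset") (succ: "fm multiset")
  (kids: "nseq multiset")

text \<open>Signature variables count as free occurrences.\<close>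

primrec fv_ns :: "nseq \<Rightarrow> var set" where
  "fv_ns (NS X \<Gamma> \<Delta> K) = set_mset X \<union> \<Union>(fv ` set_mset \<Gamma>) \<union> \<Union>(fv ` set_mset \<Delta>)
     \<union> \<Union>(set_mset (image_mset fv_ns K))"

primrec bv_ns :: "nseq \<Rightarrow> var set" where
  "bv_ns (NS X \<Gamma> \<Delta> K) = \<Union>(bv ` set_mset \<Gamma>) \<union> \<Union>(bv ` set_mset \<Delta>)
     \<union> \<Union>(set_mset (image_mset bv_ns K))"

definition pure_ns :: "nseq \<Rightarrow> bool" where
  "pure_ns S \<longleftrightarrow> fv_ns S \<inter> bv_ns S = {}"

inductive in_lang_ns :: "(nat \<Rightarrow> nat set) \<Rightarrow> nseq \<Rightarrow> bool" for Pr where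
  "(\<forall>A\<in>#\<Gamma>. in_lang Pr A) \<Longrightarrow> (\<forall>A\<in>#\<Delta>. in_lang Pr A) \<Longrightarrow> (\<forall>S\<in>#K. in_lang_ns Pr S) \<Longrightarrow>
   in_lang_ns Pr (NS X \<Gamma> \<Delta> K)"

inductive alpha_ns :: "nseq \<Rightarrow> nseq \<Rightarrow> bool" where
  "rel_mset alpha \<Gamma> \<Gamma>' \<Longrightarrow> rel_mset alpha \<Delta> \<Delta>' \<Longrightarrow> rel_mset alpha_ns K K' \<Longrightarrow>
   alpha_ns (NS X \<Gamma> \<Delta> K) (NS X \<Gamma>' \<Delta>' K')"
monos multiset.rel_mono

text \<open>A node of a context carries a multiset of hole labels. A context with \<open>k\<close> holes has the
  labels \<open>0, \<dots>, k - 1\<close>, each exactly once.\<close>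

datatype ctx = Ctx "var multiset" "fm multiset" "fm multiset" "nat multiset" "ctx multiset"

primrec holes :: "ctx \<Rightarrow> nat multiset" where
  "holes (Ctx X \<Gamma> \<Delta> H K) = H + \<Sum>\<^sub># (image_mset holes K)"

definition is_ctx :: "nat \<Rightarrow> ctx \<Rightarrow> bool" where
  "is_ctx k C \<longleftrightarrow> holes C = mset [0..<k]"

inductive hole_depth :: "nat \<Rightarrow> ctx \<Rightarrow> nat \<Rightarrow> bool" for i where
  "i \<in># H \<Longrightarrow> hole_depth i (Ctx X \<Gamma> \<Delta> H K) 0"
| "C \<in># K \<Longrightarrow> hole_depth i C d \<Longrightarrow> hole_depth i (Ctx X \<Gamma> \<Delta> H K) (Suc d)"

primrec fill :: "(nat \<Rightarrow> nseq) \<Rightarrow> ctx \<Rightarrow> nseq" where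
  "fill f (Ctx X \<Gamma> \<Delta> H K) =
     NS (X + (\<Sum>h\<in>#H. sig (f h))) (\<Gamma> + (\<Sum>h\<in>#H. ante (f h))) (\<Delta> + (\<Sum>h\<in>#H. succ (f h)))
        (image_mset (fill f) K + (\<Sum>h\<in>#H. kids (f h)))"

text \<open>In the rules below, components not displayed at a hole (among them further children of its
  node) belong to the context, whereas a displayed child carries its own children \<open>K\<close>.\<close>

definition plug :: "ctx \<Rightarrow> nseq list \<Rightarrow> nseq" where
  "plug C Ss = fill (\<lambda>i. Ss ! i) C"

section \<open>Rules\<close>

datatype rule = Init | LBot | LImp | RImp | LAll | RAll | LBox | RBox
  | Ref | Repl | ReplX | Rig
  | RuD | RuT | RuB | Ru4 | Ru5 | RuCBF | RuBF | RuUI | Ru5dom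

text \<open>\<open>rule_inst r ys Ps S\<close>: there is an instance of \<open>r\<close> with premisses \<open>Ps\<close>, conclusion \<open>S\<close>
  and list of eigenvariables \<open>ys\<close> (a singleton for \<open>RAll\<close>, empty otherwise).\<close>

inductive rule_inst :: "rule \<Rightarrow> var list \<Rightarrow> nseq list \<Rightarrow> nseq \<Rightarrow> bool" where
  Init: "is_ctx 1 C \<Longrightarrow> atomic P \<Longrightarrow>
    rule_inst Init [] [] (plug C [NS X (add_mset P \<Gamma>) (add_mset P \<Delta>) {#}])"
| LBot: "is_ctx 1 C \<Longrightarrow>
    rule_inst LBot [] [] (plug C [NS X (add_mset Bot \<Gamma>) \<Delta> {#}])"
| LImp: "is_ctx 1 C \<Longrightarrow>
    rule_inst LImp []
      [plug C [NS X \<Gamma> (add_mset A \<Delta>) {#}], plug C [NS X (add_mset B \<Gamma>) \<Delta> {#}]]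
      (plug C [NS X (add_mset (Imp A B) \<Gamma>) \<Delta> {#}])"
| RImp: "is_ctx 1 C \<Longrightarrow>
    rule_inst RImp []
      [plug C [NS X (add_mset A \<Gamma>) (add_mset B \<Delta>) {#}]]
      (plug C [NS X \<Gamma> (add_mset (Imp A B) \<Delta>) {#}])"
| LAll: "is_ctx 1 C \<Longrightarrow>
    rule_inst LAll []
      [plug C [NS (add_mset z X) (add_mset (subst A z x) (add_mset (All x A) \<Gamma>)) \<Delta> {#}]]
      (plug C [NS (add_mset z X) (add_mset (All x A) \<Gamma>) \<Delta> {#}])"
| RAll: "is_ctx 1 C \<Longrightarrow> S = plug C [NS X \<Gamma> (add_mset (All x A) \<Delta>) {#}] \<Longrightarrow>
    y \<notin> fv_ns S \<union> bv_ns S \<Longrightarrow>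
    rule_inst RAll [y] [plug C [NS (add_mset y X) \<Gamma> (add_mset (subst A y x) \<Delta>) {#}]] S"
| LBox: "is_ctx 1 C \<Longrightarrow>
    rule_inst LBox []
      [plug C [NS X (add_mset (Box A) \<Gamma>) \<Delta> {#NS Y (add_mset A \<Pi>) \<Sigma> K#}]]
      (plug C [NS X (add_mset (Box A) \<Gamma>) \<Delta> {#NS Y \<Pi> \<Sigma> K#}])"
| RBox: "is_ctx 1 C \<Longrightarrow>
    rule_inst RBox []
      [plug C [NS X \<Gamma> \<Delta> {#NS {#} {#} {#A#} {#}#}]]
      (plug C [NS X \<Gamma> (add_mset (Box A) \<Delta>) {#}])"
| Ref: "is_ctx 1 C \<Longrightarrow>
    rule_inst Ref [] [plug C [NS X (add_mset (Eq x x) \<Gamma>) \<Delta> {#}]] (plug C [NS X \<Gamma> \<Delta> {#}])"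
| Repl: "is_ctx 1 C \<Longrightarrow> atomic P \<Longrightarrow>
    rule_inst Repl []
      [plug C [NS X (add_mset (subst P y z) (add_mset (Eq x y) (add_mset (subst P x z) \<Gamma>))) \<Delta> {#}]]
      (plug C [NS X (add_mset (Eq x y) (add_mset (subst P x z) \<Gamma>)) \<Delta> {#}])"
| ReplX: "is_ctx 1 C \<Longrightarrow>
    rule_inst ReplX []
      [plug C [NS (add_mset x (add_mset y X)) (add_mset (Eq x y) \<Gamma>) \<Delta> {#}]]
      (plug C [NS (add_mset x X) (add_mset (Eq x y) \<Gamma>) \<Delta> {#}])"
| Rig: "is_ctx 2 C \<Longrightarrow>
    rule_inst Rig []
      [plug C [NS X (add_mset (Eq x y) \<Gamma>) \<Delta> {#}, NS Y (add_mset (Eq x y) \<Pi>) \<Sigma> {#}]]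
      (plug C [NS X (add_mset (Eq x y) \<Gamma>) \<Delta> {#}, NS Y \<Pi> \<Sigma> {#}])"
| RuD: "is_ctx 1 C \<Longrightarrow>
    rule_inst RuD []
      [plug C [NS X \<Gamma> \<Delta> {#NS {#} {#} {#} {#}#}]]
      (plug C [NS X \<Gamma> \<Delta> {#}])"
| RuT: "is_ctx 1 C \<Longrightarrow>
    rule_inst RuT []
      [plug C [NS X (add_mset A (add_mset (Box A) \<Gamma>)) \<Delta> {#}]]
      (plug C [NS X (add_mset (Box A) \<Gamma>) \<Delta> {#}])"
| RuB: "is_ctx 1 C \<Longrightarrow>
    rule_inst RuB []
      [plug C [NS X (add_mset A \<Gamma>) \<Delta> {#NS Y (add_mset (Box A) \<Pi>) \<Sigma> K#}]]
      (plug C [NS X \<Gamma> \<Delta> {#NS Y (add_mset (Box A) \<Pi>) \<Sigma> K#}])"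
| Ru4: "is_ctx 1 C \<Longrightarrow>
    rule_inst Ru4 []
      [plug C [NS X (add_mset (Box A) \<Gamma>) \<Delta> {#NS Y (add_mset (Box A) \<Pi>) \<Sigma> K#}]]
      (plug C [NS X (add_mset (Box A) \<Gamma>) \<Delta> {#NS Y \<Pi> \<Sigma> K#}])"
| Ru5: "is_ctx 2 C \<Longrightarrow> hole_depth 0 C d \<Longrightarrow> d \<ge> 1 \<Longrightarrow>
    rule_inst Ru5 []
      [plug C [NS X (add_mset (Box A) \<Gamma>) \<Delta> {#}, NS Y (add_mset (Box A) \<Pi>) \<Sigma> {#}]]
      (plug C [NS X (add_mset (Box A) \<Gamma>) \<Delta> {#}, NS Y \<Pi> \<Sigma> {#}])"
| RuCBF: "is_ctx 1 C \<Longrightarrow>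
    rule_inst RuCBF []
      [plug C [NS (add_mset x X) \<Gamma> \<Delta> {#NS (add_mset x Y) \<Pi> \<Sigma> K#}]]
      (plug C [NS (add_mset x X) \<Gamma> \<Delta> {#NS Y \<Pi> \<Sigma> K#}])"
| RuBF: "is_ctx 1 C \<Longrightarrow>
    rule_inst RuBF []
      [plug C [NS (add_mset x X) \<Gamma> \<Delta> {#NS (add_mset x Y) \<Pi> \<Sigma> K#}]]
      (plug C [NS X \<Gamma> \<Delta> {#NS (add_mset x Y) \<Pi> \<Sigma> K#}])"
| RuUI: "is_ctx 1 C \<Longrightarrow>
    rule_inst RuUI [] [plug C [NS (add_mset x X) \<Gamma> \<Delta> {#}]] (plug C [NS X \<Gamma> \<Delta> {#}])"
| Ru5dom: "is_ctx 2 C \<Longrightarrow> hole_depth 0 C d \<Longrightarrow> d \<ge> 1 \<Longrightarrow> hole_depth 1 C e \<Longrightarrow> e \<ge> 1 \<Longrightarrow>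
    rule_inst Ru5dom []
      [plug C [NS (add_mset x X) \<Gamma> \<Delta> {#}, NS (add_mset x Y) \<Pi> \<Sigma> {#}]]
      (plug C [NS (add_mset x X) \<Gamma> \<Delta> {#}, NS Y \<Pi> \<Sigma> {#}])"

fun ax_rule :: "ax \<Rightarrow> rule" where
  "ax_rule D_ax = RuD"
| "ax_rule T_ax = RuT"
| "ax_rule B_ax = RuB"
| "ax_rule Four_ax = Ru4"
| "ax_rule Five_ax = Ru5"
| "ax_rule CBF_ax = RuCBF"
| "ax_rule BF_ax = RuBF"
| "ax_rule UI_ax = RuUI"

definition NQ :: "ax set \<Rightarrow> rule set" where
  "NQ L = {Init, LBot, LImp, RImp, LAll, RAll, LBox, RBox, Ref, Repl, ReplX, Rig} \<union> ax_rule ` L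
     \<union> (if Five_ax \<in> L \<and> {CBF_ax, BF_ax} \<inter> L \<noteq> {} then {Ru5dom} else {})"

section \<open>Derivations\<close>

datatype dtree = Infer (concl: nseq) rule "var list" "dtree list"

primrec height :: "dtree \<Rightarrow> nat" where
  "height (Infer S r ys ds) = Suc (Max (insert 0 (set (map height ds))))"

primrec eigenvars :: "dtree \<Rightarrow> var list" where
  "eigenvars (Infer S r ys ds) = ys @ concat (map eigenvars ds)"

text \<open>Every nested sequent in the tree belongs to the language given by \<open>Pr\<close> and is pure.\<close>

inductive inferences_ok :: "(nat \<Rightarrow> nat set) \<Rightarrow> ax set \<Rightarrow> dtree \<Rightarrow> bool" for Pr L where
  "r \<in> NQ L \<Longrightarrow> rule_inst r ys (map concl ds) S \<Longrightarrow> in_lang_ns Pr S \<Longrightarrow> pure_ns S \<Longrightarrow>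
   (\<forall>d\<in>set ds. inferences_ok Pr L d) \<Longrightarrow> inferences_ok Pr L (Infer S r ys ds)"

definition is_derivation :: "(nat \<Rightarrow> nat set) \<Rightarrow> ax set \<Rightarrow> dtree \<Rightarrow> bool" where
  "is_derivation Pr L d \<longleftrightarrow> inferences_ok Pr L d \<and> distinct (eigenvars d)"

text \<open>Since \<open>alpha_ns\<close> is reflexive, this covers derivations of \<open>S\<close> itself.\<close>

definition derivable_le :: "(nat \<Rightarrow> nat set) \<Rightarrow> ax set \<Rightarrow> nat \<Rightarrow> nseq \<Rightarrow> bool" where
  "derivable_le Pr L n S \<longleftrightarrow>
     (\<exists>d. is_derivation Pr L d \<and> alpha_ns S (concl d) \<and> height d \<le> n)"

end

theory Submission
  imports Defs
begin

text \<open>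
  A nested sequent is a finite tree with pairwise distinct labels at its nodes, hence a set of edges
  together with a multiset of labelled formulas and labelled signature variables. In this form a rule
  instance replaces a few labelled items by others, and two rule instances with the same conclusion
  interact only if they share a principal item. Every rule except \<open>L\<supset>\<close>, \<open>R\<supset>\<close>, \<open>R\<forall>\<close> and \<open>R\<box>\<close>
  is cumulative, so that its invertibility is weakening; those four have a single principal formula,
  which no other rule can have as principal, so it can be traced upwards through a derivation.

  All bookkeeping about variables is moved into the two translations. Formulas are taken up to
  renaming of bound variables (de Bruijn indices), and the labelled \<open>R\<forall>\<close> has one premiss for every
  variable of a fixed set \<open>Fr\<close>; these premisses are available because a derivation can be read under
  an arbitrary renaming of its free variables. On the way back, the bound variables are kept outside
  \<open>Fr\<close> and the eigenvariables are chosen in \<open>Fr\<close> one after the other, so all sequents are pure and all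
  eigenvariables are distinct.
\<close>

section \<open>Formulas with de Bruijn indices\<close>

text \<open>The obstacle is that a context is a tree of multisets: it does not name the nodes that a
  rule acts on, and equal subtrees cannot be told apart, so two instances with a common conclusion
  have no common coordinates. Distinct labels supply them. The second obstacle is purity: weakening
  or substituting in a derivation can clash with its eigenvariables, and each repair would call for
  a further height-preserving renaming. With a premiss for each variable of \<open>Fr\<close> no
  freshness is left to protect, so weakening and inversion are plain inductions; the infinite
  branching is harmless because \<open>lder\<close> carries a height bound and no tree. Likewise
  \<open>RBox\<close> and \<open>RuD\<close> have a premiss for each new label, so an inversion
  finds the very label it asks for. \<open>Fr\<close> has to be infinite, to supply eigenvariables,
  and co-infinite, to leave names for bound variables; the latter may be moved because derivability
  is up to alphabetical variants. Variables of the given derivation outside \<open>Fr\<close> are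
  sent into it by a renaming \<open>\<sigma>\<close> that fixes the free variables of the premiss at
  stake.\<close>

datatype dvar = Bnd nat | Fre var

datatype dfm = DRel nat "dvar list" | DEq dvar dvar | DBot | DImp dfm dfm | DAll dfm | DBox dfm

fun lift :: "dvar \<Rightarrow> dvar" where
  "lift (Bnd k) = Bnd (Suc k)"
| "lift (Fre x) = Fre x"

definition bind :: "(var \<Rightarrow> dvar) \<Rightarrow> var \<Rightarrow> var \<Rightarrow> dvar" where
  "bind e x = (lift \<circ> e)(x := Bnd 0)"

primrec db :: "(var \<Rightarrow> dvar) \<Rightarrow> fm \<Rightarrow> dfm" where
  "db e (Rel i xs) = DRel i (map e xs)"
| "db e (Eq x y) = DEq (e x) (e y)"
| "db e Bot = DBot"
| "db e (Imp A B) = DImp (db e A) (db e B)"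
| "db e (All x A) = DAll (db (bind e x) A)"
| "db e (Box A) = DBox (db e A)"

fun instv :: "nat \<Rightarrow> var \<Rightarrow> dvar \<Rightarrow> dvar" where
  "instv k z (Bnd j) = (if j = k then Fre z else Bnd j)"
| "instv k z (Fre x) = Fre x"

primrec inst :: "var \<Rightarrow> nat \<Rightarrow> dfm \<Rightarrow> dfm" where
  "inst z k (DRel i xs) = DRel i (map (instv k z) xs)"
| "inst z k (DEq x y) = DEq (instv k z x) (instv k z y)"
| "inst z k DBot = DBot"
| "inst z k (DImp A B) = DImp (inst z k A) (inst z k B)"
| "inst z k (DAll A) = DAll (inst z (Suc k) A)"
| "inst z k (DBox A) = DBox (inst z k A)"

fun datomic :: "dfm \<Rightarrow> bool" where
  "datomic (DRel i xs) = True"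
| "datomic (DEq x y) = True"
| "datomic _ = False"

fun dvfree :: "dvar \<Rightarrow> var set" where
  "dvfree (Fre x) = {x}"
| "dvfree (Bnd k) = {}"

primrec dfv :: "dfm \<Rightarrow> var set" where
  "dfv (DRel i xs) = \<Union>(dvfree ` set xs)"
| "dfv (DEq x y) = dvfree x \<union> dvfree y"
| "dfv DBot = {}"
| "dfv (DImp A B) = dfv A \<union> dfv B"
| "dfv (DAll A) = dfv A"
| "dfv (DBox A) = dfv A"

primrec dlang :: "(nat \<Rightarrow> nat set) \<Rightarrow> dfm \<Rightarrow> bool" where
  "dlang Pr (DRel i xs) \<longleftrightarrow> i \<in> Pr (length xs)"
| "dlang Pr (DEq x y) \<longleftrightarrow> True"
| "dlang Pr DBot \<longleftrightarrow> True"
| "dlang Pr (DImp A B) \<longleftrightarrow> dlang Pr A \<and> dlang Pr B"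
| "dlang Pr (DAll A) \<longleftrightarrow> dlang Pr A"
| "dlang Pr (DBox A) \<longleftrightarrow> dlang Pr A"

lemma finite_fv [simp]: "finite (fv A)"
  by (induction A) auto

lemma db_cong: "(\<And>x. x \<in> fv A \<Longrightarrow> e x = e' x) \<Longrightarrow> db e A = db e' A"
proof (induction A arbitrary: e e')
  case (All x A)
  have "bind e x v = bind e' x v" if "v \<in> fv A" for v
    using All.prems[of v] that by (simp add: bind_def)
  then have "db (bind e x) A = db (bind e' x) A" by (rule All.IH)
  then show ?case by simp
next
  case (Imp A B)
  have "db e A = db e' A" by (rule Imp.IH) (simp add: Imp.prems)
  moreover have "db e B = db e' B" by (rule Imp.IH) (simp add: Imp.prems)
  ultimately show ?case by simp
next
  case (Box A)
  have "db e A = db e' A" by (rule Box.IH) (simp add: Box.prems)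
  then show ?case by simp
qed simp_all

lemma fresh_Least: "finite F \<Longrightarrow> (LEAST w. w \<notin> F) \<notin> F" for F :: "nat set"
  using LeastI_ex[of "\<lambda>w. w \<notin> F"] ex_new_if_finite[OF infinite_UNIV_nat] by blast

text \<open>Hides the \<open>LEAST\<close> of the definition: later arguments only need that the
  chosen bound variable captures nothing and that no renaming happens without cause.\<close>

lemma psubst_All:
  obtains w where "psubst \<sigma> (All x A) = All w (psubst (\<sigma>(x := w)) A)" "w \<notin> \<sigma> ` (fv A - {x})"
    "x \<notin> \<sigma> ` (fv A - {x}) \<Longrightarrow> w = x"
proof
  let ?F = "\<sigma> ` (fv A - {x})"
  let ?w = "if x \<in> ?F then (LEAST w. w \<notin> ?F) else x"
  show "psubst \<sigma> (All x A) = All ?w (psubst (\<sigma>(x := ?w)) A)" by (simp only: psubst.simps Let_def)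
  have "(LEAST w. w \<notin> ?F) \<notin> ?F" by (rule fresh_Least) simp
  then show "?w \<notin> ?F" by (auto simp del: image_iff)
  show "?w = x" if "x \<notin> ?F" using that by (simp only: if_False)
qed

lemma db_psubst: "db e (psubst \<sigma> A) = db (e \<circ> \<sigma>) A"
proof (induction A arbitrary: e \<sigma>)
  case (All x A)
  obtain w where w: "psubst \<sigma> (All x A) = All w (psubst (\<sigma>(x := w)) A)" "w \<notin> \<sigma> ` (fv A - {x})"
    by (rule psubst_All)
  \<comment> \<open>Both environments agree on \<open>fv A\<close>: among the images of these
    variables \<open>w\<close> comes from \<open>x\<close> alone, so overwriting \<open>e\<close> at
    \<open>w\<close> disturbs no other variable.\<close>
  have "db (bind e w \<circ> \<sigma>(x := w)) A = db (bind (e \<circ> \<sigma>) x) A"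
    using w(2) by (intro db_cong) (auto simp: bind_def)
  then show ?case unfolding w(1) by (simp add: All comp_def)
qed auto

lemma db_subst: "db e (subst A y x) = db (e(x := e y)) A"
  unfolding subst_def db_psubst by (intro db_cong) auto

lemma lift_instv: "lift (instv k z d) = instv (Suc k) z (lift d)"
  by (cases d) auto

lemma inst_db: "inst z k (db e A) = db (instv k z \<circ> e) A"
proof (induction A arbitrary: k e)
  case (All x A)
  have "instv (Suc k) z \<circ> bind e x = bind (instv k z \<circ> e) x"
    by (auto simp: bind_def lift_instv)
  then show ?case by (simp add: All comp_def)
qed auto

lemma inst_db_bind: "inst z 0 (db (bind (Fre \<circ> \<sigma>) x) A) = db (Fre \<circ> \<sigma>(x := z)) A"
  unfolding inst_db by (intro db_cong) (auto simp: bind_def)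

text \<open>The bridge for both quantifier rules: reading an instance under a renaming is
  instantiating the body at the renamed variable, whatever bound names \<open>subst\<close> had to
  change.\<close>

lemma db_subst_inst: "db (Fre \<circ> \<sigma>) (subst A y x) = inst (\<sigma> y) 0 (db (bind (Fre \<circ> \<sigma>) x) A)"
  unfolding inst_db_bind db_subst by (intro db_cong) auto

lemma alpha_db: "alpha A B \<Longrightarrow> db e A = db e B"
proof (induction arbitrary: e rule: alpha.induct)
  case (alpha_rename y A x)
  then show ?case
    by (auto simp: db_subst intro!: db_cong) (auto simp: bind_def)
qed auto

lemma in_lang_db: "in_lang Pr A \<longleftrightarrow> dlang Pr (db e A)"
  by (induction A arbitrary: e) auto

lemma in_lang_subst: "dlang Pr (inst z k a) \<longleftrightarrow> dlang Pr a"
  by (induction a arbitrary: k) auto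

lemma dfv_inst: "dfv (inst z k a) \<subseteq> insert z (dfv a)"
proof (induction a arbitrary: k)
  case (DRel i xs)
  have "dvfree (instv k z d) \<subseteq> insert z (dvfree d)" for d by (cases d) auto
  then show ?case by fastforce
next
  case (DEq x y)
  have "dvfree (instv k z d) \<subseteq> insert z (dvfree d)" for d by (cases d) auto
  then show ?case by fastforce
next
  case (DImp a b)
  then show ?case by simp blast
qed simp_all

lemma dfv_db: "dfv (db e A) = (\<Union>x\<in>fv A. dvfree (e x))"
proof (induction A arbitrary: e)
  case (All x A)
  have "dvfree (lift d) = dvfree d" for d by (cases d) auto
  then show ?case using All by (auto simp: bind_def split: if_splits)
qed auto

lemma datomic_db [simp]: "datomic (db e A) \<longleftrightarrow> atomic A"
  by (cases A) auto

text \<open>\<open>Init\<close> and \<open>Repl\<close> ask for literal equality of formulas, while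
  labelled items know formulas only up to alphabetical variance. On atomic formulas the two agree,
  since nothing is bound.\<close>

lemma db_eq_atomic: "atomic A \<Longrightarrow> db Fre A = db Fre B \<Longrightarrow> A = B"
  by (cases A; cases B) (simp_all add: inj_map_eq_map inj_def)

section \<open>Bound variables under substitution, and variants with prescribed bound
  variables\<close>

lemma bv_psubst:
  "(\<And>v. \<sigma> v = v \<or> \<sigma> v \<notin> bv A) \<Longrightarrow> bv (psubst \<sigma> A) = bv A"
proof (induction A arbitrary: \<sigma>)
  case (All x A)
  obtain w where w: "psubst \<sigma> (All x A) = All w (psubst (\<sigma>(x := w)) A)"
    "x \<notin> \<sigma> ` (fv A - {x}) \<Longrightarrow> w = x"
    using psubst_All[of \<sigma> x A] by metis
  \<comment> \<open>A variable that is moved never lands on a bound one, so \<open>x\<close>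
    captures nothing and the renaming branch of \<open>psubst\<close> is not entered.\<close>
  have "\<sigma> v \<noteq> x" if "v \<noteq> x" for v using All.prems[of v] that by auto
  then have "x \<notin> \<sigma> ` (fv A - {x})" by fastforce
  then have "w = x" by (rule w(2))
  moreover have "bv (psubst (\<sigma>(x := x)) A) = bv A"
    using All.prems by (intro All.IH) auto
  ultimately show ?case using w(1) by simp
next
  case (Imp A B)
  have "bv (psubst \<sigma> A) = bv A" "bv (psubst \<sigma> B) = bv B"
    using Imp.prems by (auto intro!: Imp.IH)
  then show ?case by simp
qed simp_all

lemma bv_subst: "y \<notin> bv A \<Longrightarrow> bv (subst A y x) = bv A"
  unfolding subst_def by (rule bv_psubst) auto

lemma finite_bv [simp]: "finite (bv A)"
  by (induction A) auto

lemma ex_alpha_bv_avoid: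
  assumes "infinite U"
  shows "\<exists>B. alpha A B \<and> bv B \<subseteq> U"
proof (induction A)
  case (All x A)
  then obtain B where B: "alpha A B" "bv B \<subseteq> U" by blast
  \<comment> \<open>Outside \<open>fv B\<close> to make the renaming legal; outside
    \<open>bv B\<close> so that \<open>subst\<close> renames nothing further and brings in no bound
    name from outside \<open>U\<close>.\<close>
  obtain y where y: "y \<in> U" "y \<notin> fv B \<union> bv B"
    using assms infinite_super[of U "fv B \<union> bv B"] by auto
  have "alpha (All x A) (All y (subst B y x))"
    using alpha_trans[OF alpha_All[OF B(1)] alpha_rename[of y B x]] y by simp
  moreover have "bv (All y (subst B y x)) \<subseteq> U" using y B(2) by (simp add: bv_subst)
  ultimately show ?case by blast
next
  case (Imp A1 A2)
  then show ?case using alpha_Imp by (metis Un_subset_iff bv.simps(4))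
next
  case (Box A)
  then show ?case using alpha_Box by (metis bv.simps(6))
qed (auto intro!: exI alpha_refl)

text \<open>\<open>p\<close> and \<open>q\<close> are \<open>P(x/z)\<close> and \<open>P(y/z)\<close> for an atomic \<open>P\<close>; the renaming \<open>\<tau>\<close> makes
  the relation invariant under renaming.\<close>
definition drepl :: "var \<Rightarrow> var \<Rightarrow> dfm \<Rightarrow> dfm \<Rightarrow> bool" where
  "drepl x y p q \<longleftrightarrow> (\<exists>P \<tau> z. atomic P \<and>
     p = db (Fre \<circ> \<tau>(z := x)) P \<and> q = db (Fre \<circ> \<tau>(z := y)) P)"

lemma drepl_subst:
  "atomic P \<Longrightarrow> drepl (\<sigma> x) (\<sigma> y) (db (Fre \<circ> \<sigma>) (subst P x z)) (db (Fre \<circ> \<sigma>) (subst P y z))"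
  unfolding drepl_def db_subst by (intro exI[of _ P] exI[of _ \<sigma>] exI[of _ z]) (auto intro!: db_cong)

lemma psubst_psubst_atomic:
  "atomic P \<Longrightarrow> (\<And>v. v \<in> fv P \<Longrightarrow> \<tau> (\<sigma> v) = \<rho> v) \<Longrightarrow> psubst \<tau> (psubst \<sigma> P) = psubst \<rho> P"
  by (cases P) auto

lemma drepl_pullback:
  assumes "drepl x y (db Fre A) q"
  obtains P z where "atomic P" "A = subst P x z" "q = db Fre (subst P y z)"
proof -
  obtain P \<tau> z where P: "atomic P" "db Fre A = db Fre (psubst (\<tau>(z := x)) P)"
      "q = db Fre (psubst (\<tau>(z := y)) P)"
    using assms unfolding drepl_def db_psubst by auto
  \<comment> \<open>The renaming \<open>\<tau>\<close> may send other variables of \<open>P\<close>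
    to \<open>z\<close>, which would then be replaced too. A placeholder outside the image of
    \<open>\<tau>\<close> keeps the marked positions apart.\<close>
  obtain z' where z': "z' \<notin> \<tau> ` fv P"
    using ex_new_if_finite[OF infinite_UNIV_nat, of "\<tau> ` fv P"] by auto
  have eq: "subst (psubst (\<tau>(z := z')) P) v z' = psubst (\<tau>(z := v)) P" for v
    unfolding subst_def using z' P(1) by (intro psubst_psubst_atomic) auto
  have at: "atomic (psubst \<rho> P)" for \<rho> using P(1) by (cases P) auto
  show thesis
  proof
    show "A = subst (psubst (\<tau>(z := z')) P) x z'"
      unfolding eq using db_eq_atomic[OF at P(2)[symmetric]] by simp
    show "q = db Fre (subst (psubst (\<tau>(z := z')) P) y z')" unfolding eq P(3) ..
  qed (rule at)
qed

lemma drepl_lang: "drepl x y p q \<Longrightarrow> dlang Pr p \<Longrightarrow> dlang Pr q"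
  unfolding drepl_def by (auto simp: in_lang_db[symmetric])

lemma drepl_dfv: "drepl x y p q \<Longrightarrow> dfv q \<subseteq> insert y (dfv p)"
  unfolding drepl_def by (auto simp: dfv_db split: if_splits)

section \<open>Items and trees\<close>

text \<open>One type for the three components of a node, so that every rule exchanges parts of a
  single multiset, whichever side it touches.\<close>

datatype 'f item = Sg var | An 'f | Sc 'f

definition items :: "var multiset \<Rightarrow> 'f multiset \<Rightarrow> 'f multiset \<Rightarrow> 'f item multiset" where
  "items X \<Gamma> \<Delta> = image_mset Sg X + image_mset An \<Gamma> + image_mset Sc \<Delta>"

definition sigs :: "'f item multiset \<Rightarrow> var multiset" where
  "sigs A = \<Sum>\<^sub># (image_mset (\<lambda>a. case a of Sg x \<Rightarrow> {#x#} | _ \<Rightarrow> {#}) A)"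

definition antes :: "'f item multiset \<Rightarrow> 'f multiset" where
  "antes A = \<Sum>\<^sub># (image_mset (\<lambda>a. case a of An x \<Rightarrow> {#x#} | _ \<Rightarrow> {#}) A)"

definition succs :: "'f item multiset \<Rightarrow> 'f multiset" where
  "succs A = \<Sum>\<^sub># (image_mset (\<lambda>a. case a of Sc x \<Rightarrow> {#x#} | _ \<Rightarrow> {#}) A)"

lemma parts_simps [simp]:
  "sigs {#} = {#}" "antes {#} = {#}" "succs {#} = {#}"
  "sigs (A + B) = sigs A + sigs B" "antes (A + B) = antes A + antes B" "succs (A + B) = succs A + succs B"
  "sigs (add_mset (Sg x) A) = add_mset x (sigs A)" "sigs (add_mset (An f) A) = sigs A"
  "sigs (add_mset (Sc f) A) = sigs A" "antes (add_mset (Sg x) A) = antes A"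
  "antes (add_mset (An f) A) = add_mset f (antes A)" "antes (add_mset (Sc f) A) = antes A"
  "succs (add_mset (Sg x) A) = succs A" "succs (add_mset (An f) A) = succs A"
  "succs (add_mset (Sc f) A) = add_mset f (succs A)"
  by (auto simp: sigs_def antes_def succs_def)

lemma items_empty [simp]: "items {#} {#} {#} = {#}"
  by (simp add: items_def)

lemma items_add [simp]:
  "items (add_mset x X) \<Gamma> \<Delta> = add_mset (Sg x) (items X \<Gamma> \<Delta>)"
  "items X (add_mset A \<Gamma>) \<Delta> = add_mset (An A) (items X \<Gamma> \<Delta>)"
  "items X \<Gamma> (add_mset A \<Delta>) = add_mset (Sc A) (items X \<Gamma> \<Delta>)"
  by (simp_all add: items_def)

lemma items_parts [simp]: "items (sigs A) (antes A) (succs A) = A"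
proof (induction A)
  case (add a A)
  then show ?case by (cases a) simp_all
qed simp

lemma parts_items [simp]:
  "sigs (items X \<Gamma> \<Delta>) = X" "antes (items X \<Gamma> \<Delta>) = \<Gamma>" "succs (items X \<Gamma> \<Delta>) = \<Delta>"
proof -
  have [simp]: "sigs (image_mset Sg X) = X" "sigs (image_mset An \<Gamma>) = {#}" "sigs (image_mset Sc \<Delta>) = {#}" for X \<Gamma> \<Delta>
    by (induction X; induction \<Gamma>; induction \<Delta>; simp)+
  have [simp]: "antes (image_mset Sg X) = {#}" "antes (image_mset An \<Gamma>) = \<Gamma>" "antes (image_mset Sc \<Delta>) = {#}" for X \<Gamma> \<Delta>
    by (induction X; induction \<Gamma>; induction \<Delta>; simp)+
  have [simp]: "succs (image_mset Sg X) = {#}" "succs (image_mset An \<Gamma>) = {#}" "succs (image_mset Sc \<Delta>) = \<Delta>" for X \<Gamma> \<Delta>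
    by (induction X; induction \<Gamma>; induction \<Delta>; simp)+
  show "sigs (items X \<Gamma> \<Delta>) = X" "antes (items X \<Gamma> \<Delta>) = \<Gamma>" "succs (items X \<Gamma> \<Delta>) = \<Delta>"
    by (simp_all add: items_def)
qed

section \<open>Items placed at labelled nodes\<close>

definition at :: "('l \<times> 'a) multiset \<Rightarrow> 'l \<Rightarrow> 'a multiset" where
  "at M l = image_mset snd (filter_mset (\<lambda>p. fst p = l) M)"

definition put :: "'l \<Rightarrow> 'a multiset \<Rightarrow> ('l \<times> 'a) multiset" where
  "put w A = image_mset (Pair w) A"

lemma at_simps [simp]:
  "at {#} l = {#}" "at (M + N) l = at M l + at N l"
  "at (add_mset p M) l = (if fst p = l then add_mset (snd p) (at M l) else at M l)"
  by (auto simp: at_def)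

lemma at_put [simp]: "at (put w A) l = (if l = w then A else {#})"
  by (induction A) (auto simp: put_def)

lemma put_simps [simp]: "put w {#} = {#}" "put w (A + B) = put w A + put w B"
  "put w (add_mset a A) = add_mset (w, a) (put w A)"
  by (auto simp: put_def)

lemma mem_at [simp]: "a \<in># at M l \<longleftrightarrow> (l, a) \<in># M"
  by (force simp: at_def)

lemma set_put [simp]: "set_mset (put w A) = Pair w ` set_mset A"
  by (simp add: put_def)

text \<open>What is displayed at a node can be cut out of the global multiset; the remainder serves
  as the items of the context.\<close>

lemma at_eq_add:
  assumes "at M w = B + A"
  obtains M0 where "M = M0 + put w A" "at M0 w = B"
proof -
  have "M = filter_mset (\<lambda>p. fst p \<noteq> w) M + filter_mset (\<lambda>p. fst p = w) M"
    using multiset_partition[of M "\<lambda>p. fst p \<noteq> w"] by simp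
  also have "filter_mset (\<lambda>p. fst p = w) M = put w (at M w)"
    unfolding put_def at_def multiset.map_comp comp_def
    by (rule sym) (rule trans[OF image_mset_cong[where g = id]], auto)
  finally have *: "M = (filter_mset (\<lambda>p. fst p \<noteq> w) M + put w B) + put w A"
    using assms by (simp add: ac_simps)
  have "at (filter_mset (\<lambda>p. fst p \<noteq> w) M) w = {#}" by (simp add: at_def filter_filter_mset)
  then show thesis using that[OF *] by simp
qed

text \<open>Nested sequents, contexts and labellings are decorations of one and the same kind of
  unordered tree, so the map function and the relator of this datatype transport data between
  them.\<close>

datatype 'a tr = Tr (lab: 'a) "'a tr multiset"

primrec ns :: "fm item multiset tr \<Rightarrow> nseq" where
  "ns (Tr A K) = NS (sigs A) (antes A) (succs A) (image_mset ns K)"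

primrec tree :: "nseq \<Rightarrow> fm item multiset tr" where
  "tree (NS X \<Gamma> \<Delta> K) = Tr (items X \<Gamma> \<Delta>) (image_mset tree K)"

lemma ns_tree [simp]: "ns (tree S) = S"
  by (induction S) (simp add: multiset.map_comp comp_def cong: image_mset_cong)

lemma tree_ns [simp]: "tree (ns t) = t"
  by (induction t) (simp add: multiset.map_comp comp_def cong: image_mset_cong)

primrec ctree :: "(fm item multiset \<times> nat multiset) tr \<Rightarrow> ctx" where
  "ctree (Tr p K) = Ctx (sigs (fst p)) (antes (fst p)) (succs (fst p)) (snd p) (image_mset ctree K)"

primrec labels :: "'a tr \<Rightarrow> 'a multiset" where
  "labels (Tr l K) = add_mset l (\<Sum>\<^sub># (image_mset labels K))"

primrec edges :: "'a tr \<Rightarrow> ('a \<times> 'a) set" where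
  "edges (Tr l K) = (\<Union>k\<in>set_mset K. {(l, lab k)}) \<union> \<Union>(set_mset (image_mset edges K))"

text \<open>Distinctness has to be stated for the multiset of labels, as \<open>set_tr\<close>
  forgets repetitions and the children have no order to list them in.\<close>

definition uniq :: "'a multiset \<Rightarrow> bool" where
  "uniq N \<longleftrightarrow> (\<forall>x. count N x \<le> 1)"

lemma set_labels [simp]: "set_mset (labels t) = set_tr t"
  by (induction t) auto

lemma uniq_add [simp]: "uniq (add_mset x N) \<longleftrightarrow> x \<notin># N \<and> uniq N"
proof -
  have "(\<forall>y. count (add_mset x N) y \<le> 1) \<longleftrightarrow> count N x = 0 \<and> (\<forall>y. count N y \<le> 1)"
    (is "?l \<longleftrightarrow> ?r")
  proof
    assume l: ?l
    have "count N x = 0" using l[rule_format, of x] by simp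
    moreover have "count N y \<le> 1" for y using l[rule_format, of y] by (simp split: if_splits)
    ultimately show ?r by blast
  qed auto
  then show ?thesis by (simp add: uniq_def not_in_iff)
qed

lemma uniq_plus: "uniq (M + N) \<longleftrightarrow> uniq M \<and> uniq N \<and> set_mset M \<inter> set_mset N = {}"
proof (induction M)
  case empty
  then show ?case by (simp add: uniq_def)
next
  case (add x M)
  then show ?case by auto
qed

lemma labels_map: "labels (map_tr f t) = image_mset f (labels t)"
proof (induction t)
  case (Tr l K)
  have "image_mset (labels \<circ> map_tr f) K = image_mset (image_mset f \<circ> labels) K"
    by (rule image_mset_cong) (simp add: Tr)
  moreover have "\<Sum>\<^sub># (image_mset (image_mset f \<circ> labels) K) = image_mset f (\<Sum>\<^sub># (image_mset labels K))"
    by (induction K) auto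
  ultimately show ?case by (simp add: multiset.map_comp)
qed

text \<open>When the first components are distinct, a tree of pairs is the graph of a function. From
  here on decorations can be handled as functions of labels.\<close>

lemma uniq_decoration:
  assumes "uniq (labels (map_tr fst y))"
  obtains g where "y = map_tr (\<lambda>l. (l, g l)) (map_tr fst y)"
proof -
  have *: "uniq (image_mset fst N) \<Longrightarrow> p \<in># N \<Longrightarrow> q \<in># N \<Longrightarrow> fst p = fst q \<Longrightarrow> p = q" for p q and N :: "('a \<times> 'b) multiset"
    by (induction N) auto
  have inj: "p = q" if "p \<in> set_tr y" "q \<in> set_tr y" "fst p = fst q" for p q
    using *[of "labels y"] assms that by (simp add: labels_map)
  define g where "g l = snd (SOME p. p \<in> set_tr y \<and> fst p = l)" for l
  have "(fst p, g (fst p)) = p" if "p \<in> set_tr y" for p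
  proof -
    have "(SOME q. q \<in> set_tr y \<and> fst q = fst p) = p"
      using inj that by (intro some_equality) auto
    then show ?thesis by (simp add: g_def)
  qed
  then have "map_tr (\<lambda>p. (fst p, g (fst p))) y = map_tr id y"
    by (intro tr.map_cong0) simp
  then show thesis by (intro that[of g]) (simp add: tr.map_comp comp_def tr.map_id)
qed

text \<open>The relator only provides some matching of unordered children; the distinct labels turn
  this matching into a function \<open>g\<close>.\<close>

lemma rel_tr_decoration:
  assumes "rel_tr R T s" "uniq (labels T)"
  obtains g where "s = map_tr g T" "\<And>l. l \<in> set_tr T \<Longrightarrow> R l (g l)"
proof -
  obtain y where y: "set_tr y \<subseteq> {(x, y). R x y}" "map_tr fst y = T" "map_tr snd y = s"
    using assms(1) unfolding tr.in_rel by auto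
  obtain g where g: "y = map_tr (\<lambda>l. (l, g l)) T"
    using uniq_decoration[of y] assms(2) y(2) by metis
  have "s = map_tr g T" using y(3) by (subst (asm) g) (simp add: tr.map_comp comp_def)
  moreover have "R l (g l)" if "l \<in> set_tr T" for l
    using y(1) that by (subst (asm) g) (auto simp: tr.set_map)
  ultimately show thesis using that by blast
qed

lemma lab_map [simp]: "lab (map_tr f t) = f (lab t)"
  by (cases t) simp

lemma lab_in_set [simp]: "lab t \<in> set_tr t"
  by (cases t) simp

lemma set_tr_edges: "set_tr t = insert (lab t) (Range (edges t))"
proof (induction t)
  case (Tr l K)
  then show ?case by (auto 4 4 simp: Range_iff)
qed

text \<open>Grafts the trees \<open>q a\<close> as further children, which is what filling holes
  does to the shape of a context. The map \<open>p\<close> allows the trees to be grafted to be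
  stored in the labels and stripped at the same time.\<close>

primrec attach :: "('a \<Rightarrow> 'b) \<Rightarrow> ('a \<Rightarrow> 'b tr multiset) \<Rightarrow> 'a tr \<Rightarrow> 'b tr" where
  "attach p q (Tr a K) = Tr (p a) (image_mset (attach p q) K + q a)"

abbreviation grow :: "('a \<Rightarrow> 'a tr multiset) \<Rightarrow> 'a tr \<Rightarrow> 'a tr" where
  "grow \<equiv> attach (\<lambda>l. l)"

lemma attach_map: "attach p q (map_tr g t) = attach (p \<circ> g) (q \<circ> g) t"
  by (induction t) (simp add: multiset.map_comp comp_def cong: image_mset_cong)

lemma attach_cong: "(\<And>l. l \<in> set_tr t \<Longrightarrow> q l = q' l) \<Longrightarrow> attach p q t = attach p q' t"
  by (induction t) (auto intro!: image_mset_cong)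

lemma attach_empty: "grow (\<lambda>l. {#}) t = t"
  by (induction t) (simp cong: image_mset_cong)

lemma lab_attach [simp]: "lab (attach p q t) = p (lab t)"
  by (cases t) simp

lemma labels_attach: "labels (grow \<kappa> t) = labels t + (\<Sum>l\<in>#labels t. \<Sum>k\<in>#\<kappa> l. labels k)"
proof (induction t)
  case (Tr l K)
  have "image_mset (labels \<circ> grow \<kappa>) K = image_mset (\<lambda>t. labels t + (\<Sum>l\<in>#labels t. \<Sum>k\<in>#\<kappa> l. labels k)) K"
    by (rule image_mset_cong) (simp add: Tr)
  moreover have "\<Sum>\<^sub># (image_mset (\<lambda>t. labels t + (\<Sum>l\<in>#labels t. \<Sum>k\<in>#\<kappa> l. labels k)) K)
    = \<Sum>\<^sub># (image_mset labels K) + (\<Sum>l\<in>#\<Sum>\<^sub># (image_mset labels K). \<Sum>k\<in>#\<kappa> l. labels k)"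
    by (induction K) (auto simp: ac_simps)
  ultimately show ?case by (simp add: multiset.map_comp ac_simps)
qed

lemma edges_attach:
  "edges (grow \<kappa> t) = edges t \<union> (\<Union>l\<in>set_tr t. \<Union>k\<in>set_mset (\<kappa> l). insert (l, lab k) (edges k))"
proof (induction t)
  case (Tr l K)
  have "\<Union>(edges ` grow \<kappa> ` set_mset K) = (\<Union>t\<in>set_mset K. edges t) \<union>
    (\<Union>t\<in>set_mset K. \<Union>l\<in>set_tr t. \<Union>k\<in>set_mset (\<kappa> l). insert (l, lab k) (edges k))"
    using Tr by (simp add: UN_Un_distrib cong: SUP_cong)
  then show ?case by (simp add: UN_Un_distrib Un_ac) (auto simp: image_iff)
qed

section \<open>Nested sequents and contexts as decorated trees\<close>

definition nest :: "('l \<Rightarrow> fm item multiset) \<Rightarrow> 'l tr \<Rightarrow> nseq" where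
  "nest c T = ns (map_tr c T)"

definition node_items :: "nseq \<Rightarrow> fm item multiset" where
  "node_items S = items (sig S) (ante S) (succ S)"

lemma node_items_NS [simp]: "node_items (NS X \<Gamma> \<Delta> K) = items X \<Gamma> \<Delta>"
  by (simp add: node_items_def)

lemma nest_Tr [simp]:
  "nest c (Tr l K) = NS (sigs (c l)) (antes (c l)) (succs (c l)) (image_mset (nest c) K)"
proof -
  have "nest c = (\<lambda>k. ns (map_tr c k))" by (simp add: nest_def fun_eq_iff)
  then show ?thesis by (simp add: multiset.map_comp comp_def)
qed

lemma nest_cong: "(\<And>l. l \<in> set_tr T \<Longrightarrow> c l = c' l) \<Longrightarrow> nest c T = nest c' T"
  unfolding nest_def by (metis tr.map_cong0)

lemma parts_sum_node_items [simp]: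
  "sigs (\<Sum>h\<in>#H. node_items (f h)) = (\<Sum>h\<in>#H. sig (f h))"
  "antes (\<Sum>h\<in>#H. node_items (f h)) = (\<Sum>h\<in>#H. ante (f h))"
  "succs (\<Sum>h\<in>#H. node_items (f h)) = (\<Sum>h\<in>#H. succ (f h))"
  by (induction H) (simp_all add: node_items_def)

text \<open>\<open>fill\<close> works at each node separately: it adds the items of the fillers
  there and grafts their children. So on decorated trees it is pointwise addition combined with
  \<open>grow\<close>.\<close>

lemma fill_ctree:
  assumes "\<And>l. l \<in> set_tr T \<Longrightarrow> c l = c0 l + (\<Sum>h\<in>#H l. node_items (f h))"
    and "\<And>l. l \<in> set_tr T \<Longrightarrow> image_mset (nest c) (\<kappa> l) = (\<Sum>h\<in>#H l. kids (f h))"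
  shows "fill f (ctree (map_tr (\<lambda>l. (c0 l, H l)) T)) = nest c (grow \<kappa> T)"
  using assms
proof (induction T)
  case (Tr l K)
  have "image_mset (\<lambda>k. fill f (ctree (map_tr (\<lambda>l. (c0 l, H l)) k))) K = image_mset (\<lambda>k. nest c (grow \<kappa> k)) K"
    by (rule image_mset_cong) (rule Tr.IH, auto intro!: Tr.prems)
  then show ?case using Tr.prems[of l] by (simp add: multiset.map_comp comp_def)
qed

text \<open>Equal images of two multisets come from a pairing of their elements; \<open>Z\<close> is
  that pairing. It is needed because children are unordered.\<close>

lemma image_mset_eq_image_msetD:
  assumes "image_mset f A = image_mset g B"
  obtains Z where "A = image_mset fst Z" "B = image_mset snd Z"
    "\<And>z. z \<in># Z \<Longrightarrow> f (fst z) = g (snd z)"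
proof -
  have "rel_mset (=) (image_mset f A) (image_mset g B)"
    using assms by (simp add: multiset.rel_eq)
  then have "rel_mset (\<lambda>x y. f x = g y) A B" by (simp add: multiset.rel_map)
  then show thesis using that unfolding multiset.in_rel by fastforce
qed

lemma item_mset_eqI: "sigs A = sigs B \<Longrightarrow> antes A = antes B \<Longrightarrow> succs A = succs B \<Longrightarrow> A = B"
  by (metis items_parts)

text \<open>Converse of \<open>fill_ctree\<close>: a context that yields the sequent can be laid
  over its labelled tree. Each node of \<open>Y\<close> carries its label, the children due to hole
  fillers, the items due to the context and the holes located there.\<close>

lemma unfill:
  assumes "nest c T = fill f C"
  shows "\<exists>Y :: ('l \<times> 'l tr multiset \<times> fm item multiset \<times> nat multiset) tr.
    C = ctree (map_tr (\<lambda>p. snd (snd p)) Y) \<and> T = attach fst (\<lambda>p. fst (snd p)) Y \<and>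
    (\<forall>(l, k, A, H) \<in> set_tr Y. c l = A + (\<Sum>h\<in>#H. node_items (f h)) \<and>
      image_mset (nest c) k = (\<Sum>h\<in>#H. kids (f h)))"
  (is "\<exists>Y. ?Q T C Y")
  using assms
proof (induction C arbitrary: T)
  case (Ctx X \<Gamma> \<Delta> H KC)
  obtain l K where T: "T = Tr l K" by (cases T)
  have K: "image_mset (nest c) K = image_mset (fill f) KC + (\<Sum>h\<in>#H. kids (f h))"
    and parts: "sigs (c l) = X + (\<Sum>h\<in>#H. sig (f h))" "antes (c l) = \<Gamma> + (\<Sum>h\<in>#H. ante (f h))"
      "succs (c l) = \<Delta> + (\<Sum>h\<in>#H. succ (f h))"
    using Ctx.prems unfolding T by simp_all
  \<comment> \<open>The children of a node are either children of the context or brought in by the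
    fillers; the union on the right induces a splitting of \<open>K\<close>.\<close>
  obtain K1 K2 where K12: "K = K1 + K2" "image_mset (nest c) K1 = image_mset (fill f) KC"
      "image_mset (nest c) K2 = (\<Sum>h\<in>#H. kids (f h))"
    using image_mset_eq_plusD[OF K] by metis
  obtain Z where Z: "K1 = image_mset fst Z" "KC = image_mset snd Z"
      "\<And>z. z \<in># Z \<Longrightarrow> nest c (fst z) = fill f (snd z)"
    using image_mset_eq_image_msetD[OF K12(2)] by blast
  have "\<forall>z\<in>set_mset Z. \<exists>Y. ?Q (fst z) (snd z) Y"
    using Ctx.IH Z by auto
  then obtain y where y: "\<And>z. z \<in># Z \<Longrightarrow> ?Q (fst z) (snd z) (y z)"
    unfolding bchoice_iff by blast
  have cl: "c l = items X \<Gamma> \<Delta> + (\<Sum>h\<in>#H. node_items (f h))"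
    by (rule item_mset_eqI) (simp_all add: parts)
  have "image_mset snd Z = image_mset (\<lambda>z. ctree (map_tr (\<lambda>p. snd (snd p)) (y z))) Z"
    "image_mset fst Z = image_mset (\<lambda>z. attach fst (\<lambda>p. fst (snd p)) (y z)) Z"
    using y by (auto intro!: image_mset_cong)
  then have "?Q T (Ctx X \<Gamma> \<Delta> H KC) (Tr (l, K2, items X \<Gamma> \<Delta>, H) (image_mset y Z))"
    using y cl K12(3) unfolding T Z K12(1) by (auto simp: multiset.map_comp comp_def)
  then show ?case by blast
qed

lemma uniq_subset: "M \<subseteq># N \<Longrightarrow> uniq N \<Longrightarrow> uniq M"
  by (auto simp: uniq_plus mset_subset_eq_exists_conv)

lemma labels_subset_attach: "labels (map_tr p t) \<subseteq># labels (attach p q t)"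
proof (induction t)
  case (Tr a K)
  have "\<Sum>\<^sub># (image_mset (\<lambda>k. labels (map_tr p k)) K) \<subseteq># \<Sum>\<^sub># (image_mset (\<lambda>k. labels (attach p q k)) K)"
    using Tr by (induction K) (auto intro: subset_mset.add_mono)
  then show ?case by (simp add: multiset.map_comp comp_def subset_mset.add_increasing2)
qed

lemma unfill_uniq:
  fixes T :: "'l tr"
  assumes "nest c T = fill f C" "uniq (labels T)"
  shows "\<exists>(T0 :: 'l tr) c0 H \<kappa>. C = ctree (map_tr (\<lambda>l. (c0 l, H l)) T0) \<and> T = grow \<kappa> T0 \<and>
    (\<forall>l\<in>set_tr T0. c l = c0 l + (\<Sum>h\<in>#H l. node_items (f h)) \<and>
      image_mset (nest c) (\<kappa> l) = (\<Sum>h\<in>#H l. kids (f h)))"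
proof -
  obtain Y :: "('l \<times> 'l tr multiset \<times> fm item multiset \<times> nat multiset) tr" where Y:
    "C = ctree (map_tr (\<lambda>p. snd (snd p)) Y)" "T = attach fst (\<lambda>p. fst (snd p)) Y"
    "\<And>l k A H. (l, k, A, H) \<in> set_tr Y \<Longrightarrow> c l = A + (\<Sum>h\<in>#H. node_items (f h))"
    "\<And>l k A H. (l, k, A, H) \<in> set_tr Y \<Longrightarrow> image_mset (nest c) k = (\<Sum>h\<in>#H. kids (f h))"
    using unfill[OF assms(1)] by blast
  have "uniq (labels (map_tr fst Y))"
    using assms(2) uniq_subset[OF labels_subset_attach] unfolding Y(2) by blast
  then obtain g where g: "Y = map_tr (\<lambda>l. (l, g l)) (map_tr fst Y)" (is "_ = map_tr _ ?T0")
    by (rule uniq_decoration)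
  have mem: "(l, g l) \<in> set_tr Y" if "l \<in> set_tr ?T0" for l
    using that by (subst g) (simp add: tr.set_map)
  show ?thesis
  proof (intro exI conjI ballI)
    show "C = ctree (map_tr (\<lambda>l. (fst (snd (g l)), snd (snd (g l)))) ?T0)"
      unfolding Y(1) by (subst g) (simp add: tr.map_comp comp_def)
    show "T = grow (\<lambda>l. fst (g l)) ?T0"
      unfolding Y(2) by (subst g) (simp add: attach_map comp_def)
    fix l assume "l \<in> set_tr ?T0"
    then have "(l, fst (g l), fst (snd (g l)), snd (snd (g l))) \<in> set_tr Y" using mem by simp
    from Y(3)[OF this] Y(4)[OF this]
    show "c l = fst (snd (g l)) + (\<Sum>h\<in>#snd (snd (g l)). node_items (f h))"
      "image_mset (nest c) (fst (g l)) = (\<Sum>h\<in>#snd (snd (g l)). kids (f h))" by simp_all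
  qed
qed

lemma holes_ctree: "holes (ctree t) = (\<Sum>p\<in>#labels t. snd p)"
proof (induction t)
  case (Tr p K)
  have "image_mset (\<lambda>t. holes (ctree t)) K = image_mset (\<lambda>t. \<Sum>p\<in>#labels t. snd p) K"
    by (rule image_mset_cong) (rule Tr)
  moreover have "\<Sum>\<^sub># (image_mset (\<lambda>t. \<Sum>p\<in>#labels t. snd p) K) = (\<Sum>p\<in>#\<Sum>\<^sub># (image_mset labels K). snd p)"
    by (induction K) auto
  ultimately show ?case by (simp add: multiset.map_comp comp_def)
qed

lemma hole_depth_Ctx:
  "hole_depth i (Ctx X \<Gamma> \<Delta> H K) d \<longleftrightarrow> d = 0 \<and> i \<in># H \<or> (\<exists>C d'. C \<in># K \<and> hole_depth i C d' \<and> d = Suc d')"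
  by (subst hole_depth.simps) auto

lemma ex_hole_depth: "(\<exists>d. hole_depth i (ctree t) d) \<longleftrightarrow> (\<exists>p\<in>set_tr t. i \<in># snd p)"
proof (induction t)
  case (Tr p K)
  have "(\<exists>d. hole_depth i (ctree (Tr p K)) d) \<longleftrightarrow>
    i \<in># snd p \<or> (\<exists>k\<in>set_mset K. \<exists>d. hole_depth i (ctree k) d)"
    by (auto simp: hole_depth_Ctx)
  then show ?case using Tr by auto
qed

text \<open>The side conditions of \<open>Ru5\<close> and \<open>Ru5dom\<close> only ask for depth
  at least 1, that is, for a node other than the root. Distinct labels make this a comparison with
  \<open>lab T\<close>.\<close>

lemma hole_depth_pos:
  assumes "uniq (labels T)"
  shows "(\<exists>d\<ge>1. hole_depth i (ctree (map_tr g T)) d) \<longleftrightarrow> (\<exists>l\<in>set_tr T - {lab T}. i \<in># snd (g l))"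
proof (cases T)
  case (Tr l K)
  have l: "l \<notin> (\<Union>k\<in>set_mset K. set_tr k)" using assms unfolding Tr by auto
  have "(\<exists>d\<ge>1. hole_depth i (ctree (map_tr g T)) d) \<longleftrightarrow>
    (\<exists>k\<in>set_mset K. \<exists>d. hole_depth i (ctree (map_tr g k)) d)"
    unfolding Tr by (auto simp: hole_depth_Ctx)
  also have "\<dots> \<longleftrightarrow> (\<exists>k\<in>set_mset K. \<exists>l\<in>set_tr k. i \<in># snd (g l))"
    by (simp add: ex_hole_depth tr.set_map)
  also have "\<dots> \<longleftrightarrow> (\<exists>l\<in>set_tr T - {lab T}. i \<in># snd (g l))"
    using l unfolding Tr by auto
  finally show ?thesis .
qed

section \<open>Contexts with one or two holes as trees with marked nodes\<close>

definition mark :: "'l \<Rightarrow> nat \<Rightarrow> 'l \<Rightarrow> nat multiset" where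
  "mark w i l = (if l = w then {#i#} else {#})"

lemma sum_mark: "uniq N \<Longrightarrow> (\<Sum>l\<in>#N. mark w i l) = (if w \<in># N then {#i#} else {#})"
  by (induction N) (auto simp: mark_def)

text \<open>Peels off one hole by finding the node that carries it; applied once to contexts with
  one hole and twice to those with two.\<close>

lemma sum_uniq_add_mset:
  assumes "(\<Sum>l\<in>#N. H l) = add_mset i M" "uniq N"
  obtains w H' where "w \<in># N" "(\<Sum>l\<in>#N. H' l) = M" "\<And>l. l \<in># N \<Longrightarrow> H l = mark w i l + H' l"
proof -
  obtain w where w: "w \<in># N" "i \<in># H w"
  proof -
    have "i \<in># (\<Sum>l\<in>#N. H l)" using assms(1) by simp
    then show thesis using that by auto
  qed
  obtain N' where N': "N = add_mset w N'" "w \<notin># N'"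
    using w(1) assms(2) by (metis mset_add uniq_add)
  define H' where "H' = H(w := H w - {#i#})"
  have "(\<Sum>l\<in>#N'. H' l) = (\<Sum>l\<in>#N'. H l)"
    unfolding H'_def using N'(2) by (intro arg_cong[where f = sum_mset] image_mset_cong) auto
  moreover have "add_mset i (H w - {#i#}) = H w" using w(2) by simp
  ultimately have "(\<Sum>l\<in>#N. H' l) = M"
    using assms(1) unfolding N'(1) by (simp add: H'_def) (metis add_mset_add_mset_same_iff union_mset_add_mset_left)
  then show thesis using w
    by (intro that[of w H']) (auto simp: H'_def mark_def)
qed

definition nested :: "'l tr \<Rightarrow> ('l \<times> fm item) multiset \<Rightarrow> nseq" where
  "nested T M = nest (at M) T"

definition hole_at :: "'l tr \<Rightarrow> ('l \<times> fm item) multiset \<Rightarrow> 'l \<Rightarrow> ctx" where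
  "hole_at T M w = ctree (map_tr (\<lambda>l. (at M l, mark w 0 l)) T)"

definition holes_at :: "'l tr \<Rightarrow> ('l \<times> fm item) multiset \<Rightarrow> 'l \<Rightarrow> 'l \<Rightarrow> ctx" where
  "holes_at T M w v = ctree (map_tr (\<lambda>l. (at M l, mark w 0 l + mark v 1 l)) T)"

abbreviation kids_at :: "'l \<Rightarrow> 'l tr multiset \<Rightarrow> 'l \<Rightarrow> 'l tr multiset" where
  "kids_at w k \<equiv> (\<lambda>l. if l = w then k else {#})"

lemma grow_trivial: "(\<And>l. l \<in> set_tr T \<Longrightarrow> \<kappa> l = {#}) \<Longrightarrow> grow \<kappa> T = T"
  using attach_cong[of T \<kappa> "\<lambda>l. {#}" "\<lambda>l. l"] by (simp add: attach_empty)

lemma hole_at_cong: "(\<And>l. l \<in> set_tr T \<Longrightarrow> at M l = at M' l) \<Longrightarrow> hole_at T M w = hole_at T M' w"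
  unfolding hole_at_def by (rule arg_cong[where f = ctree]) (simp cong: tr.map_cong0)

lemma holes_labelled: "holes (ctree (map_tr (\<lambda>l. (c l, H l)) T)) = (\<Sum>l\<in>#labels T. H l)"
  by (simp add: holes_ctree labels_map multiset.map_comp comp_def)

lemma is_ctx_hole_at: "uniq (labels T) \<Longrightarrow> w \<in> set_tr T \<Longrightarrow> is_ctx 1 (hole_at T M w)"
  by (simp add: is_ctx_def hole_at_def holes_labelled sum_mark)

lemma upt2: "mset [0..<2] = {#0, 1#}"
  by (simp add: numeral_2_eq_2)

lemma is_ctx_holes_at: "uniq (labels T) \<Longrightarrow> w \<in> set_tr T \<Longrightarrow> v \<in> set_tr T \<Longrightarrow> is_ctx 2 (holes_at T M w v)"
  unfolding is_ctx_def holes_at_def holes_labelled sum_mset.distrib upt2 by (simp add: sum_mark)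

lemma plug_hole_at:
  assumes "\<And>l. l \<in> set_tr T \<Longrightarrow> at M l = at (M0 + put w (items X \<Gamma> \<Delta>)) l"
    and "K = image_mset (\<lambda>k. nested k M) k"
  shows "plug (hole_at T M0 w) [NS X \<Gamma> \<Delta> K] = nested (grow (kids_at w k) T) M"
proof -
  have "image_mset (nest (at M)) k = K" using assms(2) by (simp add: nested_def)
  then show ?thesis
    unfolding plug_def hole_at_def nested_def using assms(1) by (intro fill_ctree) (auto simp: mark_def)
qed

lemma plug_holes_at:
  "plug (holes_at T M0 w v) [NS X \<Gamma> \<Delta> {#}, NS Y \<Pi> \<Sigma> {#}]
   = nested T (M0 + put w (items X \<Gamma> \<Delta>) + put v (items Y \<Pi> \<Sigma>))"
proof -
  have "plug (holes_at T M0 w v) [NS X \<Gamma> \<Delta> {#}, NS Y \<Pi> \<Sigma> {#}]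
    = nested (grow (\<lambda>l. {#}) T) (M0 + put w (items X \<Gamma> \<Delta>) + put v (items Y \<Pi> \<Sigma>))"
    unfolding plug_def holes_at_def nested_def by (intro fill_ctree) (auto simp: mark_def)
  then show ?thesis by (simp add: attach_empty)
qed

lemma sum_mset_emptyD: "(\<Sum>l\<in>#N. H l) = {#} \<Longrightarrow> l \<in># N \<Longrightarrow> H l = {#}"
  by auto

text \<open>Locates a rule instance in a labelled tree: the single hole becomes a node
  \<open>w\<close>, the displayed items are cut out of \<open>M\<close>, and \<open>T0\<close> is
  the tree without the displayed children.\<close>

lemma unplug_hole_at:
  assumes "nested T M = plug C [NS X \<Gamma> \<Delta> K]" "is_ctx 1 C" "uniq (labels T)"
  obtains w T0 k M0 where "w \<in> set_tr T0" "M = M0 + put w (items X \<Gamma> \<Delta>)"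
    "T = grow (kids_at w k) T0" "image_mset (\<lambda>k. nested k M) k = K" "C = hole_at T0 M0 w"
proof -
  let ?f = "\<lambda>i. [NS X \<Gamma> \<Delta> K] ! i"
  obtain T0 c0 H \<kappa> where C: "C = ctree (map_tr (\<lambda>l. (c0 l, H l)) T0)" "T = grow \<kappa> T0"
    and l': "\<forall>l\<in>set_tr T0. at M l = c0 l + (\<Sum>h\<in>#H l. node_items (?f h)) \<and>
      image_mset (nest (at M)) (\<kappa> l) = (\<Sum>h\<in>#H l. kids (?f h))"
    using unfill_uniq[OF assms(1)[unfolded nested_def plug_def] assms(3)] by (elim exE conjE)
  from l' have l: "\<And>l. l \<in> set_tr T0 \<Longrightarrow> at M l = c0 l + (\<Sum>h\<in>#H l. node_items (?f h))"
      "\<And>l. l \<in> set_tr T0 \<Longrightarrow> image_mset (nest (at M)) (\<kappa> l) = (\<Sum>h\<in>#H l. kids (?f h))"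
    by simp_all
  have u: "uniq (labels T0)" using assms(3) unfolding C(2) by (simp add: labels_attach uniq_plus)
  have "(\<Sum>l\<in>#labels T0. H l) = {#0#}" using assms(2) unfolding is_ctx_def C(1) holes_labelled by simp
  then obtain w H' where w: "w \<in># labels T0"
    "(\<Sum>l\<in>#labels T0. H' l) = {#}" "\<And>l. l \<in># labels T0 \<Longrightarrow> H l = mark w 0 l + H' l"
    using sum_uniq_add_mset[OF _ u] by blast
  have H: "H l = mark w 0 l" if "l \<in> set_tr T0" for l
    using w(3)[of l] sum_mset_emptyD[OF w(2), of l] that by simp
  have atw: "at M w = c0 w + items X \<Gamma> \<Delta>" using l(1)[of w] w(1) H[of w] by (simp add: mark_def)
  obtain M0 where M0: "M = M0 + put w (items X \<Gamma> \<Delta>)" "at M0 w = c0 w"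
    using at_eq_add[OF atw] by metis
  have c0: "c0 l = at M0 l" if "l \<in> set_tr T0" for l
  proof -
    have "at M l = c0 l + (if l = w then items X \<Gamma> \<Delta> else {#})"
      using l(1)[OF that] H[OF that] by (simp add: mark_def)
    moreover have "at M l = at M0 l + (if l = w then items X \<Gamma> \<Delta> else {#})"
      unfolding M0(1) by simp
    ultimately show ?thesis by simp
  qed
  have "nest (at M) = (\<lambda>k. nested k M)" by (simp add: nested_def fun_eq_iff)
  with l(2)[of w] w(1) H[of w] have kw: "image_mset (\<lambda>k. nested k M) (\<kappa> w) = K" by (simp add: mark_def)
  have "\<kappa> l = {#}" if "l \<in> set_tr T0" "l \<noteq> w" for l
    using l(2)[OF that(1)] H[OF that(1)] that(2) by (simp add: mark_def)
  then have "T = grow (kids_at w (\<kappa> w)) T0" unfolding C(2) by (intro attach_cong) auto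
  moreover have "C = hole_at T0 M0 w"
    unfolding C(1) hole_at_def using c0 H by (intro arg_cong[where f = ctree] tr.map_cong0) auto
  ultimately show thesis using that w(1) M0(1) kw by simp
qed

lemma unplug_plain:
  assumes "nested T M = plug C [NS X \<Gamma> \<Delta> {#}]" "is_ctx 1 C" "uniq (labels T)"
  obtains w M0 where "w \<in> set_tr T" "M = M0 + put w (items X \<Gamma> \<Delta>)" "C = hole_at T M0 w"
proof -
  obtain w T0 k M0 where *: "w \<in> set_tr T0" "M = M0 + put w (items X \<Gamma> \<Delta>)"
    "T = grow (kids_at w k) T0" "image_mset (\<lambda>k. nested k M) k = {#}" "C = hole_at T0 M0 w"
    using unplug_hole_at[OF assms] by metis
  then have "T = T0" by (simp add: grow_trivial)
  with * show thesis using that by simp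
qed

lemma plug_plain: "plug (hole_at T M0 w) [NS X \<Gamma> \<Delta> {#}] = nested T (M0 + put w (items X \<Gamma> \<Delta>))"
  using plug_hole_at[of T "M0 + put w (items X \<Gamma> \<Delta>)" M0 w X \<Gamma> \<Delta> "{#}" "{#}"] by (simp add: grow_trivial)

lemma unplug_holes_at:
  assumes "nested T M = plug C [NS X \<Gamma> \<Delta> {#}, NS Y \<Pi> \<Sigma> {#}]" "is_ctx 2 C" "uniq (labels T)"
  obtains w v M0 where "w \<in> set_tr T" "v \<in> set_tr T"
    "M = M0 + put w (items X \<Gamma> \<Delta>) + put v (items Y \<Pi> \<Sigma>)" "C = holes_at T M0 w v"
proof -
  let ?f = "\<lambda>i. [NS X \<Gamma> \<Delta> {#}, NS Y \<Pi> \<Sigma> {#}] ! i"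
  obtain T0 c0 H \<kappa> where C: "C = ctree (map_tr (\<lambda>l. (c0 l, H l)) T0)" "T = grow \<kappa> T0"
    and l': "\<forall>l\<in>set_tr T0. at M l = c0 l + (\<Sum>h\<in>#H l. node_items (?f h)) \<and>
      image_mset (nest (at M)) (\<kappa> l) = (\<Sum>h\<in>#H l. kids (?f h))"
    using unfill_uniq[OF assms(1)[unfolded nested_def plug_def] assms(3)] by (elim exE conjE)
  from l' have l: "\<And>l. l \<in> set_tr T0 \<Longrightarrow> at M l = c0 l + (\<Sum>h\<in>#H l. node_items (?f h))"
      "\<And>l. l \<in> set_tr T0 \<Longrightarrow> image_mset (nest (at M)) (\<kappa> l) = (\<Sum>h\<in>#H l. kids (?f h))"
    by simp_all
  have u: "uniq (labels T0)" using assms(3) unfolding C(2) by (simp add: labels_attach uniq_plus)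
  have "(\<Sum>l\<in>#labels T0. H l) = {#0, 1#}"
    using assms(2) unfolding is_ctx_def C(1) holes_labelled upt2 .
  then obtain w H' where w: "w \<in># labels T0"
    "(\<Sum>l\<in>#labels T0. H' l) = {#1#}" "\<And>l. l \<in># labels T0 \<Longrightarrow> H l = mark w 0 l + H' l"
    using sum_uniq_add_mset[OF _ u] by blast
  obtain v H'' where v: "v \<in># labels T0"
    "(\<Sum>l\<in>#labels T0. H'' l) = {#}" "\<And>l. l \<in># labels T0 \<Longrightarrow> H' l = mark v 1 l + H'' l"
    using sum_uniq_add_mset[OF w(2) u] by blast
  have H: "H l = mark w 0 l + mark v 1 l" if "l \<in> set_tr T0" for l
    using w(3)[of l] v(3)[of l] sum_mset_emptyD[OF v(2), of l] that by simp
  have k: "\<kappa> l = {#}" if "l \<in> set_tr T0" for l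
    using l(2)[OF that] H[OF that] by (simp add: mark_def split: if_splits)
  then have T: "T = T0" unfolding C(2) by (rule grow_trivial)
  \<comment> \<open>Two separate conditionals, because both holes may be at one node, which then
    receives both fillers.\<close>
  have at: "at M l = c0 l + (if l = w then items X \<Gamma> \<Delta> else {#}) + (if l = v then items Y \<Pi> \<Sigma> else {#})"
    if "l \<in> set_tr T0" for l
    using l(1)[OF that] H[OF that] by (simp add: mark_def)
  obtain M1 where M1: "M = M1 + put v (items Y \<Pi> \<Sigma>)"
    "at M1 v = c0 v + (if v = w then items X \<Gamma> \<Delta> else {#})"
    using at_eq_add[of M v "c0 v + (if v = w then items X \<Gamma> \<Delta> else {#})"] at[of v] v(1) by auto
  have atM1: "at M l = at M1 l + (if l = v then items Y \<Pi> \<Sigma> else {#})" for l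
    unfolding M1(1) by simp
  have "at M1 w = c0 w + items X \<Gamma> \<Delta>"
    using M1(2) atM1[of w] at[of w] w(1) by (cases "v = w") simp_all
  then obtain M0 where M0: "M1 = M0 + put w (items X \<Gamma> \<Delta>)" "at M0 w = c0 w"
    by (metis at_eq_add)
  have "c0 l = at M0 l" if "l \<in> set_tr T0" for l
  proof -
    have "at M1 l = at M0 l + (if l = w then items X \<Gamma> \<Delta> else {#})"
      unfolding M0(1) by simp
    with at[OF that] atM1[of l] show ?thesis by simp
  qed
  then have "C = holes_at T0 M0 w v"
    unfolding C(1) holes_at_def using H by (intro arg_cong[where f = ctree] tr.map_cong0) auto
  then show thesis using that[of w v M0] w(1) v(1) M1(1) M0(1) T by simp
qed

lemma hole_depth_holes_at:
  assumes "uniq (labels T)" "w \<in> set_tr T" "v \<in> set_tr T"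
  shows "(\<exists>d\<ge>1. hole_depth 0 (holes_at T M w v) d) \<longleftrightarrow> w \<noteq> lab T"
    and "(\<exists>d\<ge>1. hole_depth 1 (holes_at T M w v) d) \<longleftrightarrow> v \<noteq> lab T"
  unfolding holes_at_def hole_depth_pos[OF assms(1)] using assms by (auto simp: mark_def split: if_splits)

text \<open>The root always has label 0, so it can be recognised once the tree has been reduced to
  its set of edges. No item may sit at a label outside the tree, which leaves fresh labels
  empty.\<close>

definition good :: "nat tr \<Rightarrow> (nat \<times> 'a) multiset \<Rightarrow> bool" where
  "good T M \<longleftrightarrow> lab T = 0 \<and> uniq (labels T) \<and> fst ` set_mset M \<subseteq> set_tr T"

lemma labels_grow_at:
  assumes "uniq (labels T)" "w \<in> set_tr T"
  shows "labels (grow (kids_at w {#k#}) T) = labels T + labels k"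
proof -
  have "(\<Sum>l\<in>#N. \<Sum>k\<in>#kids_at w {#k#} l. labels k) = (if w \<in># N then labels k else {#})" if "uniq N" for N
    using that by (induction N) auto
  then show ?thesis using assms by (simp add: labels_attach)
qed

lemma plug_leaf:
  fixes X' Y :: "var multiset" and \<Gamma>' \<Delta>' \<Pi> \<Sigma> :: "fm multiset"
  assumes "good T (M0 + put w (items X \<Gamma> \<Delta>))" "w \<in> set_tr T" "u \<notin> set_tr T"
  defines "T' \<equiv> grow (kids_at w {#Tr u {#}#}) T"
    and "M' \<equiv> M0 + put w (items X' \<Gamma>' \<Delta>') + put u (items Y \<Pi> \<Sigma>)"
  shows "plug (hole_at T M0 w) [NS X' \<Gamma>' \<Delta>' {#NS Y \<Pi> \<Sigma> {#}#}] = nested T' M'"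
    "good T' M'" "edges T' = insert (w, u) (edges T)"
proof -
  have [simp]: "at M0 u = {#}"
  proof -
    have "a \<notin># at M0 u" for a using assms(1,3) by (force simp: good_def)
    then show ?thesis by (metis multiset_nonemptyE)
  qed
  have "u \<noteq> w" using assms by auto
  then show "plug (hole_at T M0 w) [NS X' \<Gamma>' \<Delta>' {#NS Y \<Pi> \<Sigma> {#}#}] = nested T' M'"
    unfolding T'_def using assms(3) by (intro plug_hole_at) (auto simp: M'_def nested_def)
  have "labels T' = labels T + {#u#}"
    unfolding T'_def using assms by (subst labels_grow_at) (auto simp: good_def)
  then have "set_tr T' = insert u (set_tr T)" "uniq (labels T')"
    using assms by (auto simp: uniq_plus good_def simp flip: set_labels)
  moreover have "lab T' = lab T" by (simp add: T'_def)
  ultimately show "good T' M'" using assms by (auto simp: good_def M'_def)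
  show "edges T' = insert (w, u) (edges T)"
    unfolding T'_def edges_attach using assms(2) by (auto split: if_splits)
qed

text \<open>A hole leaves the remaining items of its node to the context, but a displayed child
  shows all of its content. Its bystanders \<open>at M0 u\<close> therefore have to be spelled out
  next to the items that the rule touches.\<close>

lemma plug_child:
  assumes "uniq (labels (grow (kids_at w {#Tr u K#}) T))" "w \<in> set_tr T"
  shows "plug (hole_at T M0 w) [NS X \<Gamma> \<Delta> {#NS (sigs (at M0 u) + Y) (antes (at M0 u) + \<Pi>) (succs (at M0 u) + \<Sigma>)
      (image_mset (\<lambda>k. nested k M0) K)#}]
    = nested (grow (kids_at w {#Tr u K#}) T) (M0 + put w (items X \<Gamma> \<Delta>) + put u (items Y \<Pi> \<Sigma>))"
    (is "_ = nested _ ?M")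
proof (rule plug_hole_at)
  have "labels T \<subseteq># labels (grow (kids_at w {#Tr u K#}) T)" by (simp add: labels_attach)
  with assms(1) have "uniq (labels T)" by (rule uniq_subset[rotated])
  then have "uniq (labels T + labels (Tr u K))"
    using assms by (simp only: labels_grow_at)
  then have un: "u \<notin> set_tr T" "u \<notin> (\<Union>k\<in>set_mset K. set_tr k)" "\<And>k. k \<in># K \<Longrightarrow> w \<notin> set_tr k"
    using assms(2) by (auto simp: uniq_plus)
  then show "at ?M l = at (M0 + put w (items X \<Gamma> \<Delta>)) l" if "l \<in> set_tr T" for l using that by auto
  have "nested k M0 = nested k ?M" if "k \<in># K" for k
    unfolding nested_def using un that by (intro nest_cong) auto
  moreover have "u \<noteq> w" using un(1) assms(2) by auto
  ultimately show "{#NS (sigs (at M0 u) + Y) (antes (at M0 u) + \<Pi>) (succs (at M0 u) + \<Sigma>)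
      (image_mset (\<lambda>k. nested k M0) K)#} = image_mset (\<lambda>k. nested k ?M) {#Tr u K#}"
    by (simp add: nested_def cong: image_mset_cong)
qed

lemma unplug_child:
  assumes "nested T M = plug C [NS X \<Gamma> \<Delta> {#NS Y \<Pi> \<Sigma> K#}]" "is_ctx 1 C" "uniq (labels T)"
  obtains w u M0 where "(w, u) \<in> edges T" "M = M0 + put w (items X \<Gamma> \<Delta>) + put u (items Y \<Pi> \<Sigma>)"
    "\<And>X' \<Gamma>' \<Delta>' Y' \<Pi>' \<Sigma>'. plug C [NS X' \<Gamma>' \<Delta>' {#NS Y' \<Pi>' \<Sigma>' K#}]
      = nested T (M0 + put w (items X' \<Gamma>' \<Delta>') + put u (items Y' \<Pi>' \<Sigma>'))"
proof -
  obtain w T0 k M1 where 1: "w \<in> set_tr T0" "M = M1 + put w (items X \<Gamma> \<Delta>)"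
    "T = grow (kids_at w k) T0" "image_mset (\<lambda>k. nested k M) k = {#NS Y \<Pi> \<Sigma> K#}" "C = hole_at T0 M1 w"
    using unplug_hole_at[OF assms] by metis
  obtain Tu where Tu: "k = {#Tu#}" "nested Tu M = NS Y \<Pi> \<Sigma> K"
    using 1(4) by (auto dest!: msed_map_invR)
  obtain u K' where u: "Tu = Tr u K'" by (cases Tu)
  have T: "T = grow (kids_at w {#Tr u K'#}) T0" using 1(3) unfolding Tu(1) u .
  have at: "at M u = items Y \<Pi> \<Sigma>" and K: "K = image_mset (\<lambda>k. nested k M) K'"
  proof -
    have "nest (at M) = (\<lambda>k. nested k M)" by (simp add: nested_def fun_eq_iff)
    then show "K = image_mset (\<lambda>k. nested k M) K'" using Tu(2) u by (simp add: nested_def)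
    show "at M u = items Y \<Pi> \<Sigma>" by (rule item_mset_eqI) (use Tu(2) u in \<open>auto simp: nested_def\<close>)
  qed
  have "labels T0 \<subseteq># labels T" by (simp add: labels_attach T)
  with assms(3) have "uniq (labels T0)" by (rule uniq_subset[rotated])
  then have labsT: "labels T = labels T0 + labels (Tr u K')" using 1(1) by (simp only: T labels_grow_at)
  then have un: "u \<notin> set_tr T0" "\<And>k. k \<in># K' \<Longrightarrow> u \<notin> set_tr k" "\<And>k. k \<in># K' \<Longrightarrow> w \<notin> set_tr k"
    using 1(1) assms(3) by (auto simp: uniq_plus)
  then have "u \<noteq> w" using 1(1) by auto
  \<comment> \<open>The displayed child shows everything located at \<open>u\<close>, so nothing
    remains there in \<open>M0\<close>.\<close>
  then have "at M1 u = {#} + items Y \<Pi> \<Sigma>" using at unfolding 1(2) by simp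
  then obtain M0 where M0: "M1 = M0 + put u (items Y \<Pi> \<Sigma>)" "at M0 u = {#}"
    using at_eq_add by metis
  have "hole_at T0 M1 w = hole_at T0 M0 w" unfolding M0(1) using un(1) by (intro hole_at_cong) auto
  moreover have "K = image_mset (\<lambda>k. nested k M0) K'"
  proof -
    have "nested k M = nested k M0" if "k \<in># K'" for k
      unfolding nested_def 1(2) M0(1) using un that by (intro nest_cong) auto
    then show ?thesis unfolding K by (intro image_mset_cong) simp
  qed
  ultimately have "plug C [NS X' \<Gamma>' \<Delta>' {#NS Y' \<Pi>' \<Sigma>' K#}]
      = nested T (M0 + put w (items X' \<Gamma>' \<Delta>') + put u (items Y' \<Pi>' \<Sigma>'))" for X' \<Gamma>' \<Delta>' Y' \<Pi>' \<Sigma>'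
    using plug_child[of w u K' T0 M0 X' \<Gamma>' \<Delta>' Y' \<Pi>' \<Sigma>'] assms(3) 1(1,5) M0(2) T by simp
  moreover have "(w, u) \<in> edges T" unfolding T edges_attach using 1(1) by auto
  moreover have "M = M0 + put w (items X \<Gamma> \<Delta>) + put u (items Y \<Pi> \<Sigma>)"
    unfolding 1(2) M0(1) by simp
  ultimately show thesis using that by blast
qed

text \<open>Cuts off the subtree below an edge. It can be grafted back with \<open>grow\<close>
  because \<open>w\<close> occurs only once, so that no other node receives a copy.\<close>

lemma edge_split:
  assumes "(w, u) \<in> edges T" "uniq (labels T)"
  shows "\<exists>T0 K. T = grow (kids_at w {#Tr u K#}) T0 \<and> w \<in> set_tr T0"
  using assms
proof (induction T)
  case (Tr l K)
  have un: "l \<notin> set_tr k" if "k \<in># K" for k using Tr.prems(2) that by auto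
  show ?case
  proof (cases "\<exists>k\<in>#K. w = l \<and> u = lab k")
    case True
    then obtain k K' where k: "K = add_mset k K'" "w = l" "u = lab k" by (auto dest!: multi_member_split)
    have "image_mset (grow (kids_at l {#k#})) K' = image_mset (\<lambda>k. k) K'"
      using un k(1) by (intro image_mset_cong grow_trivial) auto
    then have "Tr l K = grow (kids_at w {#k#}) (Tr l K')" by (simp add: k)
    then show ?thesis using k(2,3) by (cases k) (metis lab_in_set tr.sel)
  next
    case False
    then obtain k K' where k: "K = add_mset k K'" "(w, u) \<in> edges k"
      using Tr.prems(1) by (auto dest!: multi_member_split)
    obtain T0 Ku where T0: "k = grow (kids_at w {#Tr u Ku#}) T0" "w \<in> set_tr T0"
      using Tr.IH[of k] k Tr.prems(2) by (auto simp: uniq_plus)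
    have "w \<in># labels k" unfolding T0(1) labels_attach using T0(2) by simp
    then have wk: "w \<in> set_tr k" by simp
    have "image_mset (grow (kids_at w {#Tr u Ku#})) K' = image_mset (\<lambda>k. k) K'"
      using wk Tr.prems(2) k(1) by (intro image_mset_cong grow_trivial) (auto simp: uniq_plus)
    moreover have "w \<noteq> l" using un wk k(1) by auto
    ultimately have "Tr l K = grow (kids_at w {#Tr u Ku#}) (Tr l (add_mset T0 K'))"
      using T0(1) by (simp add: k)
    moreover have "w \<in> set_tr (Tr l (add_mset T0 K'))" using T0(2) by simp
    ultimately show ?thesis by blast
  qed
qed

lemma plug_edge:
  assumes "(w, u) \<in> edges T" "uniq (labels T)"
  obtains C K where "is_ctx 1 C"
    "\<And>X \<Gamma> \<Delta> Y \<Pi> \<Sigma>. plug C [NS X \<Gamma> \<Delta> {#NS (sigs (at M0 u) + Y) (antes (at M0 u) + \<Pi>) (succs (at M0 u) + \<Sigma>) K#}]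
      = nested T (M0 + put w (items X \<Gamma> \<Delta>) + put u (items Y \<Pi> \<Sigma>))"
proof -
  obtain T0 K where T: "T = grow (kids_at w {#Tr u K#}) T0" "w \<in> set_tr T0"
    using edge_split[OF assms] by blast
  have "uniq (labels T0)" using assms(2) uniq_subset[of "labels T0" "labels T"] by (simp add: T(1) labels_attach)
  then show thesis
    using that[OF is_ctx_hole_at[of T0 w M0]] plug_child[of w u K T0 M0] assms(2) T by blast
qed

section \<open>Labelled sequents\<close>

type_synonym lseq = "(nat \<times> nat) set \<times> (nat \<times> dfm item) multiset"

text \<open>Every node except the root is the target of an edge; inserting 0 covers the tree with a
  single node and no edges.\<close>

definition nodes :: "(nat \<times> nat) set \<Rightarrow> nat set" where
  "nodes E = insert 0 (Range E)"

text \<open>\<open>lrule Fr E r P Qs\<close>: in a labelled sequent with edges \<open>E\<close> and root \<open>0\<close>, the rule \<open>r\<close> replaces the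
  items \<open>P\<close> by new edges and items in \<open>Qs\<close>, one pair for each premiss. The premisses of \<open>R\<forall>\<close> range
  over all variables in \<open>Fr\<close>, fresh or not, and those of \<open>R\<box>\<close> and \<open>R\<^sub>D\<close> over all new labels.\<close>
inductive lrule :: "var set \<Rightarrow> (nat \<times> nat) set \<Rightarrow> rule \<Rightarrow> (nat \<times> dfm item) multiset \<Rightarrow> lseq set \<Rightarrow> bool"
  for Fr E where
  "datomic p \<Longrightarrow> lrule Fr E Init {#(w, An p), (w, Sc p)#} {}"
| "lrule Fr E LBot {#(w, An DBot)#} {}"
| "lrule Fr E LImp {#(w, An (DImp a b))#} {({}, {#(w, Sc a)#}), ({}, {#(w, An b)#})}"
| "lrule Fr E RImp {#(w, Sc (DImp a b))#} {({}, {#(w, An a), (w, Sc b)#})}"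
| "lrule Fr E LAll {#(w, Sg z), (w, An (DAll a))#}
     {({}, {#(w, Sg z), (w, An (inst z 0 a)), (w, An (DAll a))#})}"
| "lrule Fr E RAll {#(w, Sc (DAll a))#} {({}, {#(w, Sg y), (w, Sc (inst y 0 a))#}) | y. y \<in> Fr}"
| "(w, u) \<in> E \<Longrightarrow> lrule Fr E LBox {#(w, An (DBox a))#} {({}, {#(w, An (DBox a)), (u, An a)#})}"
| "w \<in> nodes E \<Longrightarrow>
   lrule Fr E RBox {#(w, Sc (DBox a))#} {({(w, u)}, {#(u, Sc a)#}) | u. u \<notin> nodes E}"
| "w \<in> nodes E \<Longrightarrow> x \<in> Fr \<Longrightarrow> lrule Fr E Ref {#} {({}, {#(w, An (DEq (Fre x) (Fre x)))#})}"
| "drepl x y p q \<Longrightarrow> lrule Fr E Repl {#(w, An (DEq (Fre x) (Fre y))), (w, An p)#}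
     {({}, {#(w, An q), (w, An (DEq (Fre x) (Fre y))), (w, An p)#})}"
| "lrule Fr E ReplX {#(w, Sg x), (w, An (DEq (Fre x) (Fre y)))#}
     {({}, {#(w, Sg x), (w, Sg y), (w, An (DEq (Fre x) (Fre y)))#})}"
| "v \<in> nodes E \<Longrightarrow> lrule Fr E Rig {#(w, An (DEq (Fre x) (Fre y)))#}
     {({}, {#(w, An (DEq (Fre x) (Fre y))), (v, An (DEq (Fre x) (Fre y)))#})}"
| "w \<in> nodes E \<Longrightarrow> lrule Fr E RuD {#} {({(w, u)}, {#}) | u. u \<notin> nodes E}"
| "lrule Fr E RuT {#(w, An (DBox a))#} {({}, {#(w, An a), (w, An (DBox a))#})}"
| "(w, u) \<in> E \<Longrightarrow> lrule Fr E RuB {#(u, An (DBox a))#} {({}, {#(w, An a), (u, An (DBox a))#})}"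
| "(w, u) \<in> E \<Longrightarrow> lrule Fr E Ru4 {#(w, An (DBox a))#} {({}, {#(w, An (DBox a)), (u, An (DBox a))#})}"
| "v \<in> nodes E \<Longrightarrow> w \<noteq> 0 \<Longrightarrow>
   lrule Fr E Ru5 {#(w, An (DBox a))#} {({}, {#(w, An (DBox a)), (v, An (DBox a))#})}"
| "(w, u) \<in> E \<Longrightarrow> lrule Fr E RuCBF {#(w, Sg x)#} {({}, {#(w, Sg x), (u, Sg x)#})}"
| "(w, u) \<in> E \<Longrightarrow> lrule Fr E RuBF {#(u, Sg x)#} {({}, {#(w, Sg x), (u, Sg x)#})}"
| "w \<in> nodes E \<Longrightarrow> x \<in> Fr \<Longrightarrow> lrule Fr E RuUI {#} {({}, {#(w, Sg x)#})}"
| "v \<in> nodes E \<Longrightarrow> w \<noteq> 0 \<Longrightarrow> v \<noteq> 0 \<Longrightarrow>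
   lrule Fr E Ru5dom {#(w, Sg x)#} {({}, {#(w, Sg x), (v, Sg x)#})}"

text \<open>The set \<open>Qs\<close> may be infinite, so the height is not computed from a tree:
  \<open>n\<close> bounds all premisses at once, and a rule without premisses is available at every
  positive bound.\<close>

inductive lder :: "rule set \<Rightarrow> var set \<Rightarrow> nat \<Rightarrow> (nat \<times> nat) set \<Rightarrow> (nat \<times> dfm item) multiset \<Rightarrow> bool"
  for RS Fr where
  step: "r \<in> RS \<Longrightarrow> lrule Fr E r P Qs \<Longrightarrow>
    (\<And>E' Q. (E', Q) \<in> Qs \<Longrightarrow> lder RS Fr n (E \<union> E') (Q + M)) \<Longrightarrow> lder RS Fr (Suc n) E (P + M)"

text \<open>New edges keep every side condition on edges and nodes true; only \<open>RBox\<close>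
  and \<open>RuD\<close> change, losing the premisses whose label is no longer new.\<close>

lemma lrule_mono:
  assumes "lrule Fr E r P Qs" "E \<subseteq> F"
  shows "\<exists>Qs'\<subseteq>Qs. lrule Fr F r P Qs'"
proof -
  have N: "nodes E \<subseteq> nodes F" using assms(2) by (auto simp: nodes_def)
  have RB: "w \<in> nodes E \<Longrightarrow> \<exists>Qs'\<subseteq>{({(w, u)}, {#(u, Sc a)#}) | u. u \<notin> nodes E}. lrule Fr F RBox {#(w, Sc (DBox a))#} Qs'"
    for w a using N by (intro exI[of _ "{({(w, u)}, {#(u, Sc a)#}) | u. u \<notin> nodes F}"]) (auto intro: lrule.intros)
  have RD: "w \<in> nodes E \<Longrightarrow> \<exists>Qs'\<subseteq>{({(w, u)}, {#}) | u. u \<notin> nodes E}. lrule Fr F RuD {#} Qs'"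
    for w using N by (intro exI[of _ "{({(w, u)}, {#}) | u. u \<notin> nodes F}"]) (auto intro: lrule.intros)
  show ?thesis using assms(1)
  proof cases
    case (8 w a)
    then show ?thesis using RB by simp
  next
    case (13 w)
    then show ?thesis using RD by simp
  qed (use N assms(2) in \<open>auto intro!: exI[of _ Qs] lrule.intros\<close>)
qed

lemma lrule_nodes:
  assumes "lrule Fr E r P Qs" "(E', Q) \<in> Qs"
  shows "E' = {} \<or> (\<exists>w u. E' = {(w, u)} \<and> w \<in> nodes E \<and> u \<notin> nodes E)"
  using assms by cases auto

text \<open>No renaming is called for: \<open>RAll\<close> has no freshness condition that the added
  items could violate, and labels that have been taken merely drop premisses.\<close>

lemma lder_weaken:
  assumes "lder RS Fr n E M" "E \<subseteq> F" "M \<subseteq># N"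
  shows "lder RS Fr n F N"
  using assms
proof (induction arbitrary: F N)
  case (step r E P Qs n M)
  obtain Qs' where Qs': "Qs' \<subseteq> Qs" "lrule Fr F r P Qs'" using lrule_mono[OF step.hyps(2) step.prems(1)] by blast
  obtain M' where N: "N = P + (M + M')" using step.prems(2) by (auto simp: mset_subset_eq_exists_conv ac_simps)
  show ?case unfolding N
  proof (rule lder.step[OF step.hyps(1) Qs'(2)])
    fix E' Q assume "(E', Q) \<in> Qs'"
    then show "lder RS Fr n (F \<union> E') (Q + (M + M'))"
      using Qs'(1) step.prems(1) by (intro step.IH) auto
  qed
qed

lemma lder_Suc: "lder RS Fr n E M \<Longrightarrow> lder RS Fr (Suc n) E M"
proof (induction rule: lder.induct)
  case (step r E P Qs n M)
  show ?case using step.hyps(1,2) step.IH by (rule lder.step)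
qed

definition inverting :: "rule set" where
  "inverting = {LImp, RImp, RAll, RBox}"

lemma lrule_cumulative: "lrule Fr E r P Qs \<Longrightarrow> r \<notin> inverting \<Longrightarrow> (E', Q) \<in> Qs \<Longrightarrow> P \<subseteq># Q"
  by (cases rule: lrule.cases) (auto simp: inverting_def)

lemma drepl_atomic: "drepl x y p q \<Longrightarrow> datomic p"
  by (auto simp: drepl_def)

text \<open>An implication on either side, or a universal or boxed formula on the right, is
  principal in one rule only. \<open>Init\<close> and \<open>Repl\<close>, whose principal formulas
  have no fixed shape, accept atomic ones only.\<close>

lemma lrule_inverting_unique:
  assumes "lrule Fr E r P Qs" "r \<in> inverting" "p \<in># P" "lrule Fr F r' P' Qs'" "p \<in># P'"
  shows "r' = r \<and> P' = P"
proof -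
  have "r' = LImp \<and> P' = {#(w, An (DImp a b))#}" if "(w, An (DImp a b)) \<in># P'" for w a b
    using assms(4) that by cases (auto dest: drepl_atomic)
  moreover have "r' = RImp \<and> P' = {#(w, Sc (DImp a b))#}" if "(w, Sc (DImp a b)) \<in># P'" for w a b
    using assms(4) that by cases (auto dest: drepl_atomic)
  moreover have "r' = RAll \<and> P' = {#(w, Sc (DAll a))#}" if "(w, Sc (DAll a)) \<in># P'" for w a
    using assms(4) that by cases (auto dest: drepl_atomic)
  moreover have "r' = RBox \<and> P' = {#(w, Sc (DBox a))#}" if "(w, Sc (DBox a)) \<in># P'" for w a
    using assms(4) that by cases (auto dest: drepl_atomic)
  moreover note assms(2,3,5)
  ultimately show ?thesis
    by (cases rule: lrule.cases[OF assms(1)]) (auto simp: inverting_def)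
qed

lemma lrule_inverting:
  assumes "lrule Fr E r P Qs" "r \<in> inverting"
  obtains p where "P = {#p#}"
    "\<And>F r' P' Qs'. lrule Fr F r' P' Qs' \<Longrightarrow> p \<in># P' \<Longrightarrow> r' = r \<and> P' = P"
proof -
  obtain p where p: "P = {#p#}" using assms by (cases rule: lrule.cases) (auto simp: inverting_def)
  then have "r' = r \<and> P' = P" if "lrule Fr F r' P' Qs'" "p \<in># P'" for F r' P' Qs'
    using lrule_inverting_unique[OF assms _ that] by simp
  with p show thesis by (rule that)
qed

text \<open>The principal item fixes the premisses up to the labels still free, so a premiss whose
  label is new for \<open>F\<close> is among those over \<open>F\<close> as well.\<close>

lemma lrule_inverting_det:
  assumes "lrule Fr E r P Qs" "lrule Fr F r P Qs'" "r \<in> inverting" "E \<subseteq> F" "(E', Q) \<in> Qs"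
    and "\<And>w u. (w, u) \<in> E' \<Longrightarrow> u \<notin> nodes F"
  shows "(E', Q) \<in> Qs'"
  using assms by (auto simp: inverting_def elim!: lrule.cases)

text \<open>The instance to be inverted stays fixed over \<open>E\<close>, while \<open>F\<close>
  collects the edges created further up in the derivation.\<close>

lemma lder_invert:
  assumes "lder RS Fr n F N" "lrule Fr E r P Qs" "r \<in> inverting" "(E', Q) \<in> Qs" "E \<subseteq> F" "N = P + M"
    and "\<And>w u. (w, u) \<in> E' \<Longrightarrow> u \<notin> nodes F"
  shows "lder RS Fr n (F \<union> E') (Q + M)"
  using assms
proof (induction arbitrary: M)
  case (step r' F P' Qs' n M' M)
  obtain p where p: "P = {#p#}" "\<And>F r' P' Qs'. lrule Fr F r' P' Qs' \<Longrightarrow> p \<in># P' \<Longrightarrow> r' = r \<and> P' = P"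
    using lrule_inverting[OF step.prems(1,2)] by metis
  show ?case
  proof (cases "p \<in># P'")
    case True
    \<comment> \<open>The derivation ends with the rule to be inverted, and since all variables of
      \<open>Fr\<close> or all new labels occur among its premisses, the wanted premiss is one of
      them.\<close>
    then have eq: "r' = r" "P' = P" using p(2) step.hyps(2) by blast+
    then have "(E', Q) \<in> Qs'"
      using lrule_inverting_det[OF step.prems(1) _ step.prems(2) step.prems(4,3)] step.hyps(2) step.prems(6)
      by blast
    then have "lder RS Fr n (F \<union> E') (Q + M')" by (rule step.hyps(3))
    moreover have "M' = M" using step.prems(5) eq(2) by simp
    ultimately have D: "lder RS Fr n (F \<union> E') (Q + M)" by simp
    show ?thesis using lder_Suc[OF D] by simp
  next
    case False
    then have "p \<in># M'" using step.prems(5) p(1) by (metis union_iff union_single_eq_member union_commute add_mset_add_single)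
    then obtain M'' where M'': "M' = add_mset p M''" by (blast dest: multi_member_split)
    have M: "M = P' + M''" using step.prems(5) unfolding p(1) M'' by simp
    \<comment> \<open>The last rule has another principal item, so it is repeated below the inverted
      premisses, now over the larger edge set.\<close>
    obtain Qs'' where Qs'': "Qs'' \<subseteq> Qs'" "lrule Fr (F \<union> E') r' P' Qs''"
      using lrule_mono[OF step.hyps(2), of "F \<union> E'"] by blast
    have "lder RS Fr (Suc n) (F \<union> E') (P' + (Q + M''))"
    proof (rule lder.step[OF step.hyps(1) Qs''(2)])
      fix E'' Q' assume Q': "(E'', Q') \<in> Qs''"
      \<comment> \<open>The label of \<open>E'\<close> remains new: only premisses of the instance
        over \<open>F \<union> E'\<close> are left, and their own new label avoids it.\<close>
      have fresh: "u \<notin> nodes (F \<union> E'')" if "(w, u) \<in> E'" for w u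
        using lrule_nodes[OF Qs''(2) Q'] step.prems(6)[OF that] that
        by (auto simp: nodes_def)
      have "lder RS Fr n ((F \<union> E'') \<union> E') (Q + (Q' + M''))"
        by (rule step.IH[OF _ step.prems(1-3) _ _ fresh])
          (use Q' Qs''(1) step.prems(4) p(1) M'' in auto)
      then show "lder RS Fr n (F \<union> E' \<union> E'') (Q' + (Q + M''))" by (simp add: ac_simps)
    qed
    then show ?thesis unfolding M by (simp add: ac_simps)
  qed
qed

lemma lder_premise:
  assumes "lder RS Fr n E (P + M)" "lrule Fr E r P Qs" "(E', Q) \<in> Qs"
  shows "lder RS Fr n (E \<union> E') (Q + M)"
proof (cases "r \<in> inverting")
  case True
  have "u \<notin> nodes E" if "(w, u) \<in> E'" for w u using lrule_nodes[OF assms(2,3)] that by auto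
  with True show ?thesis using lder_invert[OF assms(1,2) True assms(3)] by blast
next
  case False
  then have "P \<subseteq># Q" using lrule_cumulative assms by blast
  then show ?thesis using assms(1) by (rule_tac lder_weaken) auto
qed

section \<open>Nested rule instances as labelled ones\<close>

primrec db_item :: "(var \<Rightarrow> var) \<Rightarrow> fm item \<Rightarrow> dfm item" where
  "db_item \<sigma> (Sg x) = Sg (\<sigma> x)"
| "db_item \<sigma> (An A) = An (db (Fre \<circ> \<sigma>) A)"
| "db_item \<sigma> (Sc A) = Sc (db (Fre \<circ> \<sigma>) A)"

definition db_items :: "(var \<Rightarrow> var) \<Rightarrow> ('l \<times> fm item) multiset \<Rightarrow> ('l \<times> dfm item) multiset" where
  "db_items \<sigma> M = image_mset (\<lambda>p. (fst p, db_item \<sigma> (snd p))) M"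

lemma db_items_simps [simp]: "db_items \<sigma> {#} = {#}" "db_items \<sigma> (M + N) = db_items \<sigma> M + db_items \<sigma> N"
  "db_items \<sigma> (add_mset p M) = add_mset (fst p, db_item \<sigma> (snd p)) (db_items \<sigma> M)"
  by (simp_all add: db_items_def)

lemma db_items_put [simp]: "db_items \<sigma> (put w A) = put w (image_mset (db_item \<sigma>) A)"
  by (simp add: db_items_def put_def multiset.map_comp comp_def)

lemma good_simps [simp]:
  "good T (M + N) \<longleftrightarrow> good T M \<and> good T N"
  "good T (add_mset p M) \<longleftrightarrow> fst p \<in> set_tr T \<and> good T M"
  by (auto simp: good_def)

lemma good_put: "good T M \<Longrightarrow> w \<in> set_tr T \<Longrightarrow> good T (put w A)"
  by (auto simp: good_def)

lemma goodD: "good T M \<Longrightarrow> lab T = 0" "good T M \<Longrightarrow> uniq (labels T)" "good T M \<Longrightarrow> set_tr T = nodes (edges T)"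
  using set_tr_edges[of T] by (auto simp: good_def nodes_def)

definition represents :: "(var \<Rightarrow> var) \<Rightarrow> nseq \<Rightarrow> (nat \<times> nat) set \<Rightarrow> (nat \<times> dfm item) multiset \<Rightarrow> bool" where
  "represents \<sigma> S E M \<longleftrightarrow> (\<exists>T N. S = nested T N \<and> good T N \<and> E = edges T \<and> M = db_items \<sigma> N)"

lemma tracksI: "S = nested T N \<Longrightarrow> good T N \<Longrightarrow> E = edges T \<Longrightarrow> M = db_items \<sigma> N \<Longrightarrow> represents \<sigma> S E M"
  unfolding represents_def by blast

lemma edges_subset: "edges t \<subseteq> set_tr t \<times> set_tr t"
  by (induction t) fastforce+

text \<open>The renaming may change from the conclusion to the premisses only to let the eigenvariable
  take every value in \<open>Fr\<close>.\<close>
definition simulated where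
  "simulated Fr \<sigma> E M r Ps \<longleftrightarrow> (\<exists>P Qs M0. M = P + M0 \<and> lrule Fr E r P Qs \<and>
    (\<forall>E' Q. (E', Q) \<in> Qs \<longrightarrow> (\<exists>S\<in>set Ps. \<exists>\<sigma>'. range \<sigma>' \<subseteq> Fr \<and> represents \<sigma>' S (E \<union> E') (Q + M0))) \<and>
    (\<forall>S\<in>set Ps. \<exists>E' Q. (E', Q) \<in> Qs \<and> represents \<sigma> S (E \<union> E') (Q + M0)))"

lemma simulatedI:
  assumes "M = P + M0" "lrule Fr E r P Qs"
    "\<And>E' Q. (E', Q) \<in> Qs \<Longrightarrow> \<exists>S\<in>set Ps. \<exists>\<sigma>'. range \<sigma>' \<subseteq> Fr \<and> represents \<sigma>' S (E \<union> E') (Q + M0)"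
    "\<And>S. S \<in> set Ps \<Longrightarrow> \<exists>E' Q. (E', Q) \<in> Qs \<and> represents \<sigma> S (E \<union> E') (Q + M0)"
  shows "simulated Fr \<sigma> E M r Ps"
  unfolding simulated_def using assms by blast

abbreviation node :: "fm item multiset \<Rightarrow> nseq multiset \<Rightarrow> nseq" where
  "node A K \<equiv> NS (sigs A) (antes A) (succs A) K"

text \<open>Covers the rules that act at a single node: \<open>P\<close> is what the rule consumes,
  each \<open>Q\<close> is what a premiss puts in its place, and \<open>R\<close> are the bystanders
  in the hole.\<close>

lemma simulated_plain:
  assumes "represents \<sigma> (plug C [NS X \<Gamma> \<Delta> {#}]) E M" "is_ctx 1 C" "range \<sigma> \<subseteq> Fr"
    and "items X \<Gamma> \<Delta> = P + R" "Ps = map (\<lambda>Q. plug C [node (Q + R) {#}]) Qs"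
    and "\<And>w. w \<in> nodes E \<Longrightarrow> lrule Fr E r (put w (image_mset (db_item \<sigma>) P))
      (set (map (\<lambda>Q. ({}, put w (image_mset (db_item \<sigma>) Q))) Qs))"
  shows "simulated Fr \<sigma> E M r Ps"
proof -
  obtain T N where N: "plug C [NS X \<Gamma> \<Delta> {#}] = nested T N" "good T N" "E = edges T" "M = db_items \<sigma> N"
    using assms(1) unfolding represents_def by blast
  obtain w N0 where w: "w \<in> set_tr T" "N = N0 + put w (items X \<Gamma> \<Delta>)" "C = hole_at T N0 w"
    using unplug_plain[OF N(1)[symmetric] assms(2)] goodD(2)[OF N(2)] by blast
  have tr: "represents \<sigma> (plug C [node (Q + R) {#}]) (E \<union> {})
    (put w (image_mset (db_item \<sigma>) Q) + db_items \<sigma> (N0 + put w R))" for Q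
  proof (rule tracksI)
    show "plug C [node (Q + R) {#}] = nested T (N0 + put w (Q + R))"
      unfolding w(3) plug_plain items_parts ..
  qed (use N w in \<open>auto intro: good_put\<close>)
  show ?thesis
  proof (rule simulatedI)
    show "M = put w (image_mset (db_item \<sigma>) P) + db_items \<sigma> (N0 + put w R)"
      unfolding N(4) w(2) assms(4) by simp
    show "lrule Fr E r (put w (image_mset (db_item \<sigma>) P)) (set (map (\<lambda>Q. ({}, put w (image_mset (db_item \<sigma>) Q))) Qs))"
      using assms(6) w(1) goodD(3)[OF N(2)] N(3) by blast
    show "\<exists>S\<in>set Ps. \<exists>\<sigma>'. range \<sigma>' \<subseteq> Fr \<and> represents \<sigma>' S (E \<union> E') (Q + db_items \<sigma> (N0 + put w R))"
      if "(E', Q) \<in> set (map (\<lambda>Q. ({}, put w (image_mset (db_item \<sigma>) Q))) Qs)" for E' Q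
      using that tr assms(3) unfolding assms(5) set_map by blast
    show "\<exists>E' Q. (E', Q) \<in> set (map (\<lambda>Q. ({}, put w (image_mset (db_item \<sigma>) Q))) Qs) \<and>
      represents \<sigma> S (E \<union> E') (Q + db_items \<sigma> (N0 + put w R))" if "S \<in> set Ps" for S
      using that tr unfolding assms(5) set_map by blast
  qed
qed

lemma simulated_child:
  assumes "represents \<sigma> (plug C [NS X \<Gamma> \<Delta> {#NS Y \<Pi> \<Sigma> K#}]) E M" "is_ctx 1 C" "range \<sigma> \<subseteq> Fr"
    and "items X \<Gamma> \<Delta> = P + R" "items Y \<Pi> \<Sigma> = P' + R'" "S = plug C [node (Q + R) {#node (Q' + R') K#}]"
    and "\<And>w u. (w, u) \<in> E \<Longrightarrow> lrule Fr E r (put w (image_mset (db_item \<sigma>) P) + put u (image_mset (db_item \<sigma>) P'))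
      {({}, put w (image_mset (db_item \<sigma>) Q) + put u (image_mset (db_item \<sigma>) Q'))}"
  shows "simulated Fr \<sigma> E M r [S]"
proof -
  obtain T N where N: "plug C [NS X \<Gamma> \<Delta> {#NS Y \<Pi> \<Sigma> K#}] = nested T N" "good T N" "E = edges T" "M = db_items \<sigma> N"
    using assms(1) unfolding represents_def by blast
  obtain w u N0 where w: "(w, u) \<in> edges T" "N = N0 + put w (items X \<Gamma> \<Delta>) + put u (items Y \<Pi> \<Sigma>)"
    "plug C [node (Q + R) {#node (Q' + R') K#}] = nested T (N0 + put w (items (sigs (Q + R)) (antes (Q + R)) (succs (Q + R)))
      + put u (items (sigs (Q' + R')) (antes (Q' + R')) (succs (Q' + R'))))"
    using unplug_child[OF N(1)[symmetric] assms(2) goodD(2)[OF N(2)]] by metis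
  have wu: "w \<in> set_tr T" "u \<in> set_tr T"
    using w(1) edges_subset[of T] set_tr_edges[of T] by auto
  have tr: "represents \<sigma> S (E \<union> {})
    ((put w (image_mset (db_item \<sigma>) Q) + put u (image_mset (db_item \<sigma>) Q')) + db_items \<sigma> (N0 + put w R + put u R'))"
  proof (rule tracksI)
    show "S = nested T (N0 + put w (Q + R) + put u (Q' + R'))"
      unfolding assms(6) w(3) items_parts ..
  qed (use N w wu in \<open>auto intro: good_put\<close>)
  show ?thesis
  proof (rule simulatedI)
    show "M = (put w (image_mset (db_item \<sigma>) P) + put u (image_mset (db_item \<sigma>) P')) + db_items \<sigma> (N0 + put w R + put u R')"
      unfolding N(4) w(2) assms(4,5) by simp
    show "lrule Fr E r (put w (image_mset (db_item \<sigma>) P) + put u (image_mset (db_item \<sigma>) P'))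
      {({}, put w (image_mset (db_item \<sigma>) Q) + put u (image_mset (db_item \<sigma>) Q'))}"
      using assms(7) w(1) N(3) by blast
  qed (use tr assms(3) in \<open>auto simp del: parts_simps db_items_simps\<close>)
qed

lemma simulated_holes_at:
  assumes "represents \<sigma> (plug C [NS X \<Gamma> \<Delta> {#}, NS Y \<Pi> \<Sigma> {#}]) E M" "is_ctx 2 C" "range \<sigma> \<subseteq> Fr"
    and "items X \<Gamma> \<Delta> = P + R" "items Y \<Pi> \<Sigma> = P' + R'" "S = plug C [node (Q + R) {#}, node (Q' + R') {#}]"
    and "\<And>w v. w \<in> nodes E \<Longrightarrow> v \<in> nodes E \<Longrightarrow> (\<And>d. d \<ge> 1 \<Longrightarrow> hole_depth 0 C d \<Longrightarrow> w \<noteq> 0) \<Longrightarrow>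
      (\<And>d. d \<ge> 1 \<Longrightarrow> hole_depth 1 C d \<Longrightarrow> v \<noteq> 0) \<Longrightarrow>
      lrule Fr E r (put w (image_mset (db_item \<sigma>) P) + put v (image_mset (db_item \<sigma>) P'))
      {({}, put w (image_mset (db_item \<sigma>) Q) + put v (image_mset (db_item \<sigma>) Q'))}"
  shows "simulated Fr \<sigma> E M r [S]"
proof -
  obtain T N where N: "plug C [NS X \<Gamma> \<Delta> {#}, NS Y \<Pi> \<Sigma> {#}] = nested T N" "good T N" "E = edges T" "M = db_items \<sigma> N"
    using assms(1) unfolding represents_def by blast
  obtain w v N0 where w: "w \<in> set_tr T" "v \<in> set_tr T"
    "N = N0 + put w (items X \<Gamma> \<Delta>) + put v (items Y \<Pi> \<Sigma>)" "C = holes_at T N0 w v"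
    using unplug_holes_at[OF N(1)[symmetric] assms(2) goodD(2)[OF N(2)]] by metis
  note hd = hole_depth_holes_at[OF goodD(2)[OF N(2)] w(1,2), of N0, folded w(4), unfolded goodD(1)[OF N(2)]]
  have depth: "w \<noteq> 0" if "d \<ge> 1" "hole_depth 0 C d" for d using hd(1) that by blast
  have depth': "v \<noteq> 0" if "d \<ge> 1" "hole_depth 1 C d" for d using hd(2) that by blast
  have tr: "represents \<sigma> S (E \<union> {})
    ((put w (image_mset (db_item \<sigma>) Q) + put v (image_mset (db_item \<sigma>) Q')) + db_items \<sigma> (N0 + put w R + put v R'))"
  proof (rule tracksI)
    show "S = nested T (N0 + put w (Q + R) + put v (Q' + R'))"
      unfolding assms(6) w(4) plug_holes_at items_parts ..
  qed (use N w in \<open>auto intro: good_put\<close>)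
  show ?thesis
  proof (rule simulatedI)
    show "M = (put w (image_mset (db_item \<sigma>) P) + put v (image_mset (db_item \<sigma>) P')) + db_items \<sigma> (N0 + put w R + put v R')"
      unfolding N(4) w(3) assms(4,5) by simp
    show "lrule Fr E r (put w (image_mset (db_item \<sigma>) P) + put v (image_mset (db_item \<sigma>) P'))
      {({}, put w (image_mset (db_item \<sigma>) Q) + put v (image_mset (db_item \<sigma>) Q'))}"
      using assms(7) w(1,2) goodD(3)[OF N(2)] N(3) depth depth' by metis
  qed (use tr assms(3) in \<open>auto simp del: parts_simps db_items_simps\<close>)
qed

lemma infinite_fresh: "finite V \<Longrightarrow> \<exists>u. u \<notin> V" for V :: "nat set"
  by (rule ex_new_if_finite[OF infinite_UNIV_nat])

text \<open>A nested sequent does not fix its labels, so the one nested premiss stands for the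
  labelled premisses of all new labels at once.\<close>

lemma simulated_leaf:
  assumes "represents \<sigma> (plug C [NS X \<Gamma> \<Delta> {#}]) E M" "is_ctx 1 C" "range \<sigma> \<subseteq> Fr"
    and "items X \<Gamma> \<Delta> = P + R" "S = plug C [node R {#node Q {#}#}]"
    and "\<And>w. w \<in> nodes E \<Longrightarrow> lrule Fr E r (put w (image_mset (db_item \<sigma>) P))
      {({(w, u)}, put u (image_mset (db_item \<sigma>) Q)) | u. u \<notin> nodes E}"
  shows "simulated Fr \<sigma> E M r [S]"
proof -
  obtain T N where N: "plug C [NS X \<Gamma> \<Delta> {#}] = nested T N" "good T N" "E = edges T" "M = db_items \<sigma> N"
    using assms(1) unfolding represents_def by blast
  obtain w N0 where w: "w \<in> set_tr T" "N = N0 + put w (items X \<Gamma> \<Delta>)" "C = hole_at T N0 w"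
    using unplug_plain[OF N(1)[symmetric] assms(2)] goodD(2)[OF N(2)] by blast
  note nT = goodD(3)[OF N(2)]
  have tr: "represents \<sigma> S (E \<union> {(w, u)}) (put u (image_mset (db_item \<sigma>) Q) + db_items \<sigma> (N0 + put w R))"
    if u: "u \<notin> nodes E" for u
  proof -
    have "u \<notin> set_tr T" using u nT N(3) by simp
    note pl = plug_leaf(1,2)[OF N(2)[unfolded w(2)] w(1) this, where X' = "sigs R" and \<Gamma>' = "antes R" and
        \<Delta>' = "succs R" and Y = "sigs Q" and \<Pi> = "antes Q" and \<Sigma> = "succs Q", unfolded items_parts]
    show ?thesis
      unfolding assms(5) w(3)
      by (rule tracksI[OF pl(1,2)]) (auto simp: plug_leaf(3)[OF N(2)[unfolded w(2)] w(1) \<open>u \<notin> set_tr T\<close>] N(3))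
  qed
  \<comment> \<open>At least one new label exists because the tree is finite.\<close>
  have "finite (nodes E)" unfolding N(3) nT[symmetric] by (metis finite_set_mset set_labels)
  then obtain u where "u \<notin> nodes E" using infinite_fresh by blast
  show ?thesis
  proof (rule simulatedI)
    show "M = put w (image_mset (db_item \<sigma>) P) + db_items \<sigma> (N0 + put w R)"
      unfolding N(4) w(2) assms(4) by simp
    show "lrule Fr E r (put w (image_mset (db_item \<sigma>) P)) {({(w, u)}, put u (image_mset (db_item \<sigma>) Q)) | u. u \<notin> nodes E}"
      using assms(6) w(1) nT N(3) by blast
    show "\<exists>S\<in>set [S]. \<exists>\<sigma>'. range \<sigma>' \<subseteq> Fr \<and> represents \<sigma>' S (E \<union> E') (Q' + db_items \<sigma> (N0 + put w R))"
      if "(E', Q') \<in> {({(w, u)}, put u (image_mset (db_item \<sigma>) Q)) | u. u \<notin> nodes E}" for E' Q'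
    proof -
      obtain u where "u \<notin> nodes E" "E' = {(w, u)}" "Q' = put u (image_mset (db_item \<sigma>) Q)"
        using \<open>(E', Q') \<in> _\<close> by blast
      with tr[of u] assms(3) show ?thesis by auto
    qed
    show "\<exists>E' Q'. (E', Q') \<in> {({(w, u)}, put u (image_mset (db_item \<sigma>) Q)) | u. u \<notin> nodes E} \<and>
      represents \<sigma> S' (E \<union> E') (Q' + db_items \<sigma> (N0 + put w R))" if "S' \<in> set [S]" for S'
    proof -
      have "S' = S" using that by simp
      with tr[OF \<open>u \<notin> nodes E\<close>] \<open>u \<notin> nodes E\<close> show ?thesis by blast
    qed
  qed
qed

section \<open>Free and bound variables read off the items\<close>

primrec item_fv :: "fm item \<Rightarrow> var set" where
  "item_fv (Sg x) = {x}"
| "item_fv (An A) = fv A"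
| "item_fv (Sc A) = fv A"

primrec item_bv :: "fm item \<Rightarrow> var set" where
  "item_bv (Sg x) = {}"
| "item_bv (An A) = bv A"
| "item_bv (Sc A) = bv A"

lemma parts_Un:
  "\<Union>(item_fv ` set_mset A) = set_mset (sigs A) \<union> \<Union>(fv ` set_mset (antes A)) \<union> \<Union>(fv ` set_mset (succs A))"
  "\<Union>(item_bv ` set_mset A) = \<Union>(bv ` set_mset (antes A)) \<union> \<Union>(bv ` set_mset (succs A))"
proof (induction A)
  case (add a A)
  { case 1 show ?case using add by (cases a) auto }
  { case 2 show ?case using add by (cases a) auto }
qed auto

lemma vars_nest:
  "fv_ns (nest c T) = (\<Union>l\<in>set_tr T. \<Union>(item_fv ` set_mset (c l)))"
  "bv_ns (nest c T) = (\<Union>l\<in>set_tr T. \<Union>(item_bv ` set_mset (c l)))"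
  by (induction T) (auto simp: parts_Un)

lemma vars_nested:
  assumes "good T N"
  shows "fv_ns (nested T N) = (\<Union>p\<in>set_mset N. item_fv (snd p))" "bv_ns (nested T N) = (\<Union>p\<in>set_mset N. item_bv (snd p))"
proof -
  have *: "(\<Union>l\<in>set_tr T. \<Union>(f ` set_mset (at N l))) = (\<Union>p\<in>set_mset N. f (snd p))" for f :: "fm item \<Rightarrow> var set"
    using assms by (force simp: good_def)
  show "fv_ns (nested T N) = (\<Union>p\<in>set_mset N. item_fv (snd p))" "bv_ns (nested T N) = (\<Union>p\<in>set_mset N. item_bv (snd p))"
    unfolding nested_def vars_nest * by rule+
qed

lemma db_item_cong: "(\<And>v. v \<in> item_fv a \<Longrightarrow> \<sigma> v = \<sigma>' v) \<Longrightarrow> db_item \<sigma> a = db_item \<sigma>' a"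
  by (cases a) (auto intro!: db_cong)

lemma db_items_cong: "(\<And>p v. p \<in># N \<Longrightarrow> v \<in> item_fv (snd p) \<Longrightarrow> \<sigma> v = \<sigma>' v) \<Longrightarrow> db_items \<sigma> N = db_items \<sigma>' N"
  unfolding db_items_def by (intro image_mset_cong prod_eqI) (auto intro!: db_item_cong)

lemma simulated_RAll:
  assumes "represents \<sigma> S E M" "S = plug C [NS X \<Gamma> (add_mset (All x A) \<Delta>) {#}]" "is_ctx 1 C"
    and \<sigma>: "range \<sigma> \<subseteq> Fr" and y: "y \<notin> fv_ns S"
  shows "simulated Fr \<sigma> E M RAll [plug C [NS (add_mset y X) \<Gamma> (add_mset (subst A y x) \<Delta>) {#}]]"
    (is "simulated _ _ _ _ _ [?S']")
proof -
  obtain T N where N: "S = nested T N" "good T N" "E = edges T" "M = db_items \<sigma> N"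
    using assms(1) unfolding represents_def by blast
  obtain w N0 where w: "w \<in> set_tr T" "N = N0 + put w (items X \<Gamma> (add_mset (All x A) \<Delta>))" "C = hole_at T N0 w"
    using unplug_plain[of T N C] N(1) assms(2,3) goodD(2)[OF N(2)] by metis
  let ?a = "db (bind (Fre \<circ> \<sigma>) x) A" and ?M0 = "db_items \<sigma> (N0 + put w (items X \<Gamma> \<Delta>))"
  have fresh: "y \<notin> item_fv (snd p)" if "p \<in># N" for p
    using y that unfolding N(1) vars_nested[OF N(2)] by blast
  \<comment> \<open>The eigenvariable does not occur in the conclusion, so redirecting
    \<open>\<sigma>\<close> at \<open>y\<close> leaves the reading of the old items unchanged, while
    the premiss becomes the labelled instance for \<open>z\<close>.\<close>
  have tr: "represents (\<sigma>(y := z)) ?S' (E \<union> {}) ({#(w, Sg z), (w, Sc (inst z 0 ?a))#} + ?M0)" for z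
  proof (rule tracksI)
    let ?\<sigma> = "\<sigma>(y := z)"
    have "db_items ?\<sigma> (N0 + put w (items X \<Gamma> \<Delta>)) = ?M0"
      using fresh unfolding w(2) by (intro db_items_cong) auto
    moreover have "db_item ?\<sigma> (Sc (All x A)) = db_item \<sigma> (Sc (All x A))"
      using fresh[of "(w, Sc (All x A))"] unfolding w(2) by (intro db_item_cong) auto
    ultimately show "{#(w, Sg z), (w, Sc (inst z 0 ?a))#} + ?M0
      = db_items ?\<sigma> (N0 + put w (items (add_mset y X) \<Gamma> (add_mset (subst A y x) \<Delta>)))"
      by (simp add: db_subst_inst)
    show "?S' = nested T (N0 + put w (items (add_mset y X) \<Gamma> (add_mset (subst A y x) \<Delta>)))"
      unfolding w(3) plug_plain ..
  qed (use N w in \<open>auto intro: good_put\<close>)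
  \<comment> \<open>With \<open>\<sigma>\<close> itself the premiss is the instance for
    \<open>\<sigma> y\<close>; this form serves when a given premiss is looked up.\<close>
  have tr': "represents \<sigma> ?S' (E \<union> {}) ({#(w, Sg (\<sigma> y)), (w, Sc (inst (\<sigma> y) 0 ?a))#} + ?M0)"
    using tr[of "\<sigma> y"] by simp
  show ?thesis
  proof (rule simulatedI)
    show "M = {#(w, Sc (DAll ?a))#} + ?M0" unfolding N(4) w(2) by simp
    show "lrule Fr E RAll {#(w, Sc (DAll ?a))#} {({}, {#(w, Sg y), (w, Sc (inst y 0 ?a))#}) | y. y \<in> Fr}"
      by (rule lrule.intros)
    show "\<exists>S\<in>set [?S']. \<exists>\<sigma>'. range \<sigma>' \<subseteq> Fr \<and> represents \<sigma>' S (E \<union> E') (Q + ?M0)"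
      if asm: "(E', Q) \<in> {({}, {#(w, Sg y), (w, Sc (inst y 0 ?a))#}) | y. y \<in> Fr}" for E' Q
    proof -
      obtain z where z: "z \<in> Fr" "E' = {}" "Q = {#(w, Sg z), (w, Sc (inst z 0 ?a))#}"
        using asm by blast
      moreover have "range (\<sigma>(y := z)) \<subseteq> Fr" using \<sigma> z(1) by auto
      ultimately show ?thesis using tr[of z] unfolding z by (simp only: list.set bex_simps) blast
    qed
    show "\<exists>E' Q. (E', Q) \<in> {({}, {#(w, Sg y), (w, Sc (inst y 0 ?a))#}) | y. y \<in> Fr} \<and>
      represents \<sigma> S' (E \<union> E') (Q + ?M0)" if "S' \<in> set [?S']" for S'
    proof -
      have "\<sigma> y \<in> Fr" using \<sigma> by blast
      with tr' that show ?thesis by (simp only: list.set) blast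
    qed
  qed
qed

lemma rule_inst_simulated:
  assumes "rule_inst r ys Ps S" "represents \<sigma> S E M" "range \<sigma> \<subseteq> Fr"
  shows "simulated Fr \<sigma> E M r Ps"
  using assms(1)
proof cases
  case (Init C P X \<Gamma> \<Delta>)
  show ?thesis using assms(2) Init
    by (intro simulated_plain[OF _ _ assms(3), where Qs = "[]" and P = "{#An P, Sc P#}"]) (auto intro!: lrule.intros)
next
  case (LBot C X \<Gamma> \<Delta>)
  show ?thesis using assms(2) LBot
    by (intro simulated_plain[OF _ _ assms(3), where Qs = "[]" and P = "{#An Bot#}"]) (auto intro!: lrule.intros)
next
  case (LImp C X \<Gamma> A \<Delta> B)
  show ?thesis using assms(2) LImp
    by (intro simulated_plain[OF _ _ assms(3), where Qs = "[{#Sc A#}, {#An B#}]" and P = "{#An (Imp A B)#}"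
          and R = "items X \<Gamma> \<Delta>"]) (auto intro!: lrule.intros)
next
  case (RImp C X A \<Gamma> B \<Delta>)
  show ?thesis using assms(2) RImp
    by (intro simulated_plain[OF _ _ assms(3), where Qs = "[{#An A, Sc B#}]" and P = "{#Sc (Imp A B)#}"
          and R = "items X \<Gamma> \<Delta>"]) (auto intro!: lrule.intros)
next
  case (LAll C z X A x \<Gamma> \<Delta>)
  show ?thesis using assms(2) LAll
    by (intro simulated_plain[OF _ _ assms(3), where Qs = "[{#Sg z, An (subst A z x), An (All x A)#}]"
          and P = "{#Sg z, An (All x A)#}" and R = "items X \<Gamma> \<Delta>"])
      (auto intro!: lrule.intros simp: db_subst_inst)
next
  case (RAll C X \<Gamma> x A \<Delta> y)
  show ?thesis using simulated_RAll[OF assms(2) RAll(5,4) assms(3)] RAll by simp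
next
  case (LBox C X A \<Gamma> \<Delta> Y \<Pi> \<Sigma> K)
  show ?thesis using assms(2) LBox unfolding LBox(3)
    by (intro simulated_child[OF _ _ assms(3), where P = "{#An (Box A)#}" and P' = "{#}"
        and Q = "{#An (Box A)#}" and Q' = "{#An A#}" and R = "items X \<Gamma> \<Delta>" and R' = "items Y \<Pi> \<Sigma>"])
      (auto intro!: lrule.intros simp del: union_mset_add_mset_right)
next
  case (RBox C X \<Gamma> \<Delta> A)
  show ?thesis using assms(2) RBox unfolding RBox(3)
    by (intro simulated_leaf[OF _ _ assms(3), where P = "{#Sc (Box A)#}" and Q = "{#Sc A#}" and R = "items X \<Gamma> \<Delta>"])
      (auto intro!: lrule.intros)
next
  case (Ref C X x \<Gamma> \<Delta>)
  show ?thesis using assms(2,3) Ref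
    by (intro simulated_plain[OF _ _ assms(3), where Qs = "[{#An (Eq x x)#}]"
          and P = "{#}" and R = "items X \<Gamma> \<Delta>"]) (auto intro!: lrule.intros)
next
  case (Repl C P X y z x \<Gamma> \<Delta>)
  show ?thesis using assms(2) Repl
    by (intro simulated_plain[OF _ _ assms(3), where Qs = "[{#An (subst P y z), An (Eq x y), An (subst P x z)#}]"
          and P = "{#An (Eq x y), An (subst P x z)#}" and R = "items X \<Gamma> \<Delta>"])
      (auto intro!: lrule.intros drepl_subst)
next
  case (ReplX C x y X \<Gamma> \<Delta>)
  show ?thesis using assms(2) ReplX
    by (intro simulated_plain[OF _ _ assms(3), where Qs = "[{#Sg x, Sg y, An (Eq x y)#}]"
          and P = "{#Sg x, An (Eq x y)#}" and R = "items X \<Gamma> \<Delta>"]) (auto intro!: lrule.intros)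
next
  case (Rig C X x y \<Gamma> \<Delta> Y \<Pi> \<Sigma>)
  show ?thesis using assms(2) Rig unfolding Rig(3)
    by (intro simulated_holes_at[OF _ _ assms(3), where P = "{#An (Eq x y)#}" and P' = "{#}"
        and Q = "{#An (Eq x y)#}" and Q' = "{#An (Eq x y)#}" and R = "items X \<Gamma> \<Delta>" and R' = "items Y \<Pi> \<Sigma>"])
      (auto intro!: lrule.intros simp del: union_mset_add_mset_right)
next
  case (RuD C X \<Gamma> \<Delta>)
  show ?thesis using assms(2) RuD unfolding RuD(3)
    by (intro simulated_leaf[OF _ _ assms(3), where P = "{#}" and Q = "{#}" and R = "items X \<Gamma> \<Delta>"])
      (auto intro!: lrule.intros)
next
  case (RuT C X A \<Gamma> \<Delta>)
  show ?thesis using assms(2) RuT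
    by (intro simulated_plain[OF _ _ assms(3), where Qs = "[{#An A, An (Box A)#}]"
          and P = "{#An (Box A)#}" and R = "items X \<Gamma> \<Delta>"]) (auto intro!: lrule.intros)
next
  case (RuB C X A \<Gamma> \<Delta> Y \<Pi> \<Sigma> K)
  show ?thesis using assms(2) RuB unfolding RuB(3)
    by (intro simulated_child[OF _ _ assms(3), where P = "{#}" and P' = "{#An (Box A)#}"
        and Q = "{#An A#}" and Q' = "{#An (Box A)#}" and R = "items X \<Gamma> \<Delta>" and R' = "items Y \<Pi> \<Sigma>"])
      (auto intro!: lrule.intros simp del: union_mset_add_mset_right)
next
  case (Ru4 C X A \<Gamma> \<Delta> Y \<Pi> \<Sigma> K)
  show ?thesis using assms(2) Ru4 unfolding Ru4(3)
    by (intro simulated_child[OF _ _ assms(3), where P = "{#An (Box A)#}" and P' = "{#}"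
        and Q = "{#An (Box A)#}" and Q' = "{#An (Box A)#}" and R = "items X \<Gamma> \<Delta>" and R' = "items Y \<Pi> \<Sigma>"])
      (auto intro!: lrule.intros simp del: union_mset_add_mset_right)
next
  case (Ru5 C d X A \<Gamma> \<Delta> Y \<Pi> \<Sigma>)
  show ?thesis using assms(2) Ru5 unfolding Ru5(3)
    by (intro simulated_holes_at[OF _ _ assms(3), where P = "{#An (Box A)#}" and P' = "{#}"
        and Q = "{#An (Box A)#}" and Q' = "{#An (Box A)#}" and R = "items X \<Gamma> \<Delta>" and R' = "items Y \<Pi> \<Sigma>"])
      (auto intro!: lrule.intros simp del: union_mset_add_mset_right)
next
  case (RuCBF C x X \<Gamma> \<Delta> Y \<Pi> \<Sigma> K)
  show ?thesis using assms(2) RuCBF unfolding RuCBF(3)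
    by (intro simulated_child[OF _ _ assms(3), where P = "{#Sg x#}" and P' = "{#}"
        and Q = "{#Sg x#}" and Q' = "{#Sg x#}" and R = "items X \<Gamma> \<Delta>" and R' = "items Y \<Pi> \<Sigma>"])
      (auto intro!: lrule.intros simp del: union_mset_add_mset_right)
next
  case (RuBF C x X \<Gamma> \<Delta> Y \<Pi> \<Sigma> K)
  show ?thesis using assms(2) RuBF unfolding RuBF(3)
    by (intro simulated_child[OF _ _ assms(3), where P = "{#}" and P' = "{#Sg x#}"
        and Q = "{#Sg x#}" and Q' = "{#Sg x#}" and R = "items X \<Gamma> \<Delta>" and R' = "items Y \<Pi> \<Sigma>"])
      (auto intro!: lrule.intros simp del: union_mset_add_mset_right)
next
  case (RuUI C x X \<Gamma> \<Delta>)
  show ?thesis using assms(2,3) RuUI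
    by (intro simulated_plain[OF _ _ assms(3), where Qs = "[{#Sg x#}]"
          and P = "{#}" and R = "items X \<Gamma> \<Delta>"]) (auto intro!: lrule.intros)
next
  case (Ru5dom C d e x X \<Gamma> \<Delta> Y \<Pi> \<Sigma>)
  show ?thesis using assms(2) Ru5dom unfolding Ru5dom(3)
    by (intro simulated_holes_at[OF _ _ assms(3), where P = "{#Sg x#}" and P' = "{#}"
        and Q = "{#Sg x#}" and Q' = "{#Sg x#}" and R = "items X \<Gamma> \<Delta>" and R' = "items Y \<Pi> \<Sigma>"])
      (auto intro!: lrule.intros simp del: union_mset_add_mset_right)
qed

section \<open>From derivations to labelled derivations\<close>

lemma height_le_Suc: "height (Infer S r ys ds) \<le> Suc n \<longleftrightarrow> (\<forall>d\<in>set ds. height d \<le> n)"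
  by simp

text \<open>The renaming must vary in the induction: at \<open>RAll\<close> the derivation of the
  single premiss is reused for each value that the eigenvariable can take in
  \<open>Fr\<close>.\<close>

lemma derivation_lder:
  assumes "inferences_ok Pr L d" "height d \<le> n" "represents \<sigma> (concl d) E M" "range \<sigma> \<subseteq> Fr"
  shows "lder (NQ L) Fr n E M"
  using assms
proof (induction arbitrary: n \<sigma> E M)
  case (1 r ys ds S)
  obtain m where m: "n = Suc m" using "1.prems"(1) by (cases n) auto
  have h: "height d \<le> m" if "d \<in> set ds" for d
    using "1.prems"(1) that unfolding m height_le_Suc by blast
  have "simulated Fr \<sigma> E M r (map concl ds)"
    using rule_inst_simulated[OF "1.hyps"(2)] "1.prems"(2,3) by simp
  then obtain P Qs M0 where sim: "M = P + M0" "lrule Fr E r P Qs"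
    "\<And>E' Q. (E', Q) \<in> Qs \<Longrightarrow> \<exists>S\<in>set (map concl ds). \<exists>\<sigma>'. range \<sigma>' \<subseteq> Fr \<and> represents \<sigma>' S (E \<union> E') (Q + M0)"
    unfolding simulated_def by (elim exE conjE) blast
  show ?case unfolding sim(1) m
  proof (rule lder.step[OF "1.hyps"(1) sim(2)])
    fix E' Q assume "(E', Q) \<in> Qs"
    then obtain d \<sigma>' where "d \<in> set ds" "range \<sigma>' \<subseteq> Fr" "represents \<sigma>' (concl d) (E \<union> E') (Q + M0)"
      using sim(3) by fastforce
    then show "lder (NQ L) Fr m (E \<union> E') (Q + M0)" using 1 h by blast
  qed
qed

section \<open>Alphabetical variants and existence of labellings\<close>

lemma count_at: "count (at M l) a = count M (l, a)"
  by (induction M) auto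

lemma at_eqI: "(\<And>l. at M l = at N l) \<Longrightarrow> M = N"
  by (metis count_at multiset_eqI surj_pair)

lemma at_sum_put: "uniq L \<Longrightarrow> at (\<Sum>l\<in>#L. put l (g l)) k = (if k \<in># L then g k else {#})"
  by (induction L) auto

lemma at_db_items: "at (db_items \<sigma> N) l = image_mset (db_item \<sigma>) (at N l)"
  by (induction N) auto

lemma ex_decorated:
  assumes "uniq (labels T)" "lab T = 0"
  obtains N where "good T N" "\<And>l. at N l = (if l \<in> set_tr T then g l else {#})"
proof
  let ?N = "\<Sum>l\<in>#labels T. put l (g l)"
  show at: "at ?N l = (if l \<in> set_tr T then g l else {#})" for l
    by (simp add: at_sum_put[OF assms(1)])
  have "l \<in> set_tr T" if "(l, a) \<in># ?N" for l a
    using that unfolding mem_at[symmetric] at by (simp split: if_splits)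
  then show "good T ?N" using assms by (auto simp: good_def)
qed

lemma at_good: "good T N \<Longrightarrow> l \<notin> set_tr T \<Longrightarrow> at N l = {#}"
  by (metis (no_types, lifting) good_def fst_conv image_eqI mem_at multiset_nonemptyE subsetD)

lemma image_mset_eq_rel: "rel_mset R A B \<Longrightarrow> (\<And>x y. R x y \<Longrightarrow> f x = g y) \<Longrightarrow> image_mset f A = image_mset g B"
  unfolding multiset.rel_eq[symmetric] multiset.rel_map by (erule multiset.rel_mono_strong)

lemma image_db_item_items:
  "image_mset (db_item \<sigma>) (items X \<Gamma> \<Delta>) = image_mset Sg (image_mset \<sigma> X) +
     image_mset An (image_mset (db (Fre \<circ> \<sigma>)) \<Gamma>) + image_mset Sc (image_mset (db (Fre \<circ> \<sigma>)) \<Delta>)"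
  by (simp add: items_def multiset.map_comp comp_def)

lemma alpha_ns_tree:
  "alpha_ns S S' \<Longrightarrow> map_tr (image_mset (db_item \<sigma>)) (tree S) = map_tr (image_mset (db_item \<sigma>)) (tree S')"
proof (induction rule: alpha_ns.induct)
  case (1 \<Gamma> \<Gamma>' \<Delta> \<Delta>' K K' X)
  have "image_mset (db (Fre \<circ> \<sigma>)) \<Gamma> = image_mset (db (Fre \<circ> \<sigma>)) \<Gamma>'"
    "image_mset (db (Fre \<circ> \<sigma>)) \<Delta> = image_mset (db (Fre \<circ> \<sigma>)) \<Delta>'"
    by (rule image_mset_eq_rel[OF 1(1)] image_mset_eq_rel[OF 1(2)]; erule alpha_db)+
  moreover have "image_mset (\<lambda>S. map_tr (image_mset (db_item \<sigma>)) (tree S)) K = image_mset (\<lambda>S. map_tr (image_mset (db_item \<sigma>)) (tree S)) K'"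
    by (rule image_mset_eq_rel[OF 1(3)]) blast
  ultimately show ?case by (simp add: image_db_item_items multiset.map_comp comp_def)
qed

text \<open>A variant has the same de Bruijn items node by node, but its children correspond only up
  to order. The labels of \<open>T\<close> are carried along this correspondence.\<close>

lemma represents_alpha:
  assumes "represents \<sigma> S E M" "alpha_ns S S'"
  shows "represents \<sigma> S' E M"
proof -
  obtain T N where N: "S = nested T N" "good T N" "E = edges T" "M = db_items \<sigma> N"
    using assms(1) unfolding represents_def by blast
  have "map_tr (\<lambda>l. image_mset (db_item \<sigma>) (at N l)) T = map_tr (image_mset (db_item \<sigma>)) (tree S')"
    using alpha_ns_tree[OF assms(2), of \<sigma>] unfolding N(1) nested_def nest_def
    by (simp add: tr.map_comp comp_def)
  then have "rel_tr (\<lambda>l A. image_mset (db_item \<sigma>) (at N l) = image_mset (db_item \<sigma>) A) T (tree S')"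
    unfolding tr.rel_eq[symmetric] tr.rel_map .
  then obtain g where g: "tree S' = map_tr g T"
    "\<And>l. l \<in> set_tr T \<Longrightarrow> image_mset (db_item \<sigma>) (at N l) = image_mset (db_item \<sigma>) (g l)"
    using rel_tr_decoration[OF _ goodD(2)[OF N(2)]] by blast
  obtain N' where N': "good T N'" "\<And>l. at N' l = (if l \<in> set_tr T then g l else {#})"
    using ex_decorated[OF goodD(2,1)[OF N(2)]] by blast
  have "tree S' = map_tr (at N') T" unfolding g(1) by (rule tr.map_cong0) (simp add: N')
  then have "S' = nested T N'" unfolding nested_def nest_def by (metis ns_tree)
  moreover have "db_items \<sigma> N' = M" unfolding N(4)
    by (rule at_eqI) (simp add: at_db_items N'(2) g(2) at_good[OF N(2)])
  ultimately show ?thesis using N'(1) N(3) by (intro tracksI) auto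
qed

text \<open>The set \<open>V\<close> of forbidden labels is there for the induction: siblings are
  labelled one after the other, each avoiding the labels already spent.\<close>

lemma ex_labelling:
  assumes "finite V" "r \<notin> V"
  shows "\<exists>Y :: (nat \<times> 'a) tr. map_tr snd Y = t \<and> uniq (image_mset fst (labels Y)) \<and> fst (lab Y) = r \<and>
    fst ` set_tr Y \<inter> V = {}"
  using assms
proof (induction t arbitrary: V r)
  case (Tr a K)
  have "\<exists>YK :: (nat \<times> 'a) tr multiset. image_mset (map_tr snd) YK = K \<and>
    uniq (image_mset fst (\<Sum>\<^sub># (image_mset labels YK))) \<and> fst ` (\<Union>Y\<in>set_mset YK. set_tr Y) \<inter> V = {}"
    if "finite V" for V
    using Tr.IH that
  proof (induction K arbitrary: V)
    case (add k K)
    obtain r where "r \<notin> V" using infinite_fresh[OF add.prems(2)] by blast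
    then obtain Y :: "(nat \<times> 'a) tr" where Y: "map_tr snd Y = k" "uniq (image_mset fst (labels Y))" "fst ` set_tr Y \<inter> V = {}"
      using add.prems(1)[of k V r] add.prems(2) by auto
    have "finite (V \<union> fst ` set_tr Y)" using add.prems(2) by (metis finite_UnI finite_imageI finite_set_mset set_labels)
    then obtain YK :: "(nat \<times> 'a) tr multiset" where "image_mset (map_tr snd) YK = K"
      "uniq (image_mset fst (\<Sum>\<^sub># (image_mset labels YK)))"
      "fst ` (\<Union>Y\<in>set_mset YK. set_tr Y) \<inter> (V \<union> fst ` set_tr Y) = {}"
      using add.IH[of "V \<union> fst ` set_tr Y"] add.prems(1) by auto
    then show ?case using Y by (intro exI[of _ "add_mset Y YK"]) (auto simp: uniq_plus)
  qed (auto simp: uniq_def)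
  from this[of "insert r V"] Tr.prems obtain YK :: "(nat \<times> 'a) tr multiset" where
    "image_mset (map_tr snd) YK = K" "uniq (image_mset fst (\<Sum>\<^sub># (image_mset labels YK)))"
    "fst ` (\<Union>Y\<in>set_mset YK. set_tr Y) \<inter> insert r V = {}" by auto
  then show ?case using Tr.prems(2) by (intro exI[of _ "Tr (r, a) YK"]) (auto simp: image_iff)
qed

lemma ex_represents: "\<exists>E M. represents \<sigma> S E M"
proof -
  obtain Y :: "(nat \<times> fm item multiset) tr" where Y: "map_tr snd Y = tree S"
    "uniq (image_mset fst (labels Y))" "fst (lab Y) = 0"
    using ex_labelling[of "{}" 0 "tree S"] by auto
  let ?T = "map_tr fst Y"
  have u: "uniq (labels ?T)" using Y(2) by (simp add: labels_map)
  then obtain g where g: "Y = map_tr (\<lambda>l. (l, g l)) ?T" by (rule uniq_decoration)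
  obtain N where N: "good ?T N" "\<And>l. at N l = (if l \<in> set_tr ?T then g l else {#})"
    using ex_decorated[OF u] Y(3) by auto
  have "tree S = map_tr g ?T" using Y(1) by (subst (asm) g) (simp add: tr.map_comp comp_def)
  also have "\<dots> = map_tr (at N) ?T" by (rule tr.map_cong0) (use N(2) in auto)
  finally have "S = nested ?T N" unfolding nested_def nest_def by (metis ns_tree)
  then show ?thesis using N(1) tracksI by blast
qed

text \<open>An invariant of labelled derivations: together with bound variables kept outside
  \<open>Fr\<close>, free variables inside \<open>Fr\<close> give purity.\<close>

primrec item_ok :: "(nat \<Rightarrow> nat set) \<Rightarrow> var set \<Rightarrow> dfm item \<Rightarrow> bool" where
  "item_ok Pr Fr (Sg x) \<longleftrightarrow> x \<in> Fr"
| "item_ok Pr Fr (An a) \<longleftrightarrow> dlang Pr a \<and> dfv a \<subseteq> Fr"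
| "item_ok Pr Fr (Sc a) \<longleftrightarrow> dlang Pr a \<and> dfv a \<subseteq> Fr"

text \<open>\<open>Ref\<close> and \<open>RuUI\<close> can introduce a variable that occurs nowhere
  below; their condition \<open>x \<in> Fr\<close> preserves the invariant.\<close>

lemma lrule_ok:
  assumes "lrule Fr E r P Qs" "\<forall>p\<in>#P. item_ok Pr Fr (snd p)" "(E', Q) \<in> Qs"
  shows "\<forall>p\<in>#Q. item_ok Pr Fr (snd p)"
proof -
  have inst: "dfv (inst z 0 a) \<subseteq> Fr" if "z \<in> Fr" "dfv a \<subseteq> Fr" for z a
    using dfv_inst[of z 0 a] that by blast
  have repl: "dlang Pr q \<and> dfv q \<subseteq> Fr" if "drepl x y p q" "y \<in> Fr" "dfv p \<subseteq> Fr" "dlang Pr p" for x y p q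
    using drepl_lang drepl_dfv that by blast
  show ?thesis using assms by cases (auto simp: in_lang_subst inst dest: repl)
qed

primrec item_lang :: "(nat \<Rightarrow> nat set) \<Rightarrow> fm item \<Rightarrow> bool" where
  "item_lang Pr (Sg x) \<longleftrightarrow> True"
| "item_lang Pr (An A) \<longleftrightarrow> in_lang Pr A"
| "item_lang Pr (Sc A) \<longleftrightarrow> in_lang Pr A"

lemma item_ok_db_item: "item_ok Pr Fr (db_item \<sigma> a) \<longleftrightarrow> item_lang Pr a \<and> \<sigma> ` item_fv a \<subseteq> Fr"
  by (cases a) (auto simp: in_lang_db[of Pr _ "Fre \<circ> \<sigma>"] dfv_db)

lemma item_lang_parts: "(\<forall>a\<in>#A. item_lang Pr a) \<longleftrightarrow> (\<forall>a\<in>#antes A. in_lang Pr a) \<and> (\<forall>a\<in>#succs A. in_lang Pr a)"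
proof (induction A)
  case (add a A)
  then show ?case by (cases a) auto
qed simp

lemma in_lang_nest: "in_lang_ns Pr (nest c T) \<longleftrightarrow> (\<forall>l\<in>set_tr T. \<forall>a\<in>#c l. item_lang Pr a)"
  by (induction T) (subst in_lang_ns.simps, auto simp: item_lang_parts)

lemma in_lang_nested: "good T N \<Longrightarrow> in_lang_ns Pr (nested T N) \<longleftrightarrow> (\<forall>p\<in>#N. item_lang Pr (snd p))"
  unfolding nested_def in_lang_nest by (force simp: good_def)

lemma represents_item_ok:
  assumes "represents \<sigma> S E M" "in_lang_ns Pr S" "range \<sigma> \<subseteq> Fr"
  shows "\<forall>p\<in>#M. item_ok Pr Fr (snd p)"
proof -
  obtain T N where N: "S = nested T N" "good T N" "M = db_items \<sigma> N" using assms(1) unfolding represents_def by blast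
  have "item_ok Pr Fr (db_item \<sigma> (snd p))" if "p \<in># N" for p
    using assms(2,3) that unfolding N(1) in_lang_nested[OF N(2)] by (auto simp: item_ok_db_item)
  then show ?thesis unfolding N(3) db_items_def by simp
qed

section \<open>From labelled derivations back to pure derivations\<close>

definition represents_pure :: "var set \<Rightarrow> nseq \<Rightarrow> (nat \<times> nat) set \<Rightarrow> (nat \<times> dfm item) multiset \<Rightarrow> bool" where
  "represents_pure Fr S E M \<longleftrightarrow> (\<exists>T N. S = nested T N \<and> good T N \<and> E = edges T \<and> M = db_items id N \<and>
     (\<forall>p\<in>#N. item_bv (snd p) \<inter> Fr = {}))"

lemma represents_pureI: "S = nested T N \<Longrightarrow> good T N \<Longrightarrow> E = edges T \<Longrightarrow> M = db_items id N \<Longrightarrow>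
    (\<And>p. p \<in># N \<Longrightarrow> item_bv (snd p) \<inter> Fr = {}) \<Longrightarrow> represents_pure Fr S E M"
  unfolding represents_pure_def by blast

text \<open>The counterpart of \<open>simulated\<close> for the way back. Each nested premiss needs
  just one of the possibly infinitely many labelled ones; \<open>V\<close> holds the variables that
  the eigenvariable must avoid.\<close>

definition realized where
  "realized Fr V r S E M Qs \<longleftrightarrow> (\<exists>ys Ps. rule_inst r ys Ps S \<and> distinct ys \<and> set ys \<inter> V = {} \<and>
    (\<forall>S'\<in>set Ps. \<exists>E' Q. (E', Q) \<in> Qs \<and> represents_pure Fr S' (E \<union> E') (Q + M)))"

lemma realizedI:
  assumes "rule_inst r ys Ps S" "distinct ys" "set ys \<inter> V = {}"
    "\<And>S'. S' \<in> set Ps \<Longrightarrow> \<exists>E' Q. (E', Q) \<in> Qs \<and> represents_pure Fr S' (E \<union> E') (Q + M)"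
  shows "realized Fr V r S E M Qs"
  unfolding realized_def using assms by blast

lemma realized_plain:
  assumes "good T N" "w \<in> set_tr T" "\<forall>p\<in>#N. item_bv (snd p) \<inter> Fr = {}"
    and "\<And>C. is_ctx 1 C \<Longrightarrow> rule_inst r [] (map (\<lambda>Q. plug C [node Q {#}]) Ql) (plug C [node P {#}])"
    and "\<And>Q. Q \<in> set Ql \<Longrightarrow> ({}, put w (image_mset (db_item id) Q)) \<in> Qs"
    and "\<And>Q. Q \<in> set Ql \<Longrightarrow> \<forall>a\<in>#Q. item_bv a \<inter> Fr = {}"
    and "S = nested T (N + put w P)"
  shows "realized Fr V r S (edges T) (db_items id N) Qs"
proof (rule realizedI)
  let ?C = "hole_at T N w"
  have pl: "plug ?C [node Q {#}] = nested T (N + put w Q)" for Q unfolding plug_plain items_parts ..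
  show "rule_inst r [] (map (\<lambda>Q. plug ?C [node Q {#}]) Ql) S"
    using assms(4)[OF is_ctx_hole_at[OF goodD(2)[OF assms(1)] assms(2), of N]] by (simp only: assms(7) pl)
  fix S' assume "S' \<in> set (map (\<lambda>Q. plug ?C [node Q {#}]) Ql)"
  then obtain Q where Q: "Q \<in> set Ql" "S' = nested T (N + put w Q)" unfolding pl by auto
  have "represents_pure Fr S' (edges T \<union> {}) (put w (image_mset (db_item id) Q) + db_items id N)"
    by (rule represents_pureI[OF Q(2)]) (use assms(1-3) assms(6)[OF Q(1)] in \<open>auto intro: good_put\<close>)
  with assms(5)[OF Q(1)] show "\<exists>E' Q. (E', Q) \<in> Qs \<and> represents_pure Fr S' (edges T \<union> E') (Q + db_items id N)" by blast
qed simp_all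

text \<open>\<open>B\<close> and \<open>K\<close> are the remaining items and the children of the
  displayed child, which the nested rule shows but leaves alone.\<close>

lemma realized_child:
  assumes "good T N" "(w, u) \<in> edges T" "\<forall>p\<in>#N. item_bv (snd p) \<inter> Fr = {}"
    and "\<And>C B K. is_ctx 1 C \<Longrightarrow> rule_inst r [] [plug C [node Q {#node (B + Q') K#}]] (plug C [node P {#node (B + P') K#}])"
    and "({}, put w (image_mset (db_item id) Q) + put u (image_mset (db_item id) Q')) \<in> Qs"
    and "\<forall>a\<in>#Q + Q'. item_bv a \<inter> Fr = {}"
    and "S = nested T (N + put w P + put u P')"
  shows "realized Fr V r S (edges T) (db_items id N) Qs"
proof -
  obtain C K where C: "is_ctx 1 C"
    "\<And>A A'. plug C [node A {#node (at N u + A') K#}] = nested T (N + put w A + put u A')"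
  proof -
    obtain C K where "is_ctx 1 C" and CK: "\<And>X \<Gamma> \<Delta> Y \<Pi> \<Sigma>. plug C [NS X \<Gamma> \<Delta>
        {#NS (sigs (at N u) + Y) (antes (at N u) + \<Pi>) (succs (at N u) + \<Sigma>) K#}]
      = nested T (N + put w (items X \<Gamma> \<Delta>) + put u (items Y \<Pi> \<Sigma>))"
      using plug_edge[OF assms(2) goodD(2)[OF assms(1)]] by metis
    have "plug C [node A {#node (at N u + A') K#}] = nested T (N + put w A + put u A')" for A A'
      unfolding parts_simps CK items_parts ..
    with \<open>is_ctx 1 C\<close> show thesis by (rule that)
  qed
  have wu: "w \<in> set_tr T" "u \<in> set_tr T" using assms(2) edges_subset[of T] by auto
  show ?thesis
  proof (rule realizedI)
    show "rule_inst r [] [plug C [node Q {#node (at N u + Q') K#}]] S"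
      using assms(4)[OF C(1), of "at N u" K] by (simp only: assms(7) C(2))
    fix S' assume "S' \<in> set [plug C [node Q {#node (at N u + Q') K#}]]"
    then have S': "S' = nested T (N + put w Q + put u Q')" using C(2) by simp
    have "represents_pure Fr S' (edges T \<union> {})
      ((put w (image_mset (db_item id) Q) + put u (image_mset (db_item id) Q')) + db_items id N)"
      by (rule represents_pureI[OF S']) (use assms(1,3,6) wu in \<open>auto intro: good_put\<close>)
    with assms(5) show "\<exists>E' Q. (E', Q) \<in> Qs \<and> represents_pure Fr S' (edges T \<union> E') (Q + db_items id N)" by blast
  qed simp_all
qed

lemma realized_holes_at:
  assumes "good T N" "w \<in> set_tr T" "v \<in> set_tr T" "\<forall>p\<in>#N. item_bv (snd p) \<inter> Fr = {}"
    and "\<And>C. is_ctx 2 C \<Longrightarrow> (w \<noteq> 0 \<Longrightarrow> \<exists>d\<ge>1. hole_depth 0 C d) \<Longrightarrow> (v \<noteq> 0 \<Longrightarrow> \<exists>d\<ge>1. hole_depth 1 C d) \<Longrightarrow>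
      rule_inst r [] [plug C [node Q {#}, node Q' {#}]] (plug C [node P {#}, node P' {#}])"
    and "({}, put w (image_mset (db_item id) Q) + put v (image_mset (db_item id) Q')) \<in> Qs"
    and "\<forall>a\<in>#Q + Q'. item_bv a \<inter> Fr = {}"
    and "S = nested T (N + put w P + put v P')"
  shows "realized Fr V r S (edges T) (db_items id N) Qs"
proof (rule realizedI)
  let ?C = "holes_at T N w v"
  have pl: "plug ?C [node A {#}, node A' {#}] = nested T (N + put w A + put v A')" for A A'
    unfolding plug_holes_at items_parts ..
  have u: "uniq (labels T)" by (rule goodD(2)[OF assms(1)])
  note hd = hole_depth_holes_at[OF u assms(2,3), of N, unfolded goodD(1)[OF assms(1)]]
  have "rule_inst r [] [plug ?C [node Q {#}, node Q' {#}]] (plug ?C [node P {#}, node P' {#}])"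
    by (rule assms(5)[OF is_ctx_holes_at[OF u assms(2,3)]]) (use hd in blast)+
  then show "rule_inst r [] [plug ?C [node Q {#}, node Q' {#}]] S" unfolding assms(8) pl .
  fix S' assume "S' \<in> set [plug ?C [node Q {#}, node Q' {#}]]"
  then have S': "S' = nested T (N + put w Q + put v Q')" using pl by simp
  have "represents_pure Fr S' (edges T \<union> {})
    ((put w (image_mset (db_item id) Q) + put v (image_mset (db_item id) Q')) + db_items id N)"
    by (rule represents_pureI[OF S']) (use assms(1-4,7) in \<open>auto intro: good_put\<close>)
  with assms(6) show "\<exists>E' Q. (E', Q) \<in> Qs \<and> represents_pure Fr S' (edges T \<union> E') (Q + db_items id N)" by blast
qed simp_all

lemma finite_nodes: "good T N \<Longrightarrow> finite (nodes (edges T))"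
  by (metis finite_set_mset goodD(3) set_labels)

lemma realized_leaf:
  assumes "good T N" "w \<in> set_tr T" "\<forall>p\<in>#N. item_bv (snd p) \<inter> Fr = {}"
    and "\<And>C. is_ctx 1 C \<Longrightarrow> rule_inst r [] [plug C [node {#} {#node Q {#}#}]] (plug C [node P {#}])"
    and "\<And>u. u \<notin> nodes (edges T) \<Longrightarrow> ({(w, u)}, put u (image_mset (db_item id) Q)) \<in> Qs"
    and "\<forall>a\<in>#Q. item_bv a \<inter> Fr = {}"
    and "S = nested T (N + put w P)"
  shows "realized Fr V r S (edges T) (db_items id N) Qs"
proof (rule realizedI)
  let ?C = "hole_at T N w"
  have pl: "plug ?C [node P {#}] = nested T (N + put w P)" unfolding plug_plain items_parts ..
  show "rule_inst r [] [plug ?C [node {#} {#node Q {#}#}]] S"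
    using assms(4)[OF is_ctx_hole_at[OF goodD(2)[OF assms(1)] assms(2), of N]] by (simp only: assms(7) pl)
  obtain u where u: "u \<notin> nodes (edges T)" using infinite_fresh[OF finite_nodes[OF assms(1)]] by blast
  have g: "good T (N + put w (items {#} {#} {#}))" using assms(1,2) by (simp add: good_put)
  have uT: "u \<notin> set_tr T" using u goodD(3)[OF assms(1)] by simp
  note pl' = plug_leaf(1,2)[OF g assms(2) uT, where X' = "sigs {#}" and \<Gamma>' = "antes {#}" and
        \<Delta>' = "succs {#}" and Y = "sigs Q" and \<Pi> = "antes Q" and \<Sigma> = "succs Q", unfolded items_parts]
  fix S' assume "S' \<in> set [plug ?C [node {#} {#node Q {#}#}]]"
  then have S': "S' = plug ?C [node {#} {#node Q {#}#}]" by simp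
  have "represents_pure Fr S' (edges T \<union> {(w, u)}) (put u (image_mset (db_item id) Q) + db_items id N)"
    unfolding S' by (rule represents_pureI[OF pl'])
      (use assms(3,6) in \<open>auto simp: plug_leaf(3)[OF g assms(2) uT]\<close>)
  with assms(5)[OF u] show "\<exists>E' Q. (E', Q) \<in> Qs \<and> represents_pure Fr S' (edges T \<union> E') (Q + db_items id N)" by blast
qed simp_all

lemma db_items_eq_add:
  assumes "db_items \<sigma> N = add_mset (w, x) M"
  obtains a N' where "N = add_mset (w, a) N'" "db_item \<sigma> a = x" "db_items \<sigma> N' = M"
  using msed_map_invR[OF assms[unfolded db_items_def]] unfolding db_items_def by auto

lemma db_item_eq:
  "db_item id a = Sg x \<longleftrightarrow> a = Sg x"
  "db_item id a = An p \<longleftrightarrow> (\<exists>A. a = An A \<and> db Fre A = p)"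
  "db_item id a = Sc p \<longleftrightarrow> (\<exists>A. a = Sc A \<and> db Fre A = p)"
  by (cases a; auto)+

text \<open>The outermost shape survives the translation, so a labelled principal formula can be
  read back as a named formula to which the nested rule applies.\<close>

lemma db_eq:
  "db e A = DBot \<longleftrightarrow> A = Bot"
  "db e A = DImp p q \<longleftrightarrow> (\<exists>B C. A = Imp B C \<and> db e B = p \<and> db e C = q)"
  "db e A = DAll p \<longleftrightarrow> (\<exists>x B. A = All x B \<and> db (bind e x) B = p)"
  "db e A = DBox p \<longleftrightarrow> (\<exists>B. A = Box B \<and> db e B = p)"
  "db Fre A = DEq (Fre x) (Fre y) \<longleftrightarrow> A = Eq x y"
  by (cases A; auto)+

lemma finite_vars: "finite (fv_ns S)"
  by (induction S) auto

lemma lrule_realized: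
  assumes "lrule Fr E r P Qs" "represents_pure Fr S E (P + M0)" "\<forall>p\<in>#P + M0. item_ok Pr Fr (snd p)"
    "finite V" "infinite Fr"
  shows "realized Fr V r S E M0 Qs"
proof -
  obtain T N where S: "S = nested T N" and g: "good T N" and E: "E = edges T" and d: "db_items id N = P + M0"
    and bv: "\<forall>p\<in>#N. item_bv (snd p) \<inter> Fr = {}"
    using assms(2) unfolding represents_pure_def by auto
  note nT = goodD(3)[OF g, symmetric]
  from assms(1) show ?thesis
  proof cases
    case (1 p w)
    obtain A N0 where N0: "M0 = db_items id N0" "N = add_mset (w, An A) (add_mset (w, Sc A) N0)" "atomic A"
    proof -
      obtain A B N0 where *: "M0 = db_items id N0" "N = add_mset (w, An A) (add_mset (w, Sc B) N0)"
        "db Fre A = p" "db Fre B = p"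
        using d 1 by (auto elim!: db_items_eq_add simp: db_item_eq)
      then have "atomic A" using 1 datomic_db by metis
      with * show thesis using that[of N0 A] db_eq_atomic[of A B] by simp
    qed
    show ?thesis unfolding E N0(1)
      by (rule realized_plain[where w = w and Ql = "[]" and P = "{#An A, Sc A#}"])
        (use g bv 1 nT E S N0 in \<open>auto intro!: rule_inst.intros\<close>)
  next
    case (2 w)
    obtain N0 where N0: "M0 = db_items id N0" "N = add_mset (w, An Bot) N0"
      using d 2 by (auto elim!: db_items_eq_add simp: db_item_eq db_eq)
    show ?thesis unfolding E N0(1)
      by (rule realized_plain[where w = w and Ql = "[]" and P = "{#An Bot#}"])
        (use g bv 2 nT E S N0 in \<open>auto intro!: rule_inst.intros\<close>)
  next
    case (6 w a)
    obtain x A N0 where N0: "M0 = db_items id N0" "N = add_mset (w, Sc (All x A)) N0" "a = db (bind Fre x) A"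
      using d 6 by (auto elim!: db_items_eq_add simp: db_item_eq db_eq)
    have w: "w \<in> set_tr T" using g N0(2) by simp
    \<comment> \<open>The eigenvariable is taken from \<open>Fr\<close>: removing finitely many
      variables leaves a choice, and bound variables are avoided automatically as they lie outside
      \<open>Fr\<close>.\<close>
    have "infinite (Fr - (V \<union> fv_ns S))" using assms(4,5) finite_vars by simp
    then obtain y where y: "y \<in> Fr" "y \<notin> V" "y \<notin> fv_ns S"
      using infinite_imp_nonempty by blast
    have "bv_ns S \<inter> Fr = {}" unfolding S vars_nested(2)[OF g] using bv by blast
    with y(1) have ybv: "y \<notin> bv_ns S" by blast
    let ?C = "hole_at T N0 w" and ?Q = "{#Sg y, Sc (subst A y x)#}"
    have pl: "plug ?C [node Q {#}] = nested T (N0 + put w Q)" for Q unfolding plug_plain items_parts ..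
    have S': "S = plug ?C [NS {#} {#} {#All x A#} {#}]"
      using pl[of "{#Sc (All x A)#}"] unfolding S N0(2) by simp
    have "rule_inst RAll [y] [plug ?C [NS {#y#} {#} {#subst A y x#} {#}]] S"
      using rule_inst.RAll[OF is_ctx_hole_at[OF goodD(2)[OF g] w] S', of y] y(3) ybv by simp
    then have rule: "rule_inst RAll [y] [nested T (N0 + put w ?Q)] S" using pl[of ?Q] by simp
    \<comment> \<open>So the substitution renames no bound variable, and the bound variables of the
      premiss stay outside \<open>Fr\<close>.\<close>
    have "y \<notin> bv A" using bv y(1) N0(2) by auto
    then have "represents_pure Fr (nested T (N0 + put w ?Q)) (edges T \<union> {}) ({#(w, Sg y), (w, Sc (inst y 0 a))#} + db_items id N0)"
      using g bv N0(2) w db_subst_inst[of id A y x]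
      by (intro represents_pureI[OF refl]) (auto intro: good_put simp: N0(3) bv_subst)
    moreover have "({}, {#(w, Sg y), (w, Sc (inst y 0 a))#}) \<in> Qs" using 6 y(1) by blast
    ultimately show ?thesis unfolding E N0(1) 6(1)
      using y(2) by (intro realizedI[OF rule]) (simp, simp, simp only: list.set, blast)
  next
    case (10 x y p q w)
    obtain A N0 where N0: "M0 = db_items id N0" "N = add_mset (w, An (Eq x y)) (add_mset (w, An A) N0)" "p = db Fre A"
      using d 10 by (auto elim!: db_items_eq_add simp: db_item_eq db_eq)
    obtain P' z where P': "atomic P'" "A = subst P' x z" "q = db Fre (subst P' y z)"
      using drepl_pullback 10 N0(3) by metis
    have [simp]: "bv (subst P' y z) = {}" using P'(1) by (cases P') (auto simp: subst_def)
    show ?thesis unfolding E N0(1)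
      by (rule realized_plain[where w = w and Ql = "[{#An (subst P' y z), An (Eq x y), An A#}]" and P = "{#An (Eq x y), An A#}"])
        (use g bv 10 nT E S N0 P' in \<open>auto intro!: rule_inst.intros\<close>)
  next
    case (5 w z a)
    obtain x A N0 where N0: "M0 = db_items id N0" "N = add_mset (w, Sg z) (add_mset (w, An (All x A)) N0)" "a = db (bind Fre x) A"
      using d 5 by (auto elim!: db_items_eq_add simp: db_item_eq db_eq)
    \<comment> \<open>The invariant on signatures puts \<open>z\<close> in \<open>Fr\<close>, hence
      apart from all bound variables, and the instance keeps the bound names of
      \<open>A\<close>.\<close>
    have "z \<in> Fr" using assms(3) 5 by simp
    then have "z \<notin> bv A" using bv N0(2) by auto
    then have [simp]: "bv (subst A z x) = bv A" by (rule bv_subst)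
    have [simp]: "db Fre (subst A z x) = inst z 0 a" using db_subst_inst[of id A z x] N0(3) by simp
    show ?thesis unfolding E N0(1)
      by (rule realized_plain[where w = w and Ql = "[{#Sg z, An (subst A z x), An (All x A)#}]" and P = "{#Sg z, An (All x A)#}"])
        (use g bv 5 nT E S N0 in \<open>auto intro!: rule_inst.intros\<close>)
  next
    case (3 w a b)
    obtain A B N0 where N0: "M0 = db_items id N0" "N = add_mset (w, An (Imp A B)) N0" "a = db Fre A" "b = db Fre B"
      using d 3 by (auto elim!: db_items_eq_add simp: db_item_eq db_eq)
    show ?thesis unfolding E N0(1)
      by (rule realized_plain[where w = w and Ql = "[{#Sc A#}, {#An B#}]" and P = "{#An (Imp A B)#}"])
        (use g bv 3 nT E S N0 in \<open>auto intro!: rule_inst.intros\<close>)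
  next
    case (4 w a b)
    obtain A B N0 where N0: "M0 = db_items id N0" "N = add_mset (w, Sc (Imp A B)) N0" "a = db Fre A" "b = db Fre B"
      using d 4 by (auto elim!: db_items_eq_add simp: db_item_eq db_eq)
    show ?thesis unfolding E N0(1)
      by (rule realized_plain[where w = w and Ql = "[{#An A, Sc B#}]" and P = "{#Sc (Imp A B)#}"])
        (use g bv 4 nT E S N0 in \<open>auto intro!: rule_inst.intros\<close>)
  next
    case (9 w x)
    have N0: "M0 = db_items id N" using d 9 by simp
    show ?thesis unfolding E N0
      by (rule realized_plain[where w = w and Ql = "[{#An (Eq x x)#}]" and P = "{#}"])
        (use g bv 9 nT E S in \<open>auto intro!: rule_inst.intros\<close>)
  next
    case (11 w x y)
    obtain  N0 where N0: "M0 = db_items id N0" "N = add_mset (w, Sg x) (add_mset (w, An (Eq x y)) N0)" 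
      using d 11 by (auto elim!: db_items_eq_add simp: db_item_eq db_eq)
    show ?thesis unfolding E N0(1)
      by (rule realized_plain[where w = w and Ql = "[{#Sg x, Sg y, An (Eq x y)#}]" and P = "{#Sg x, An (Eq x y)#}"])
        (use g bv 11 nT E S N0 in \<open>auto intro!: rule_inst.intros\<close>)
  next
    case (14 w a)
    obtain A N0 where N0: "M0 = db_items id N0" "N = add_mset (w, An (Box A)) N0" "a = db Fre A"
      using d 14 by (auto elim!: db_items_eq_add simp: db_item_eq db_eq)
    show ?thesis unfolding E N0(1)
      by (rule realized_plain[where w = w and Ql = "[{#An A, An (Box A)#}]" and P = "{#An (Box A)#}"])
        (use g bv 14 nT E S N0 in \<open>auto intro!: rule_inst.intros\<close>)
  next
    case (20 w x)
    have N0: "M0 = db_items id N" using d 20 by simp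
    show ?thesis unfolding E N0
      by (rule realized_plain[where w = w and Ql = "[{#Sg x#}]" and P = "{#}"])
        (use g bv 20 nT E S in \<open>auto intro!: rule_inst.intros\<close>)
  next
    case (7 w u a)
    obtain A N0 where N0: "M0 = db_items id N0" "N = add_mset (w, An (Box A)) N0" "a = db Fre A"
      using d 7 by (auto elim!: db_items_eq_add simp: db_item_eq db_eq)
    show ?thesis unfolding E N0(1)
      by (rule realized_child[where w = w and u = u and P = "{#An (Box A)#}" and P' = "{#}" and Q = "{#An (Box A)#}" and Q' = "{#An A#}"])
        (use g bv 7 nT E S N0 in \<open>auto intro!: rule_inst.intros simp: add_mset_commute\<close>)
  next
    case (15 w u a)
    obtain A N0 where N0: "M0 = db_items id N0" "N = add_mset (u, An (Box A)) N0" "a = db Fre A"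
      using d 15 by (auto elim!: db_items_eq_add simp: db_item_eq db_eq)
    show ?thesis unfolding E N0(1)
      by (rule realized_child[where w = w and u = u and P = "{#}" and P' = "{#An (Box A)#}" and Q = "{#An A#}" and Q' = "{#An (Box A)#}"])
        (use g bv 15 nT E S N0 in \<open>auto intro!: rule_inst.intros simp: add_mset_commute\<close>)
  next
    case (16 w u a)
    obtain A N0 where N0: "M0 = db_items id N0" "N = add_mset (w, An (Box A)) N0" "a = db Fre A"
      using d 16 by (auto elim!: db_items_eq_add simp: db_item_eq db_eq)
    show ?thesis unfolding E N0(1)
      by (rule realized_child[where w = w and u = u and P = "{#An (Box A)#}" and P' = "{#}" and Q = "{#An (Box A)#}" and Q' = "{#An (Box A)#}"])
        (use g bv 16 nT E S N0 in \<open>auto intro!: rule_inst.intros simp: add_mset_commute\<close>)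
  next
    case (18 w u x)
    obtain  N0 where N0: "M0 = db_items id N0" "N = add_mset (w, Sg x) N0" 
      using d 18 by (auto elim!: db_items_eq_add simp: db_item_eq db_eq)
    show ?thesis unfolding E N0(1)
      by (rule realized_child[where w = w and u = u and P = "{#Sg x#}" and P' = "{#}" and Q = "{#Sg x#}" and Q' = "{#Sg x#}"])
        (use g bv 18 nT E S N0 in \<open>auto intro!: rule_inst.intros simp: add_mset_commute\<close>)
  next
    case (19 w u x)
    obtain  N0 where N0: "M0 = db_items id N0" "N = add_mset (u, Sg x) N0" 
      using d 19 by (auto elim!: db_items_eq_add simp: db_item_eq db_eq)
    show ?thesis unfolding E N0(1)
      by (rule realized_child[where w = w and u = u and P = "{#}" and P' = "{#Sg x#}" and Q = "{#Sg x#}" and Q' = "{#Sg x#}"])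
        (use g bv 19 nT E S N0 in \<open>auto intro!: rule_inst.intros simp: add_mset_commute\<close>)
  next
    case (12 v w x y)
    obtain  N0 where N0: "M0 = db_items id N0" "N = add_mset (w, An (Eq x y)) N0" 
      using d 12 by (auto elim!: db_items_eq_add simp: db_item_eq db_eq)
    show ?thesis unfolding E N0(1)
      by (rule realized_holes_at[where w = w and v = v and P = "{#An (Eq x y)#}" and P' = "{#}" and Q = "{#An (Eq x y)#}" and Q' = "{#An (Eq x y)#}"])
        (use g bv 12 nT E S N0 in \<open>auto intro!: rule_inst.intros simp: add_mset_commute\<close>)
  next
    case (17 v w a)
    obtain A N0 where N0: "M0 = db_items id N0" "N = add_mset (w, An (Box A)) N0" "a = db Fre A"
      using d 17 by (auto elim!: db_items_eq_add simp: db_item_eq db_eq)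
    show ?thesis unfolding E N0(1)
      by (rule realized_holes_at[where w = w and v = v and P = "{#An (Box A)#}" and P' = "{#}" and Q = "{#An (Box A)#}" and Q' = "{#An (Box A)#}"])
        (use g bv 17 nT E S N0 in \<open>auto intro!: rule_inst.intros simp: add_mset_commute\<close>)
  next
    case (21 v w x)
    obtain  N0 where N0: "M0 = db_items id N0" "N = add_mset (w, Sg x) N0" 
      using d 21 by (auto elim!: db_items_eq_add simp: db_item_eq db_eq)
    show ?thesis unfolding E N0(1)
      by (rule realized_holes_at[where w = w and v = v and P = "{#Sg x#}" and P' = "{#}" and Q = "{#Sg x#}" and Q' = "{#Sg x#}"])
        (use g bv 21 nT E S N0 in \<open>auto intro!: rule_inst.intros simp: add_mset_commute\<close>)
  next
    case (8 w a)
    obtain A N0 where N0: "M0 = db_items id N0" "N = add_mset (w, Sc (Box A)) N0" "a = db Fre A"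
      using d 8 by (auto elim!: db_items_eq_add simp: db_item_eq db_eq)
    show ?thesis unfolding E N0(1)
      by (rule realized_leaf[where w = w and P = "{#Sc (Box A)#}" and Q = "{#Sc A#}"])
        (use g bv 8 nT E S N0 in \<open>auto intro!: rule_inst.intros\<close>)
  next
    case (13 w)
    have N0: "M0 = db_items id N" using d 13 by simp
    show ?thesis unfolding E N0
      by (rule realized_leaf[where w = w and P = "{#}" and Q = "{#}"])
        (use g bv 13 nT E S in \<open>auto intro!: rule_inst.intros\<close>)
  qed
qed

section \<open>Invertibility\<close>

definition pure_derivation where
  "pure_derivation Pr L n V S d \<longleftrightarrow> inferences_ok Pr L d \<and> concl d = S \<and> height d \<le> n \<and>
     distinct (eigenvars d) \<and> set (eigenvars d) \<inter> V = {}"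

text \<open>Eigenvariables become distinct across branches because each premiss is derived after its
  predecessors, avoiding their eigenvariables. This is why \<open>V\<close> is an arbitrary finite
  set in the assumption.\<close>

lemma pure_derivations:
  assumes "\<And>S V. S \<in> set Ps \<Longrightarrow> finite V \<Longrightarrow> \<exists>d. pure_derivation Pr L n V S d" "finite V"
  shows "\<exists>ds. map concl ds = Ps \<and> (\<forall>d\<in>set ds. inferences_ok Pr L d \<and> height d \<le> n) \<and>
    distinct (concat (map eigenvars ds)) \<and> set (concat (map eigenvars ds)) \<inter> V = {}"
  using assms
proof (induction Ps arbitrary: V)
  case (Cons S Ps)
  obtain d where d: "pure_derivation Pr L n V S d" using Cons.prems by auto
  obtain ds where "map concl ds = Ps" "\<forall>d\<in>set ds. inferences_ok Pr L d \<and> height d \<le> n"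
    "distinct (concat (map eigenvars ds))" "set (concat (map eigenvars ds)) \<inter> (V \<union> set (eigenvars d)) = {}"
    using Cons.IH[of "V \<union> set (eigenvars d)"] Cons.prems by auto
  then show ?case using d by (intro exI[of _ "d # ds"]) (auto simp: pure_derivation_def)
qed auto

lemma represents_pure_sequent:
  assumes "represents_pure Fr S E M" "\<forall>p\<in>#M. item_ok Pr Fr (snd p)"
  shows "in_lang_ns Pr S" "pure_ns S"
proof -
  obtain T N where S: "S = nested T N" and g: "good T N" and M: "M = db_items id N"
    and bv: "\<forall>p\<in>#N. item_bv (snd p) \<inter> Fr = {}"
    using assms(1) unfolding represents_pure_def by auto
  have ok: "item_lang Pr (snd p) \<and> item_fv (snd p) \<subseteq> Fr" if "p \<in># N" for p
    using assms(2) that unfolding M db_items_def by (auto simp: item_ok_db_item)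
  then show "in_lang_ns Pr S" unfolding S in_lang_nested[OF g] by blast
  show "pure_ns S" unfolding pure_ns_def S vars_nested[OF g] using ok bv by blast
qed

lemma lder_derivation:
  assumes "lder (NQ L) Fr n E M" "represents_pure Fr S E M" "\<forall>p\<in>#M. item_ok Pr Fr (snd p)"
    "infinite Fr" "finite V"
  shows "\<exists>d. pure_derivation Pr L n V S d"
  using assms(1-3,5)
proof (induction arbitrary: S V)
  case (step r E P Qs n M)
  have "realized Fr V r S E M Qs"
    using lrule_realized[OF step.hyps(2) step.prems assms(4)] .
  then obtain ys Ps where rule: "rule_inst r ys Ps S" "distinct ys" "set ys \<inter> V = {}"
    and Ps: "\<And>S'. S' \<in> set Ps \<Longrightarrow> \<exists>E' Q. (E', Q) \<in> Qs \<and> represents_pure Fr S' (E \<union> E') (Q + M)"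
    unfolding realized_def by blast
  have "\<exists>d. pure_derivation Pr L n V' S' d" if "S' \<in> set Ps" "finite V'" for S' V'
  proof -
    obtain E' Q where Q: "(E', Q) \<in> Qs" "represents_pure Fr S' (E \<union> E') (Q + M)"
      using Ps[OF \<open>S' \<in> set Ps\<close>] by blast
    have "\<forall>p\<in>#Q + M. item_ok Pr Fr (snd p)"
      using lrule_ok[OF step.hyps(2) _ Q(1)] step.prems(2) by auto
    then show ?thesis using step.IH[OF Q(1) Q(2) _ \<open>finite V'\<close>] by blast
  qed
  \<comment> \<open>The eigenvariable of the present step is also forbidden in the derivations above
    it.\<close>
  moreover have "finite (V \<union> set ys)" using step.prems(3) by simp
  ultimately have "\<exists>ds. map concl ds = Ps \<and> (\<forall>d\<in>set ds. inferences_ok Pr L d \<and> height d \<le> n) \<and>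
    distinct (concat (map eigenvars ds)) \<and> set (concat (map eigenvars ds)) \<inter> (V \<union> set ys) = {}"
    by (rule pure_derivations)
  then obtain ds where ds: "map concl ds = Ps" "\<forall>d\<in>set ds. inferences_ok Pr L d \<and> height d \<le> n"
    "distinct (concat (map eigenvars ds))" "set (concat (map eigenvars ds)) \<inter> (V \<union> set ys) = {}"
    by blast
  have "inferences_ok Pr L (Infer S r ys ds)"
    using step.hyps(1) rule(1) ds(1,2) represents_pure_sequent[OF step.prems(1,2)]
    by (intro inferences_ok.intros) auto
  moreover have "height (Infer S r ys ds) \<le> Suc n" using ds(2) by simp
  moreover have "distinct (eigenvars (Infer S r ys ds))" "set (eigenvars (Infer S r ys ds)) \<inter> V = {}"
    using rule(2,3) ds(3,4) by auto
  ultimately show ?case unfolding pure_derivation_def by (metis dtree.sel(1))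
qed

section \<open>Renaming bound variables throughout a sequent\<close>

lemma parts_map_item [simp]:
  "sigs (image_mset (map_item h) A) = sigs A" "antes (image_mset (map_item h) A) = image_mset h (antes A)"
  "succs (image_mset (map_item h) A) = image_mset h (succs A)"
proof (induction A)
  case (add a A)
  { case 1 show ?case using add by (cases a) auto }
  { case 2 show ?case using add by (cases a) auto }
  { case 3 show ?case using add by (cases a) auto }
qed auto

lemma rel_mset_image: "(\<And>x. x \<in># A \<Longrightarrow> R x (f x)) \<Longrightarrow> rel_mset R A (image_mset f A)"
  by (simp add: multiset.rel_map multiset.rel_refl_strong)

lemma alpha_nest:
  assumes "\<And>A. alpha A (h A)"
  shows "alpha_ns (nest c T) (nest (\<lambda>l. image_mset (map_item h) (c l)) T)"
proof (induction T)
  case (Tr l K)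
  have "rel_mset alpha_ns (image_mset (nest c) K) (image_mset (nest (\<lambda>l. image_mset (map_item h) (c l))) K)"
    unfolding multiset.rel_map using Tr by (intro multiset.rel_refl_strong)
  then show ?case using assms by (auto intro!: alpha_ns.intros rel_mset_image)
qed

lemma at_map: "at (image_mset (\<lambda>p. (fst p, h (snd p))) N) l = image_mset h (at N l)"
  by (induction N) auto

lemma represents_rename_bound:
  assumes "represents \<sigma> S E M" "\<And>v. v \<in> fv_ns S \<Longrightarrow> \<sigma> v = v" "infinite (- Fr)"
  obtains S' where "alpha_ns S S'" "represents_pure Fr S' E M"
proof -
  obtain T N where S: "S = nested T N" and g: "good T N" and E: "E = edges T" and M: "M = db_items \<sigma> N"
    using assms(1) unfolding represents_def by blast
  \<comment> \<open>As \<open>\<sigma>\<close> fixes every free variable of \<open>S\<close>, the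
    labelled items can be read without a renaming, as \<open>represents_pure\<close>
    demands.\<close>
  have "db_items \<sigma> N = db_items id N"
    using assms(2) unfolding S vars_nested[OF g] by (intro db_items_cong) auto
  obtain h where h: "\<And>A. alpha A (h A)" "\<And>A. bv (h A) \<subseteq> - Fr"
    using ex_alpha_bv_avoid[OF assms(3)] by metis
  let ?N = "image_mset (\<lambda>p. (fst p, map_item h (snd p))) N"
  have "alpha_ns S (nested T ?N)"
    using alpha_nest[of h "at N" T] h(1) unfolding S nested_def at_map .
  moreover have "represents_pure Fr (nested T ?N) E M"
  proof (rule represents_pureI[OF refl _ E])
    show "good T ?N" using g by (auto simp: good_def)
    have "db_item id a = db_item id (map_item h a)" for a
      using alpha_db[OF h(1)] by (cases a) auto
    then show "M = db_items id ?N" unfolding M \<open>db_items \<sigma> N = db_items id N\<close>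
      by (simp add: db_items_def multiset.map_comp comp_def)
    have "item_bv (map_item h a) \<inter> Fr = {}" for a using h(2) by (cases a) auto
    then show "item_bv (snd p) \<inter> Fr = {}" if p: "p \<in># ?N" for p
    proof -
      obtain q where "p = (fst q, map_item h (snd q))" using p unfolding set_image_mset by blast
      then show ?thesis using \<open>\<And>a. item_bv (map_item h a) \<inter> Fr = {}\<close> by simp
    qed
  qed
  ultimately show thesis by (rule that)
qed

theorem lemma8:
  fixes Pr :: "nat \<Rightarrow> nat set" and L :: "ax set" and r :: rule and ys :: "var list"
    and Ps :: "nseq list" and S :: nseq and n :: nat
  assumes "properly_closed L"
    and "r \<in> NQ L"
    and "rule_inst r ys Ps S"
    and "derivable_le Pr L n S"
  shows "\<forall>P\<in>set Ps. derivable_le Pr L n P"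
proof
  fix S' assume S': "S' \<in> set Ps"
  obtain d where d: "inferences_ok Pr L d" "alpha_ns S (concl d)" "height d \<le> n"
    using assms(4) unfolding derivable_le_def is_derivation_def by blast
  \<comment> \<open>Contains the free variables of the premiss, including the eigenvariable of a
    given \<open>RAll\<close> instance. The even numbers make it infinite, and almost all odd
    numbers remain outside for bound variables.\<close>
  define Fr where "Fr = fv_ns S' \<union> Collect even"
  \<comment> \<open>Free variables of the conclusion or of its derivation that are absent from
    \<open>Fr\<close> are sent to 0, which is even and thus in \<open>Fr\<close>.\<close>
  define \<sigma> where "\<sigma> v = (if v \<in> Fr then v else 0)" for v
  have \<sigma>: "range \<sigma> \<subseteq> Fr" by (auto simp: \<sigma>_def Fr_def)
  have "\<exists>v\<ge>m. even v" "\<exists>v\<ge>m. odd v" for m :: nat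
    by (rule exI[of _ "2 * m"], simp) (rule exI[of _ "Suc (2 * m)"], simp)
  then have "infinite {v :: nat. even v}" "infinite {v :: nat. odd v}"
    unfolding infinite_nat_iff_unbounded_le by auto
  moreover have "- Fr = {v. odd v} - fv_ns S'" by (auto simp: Fr_def)
  ultimately have inf: "infinite Fr" "infinite (- Fr)" using finite_vars[of S'] by (auto simp: Fr_def)
  obtain E M where tr: "represents \<sigma> S E M" using ex_represents by blast
  \<comment> \<open>The derivation may be one of an alphabetical variant of \<open>S\<close>, but
    both have the same labelled form.\<close>
  have tr': "represents \<sigma> (concl d) E M" by (rule represents_alpha[OF tr d(2)])
  have "simulated Fr \<sigma> E M r Ps" by (rule rule_inst_simulated[OF assms(3) tr \<sigma>])
  then obtain P Qs M0 E' Q where sim: "M = P + M0" "lrule Fr E r P Qs" "(E', Q) \<in> Qs"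
    and trS': "represents \<sigma> S' (E \<union> E') (Q + M0)"
    unfolding simulated_def using S' by (elim exE conjE) blast
  have "lder (NQ L) Fr n E (P + M0)" using derivation_lder[OF d(1,3) tr' \<sigma>] unfolding sim(1) .
  then have D: "lder (NQ L) Fr n (E \<union> E') (Q + M0)" using sim(2,3) by (rule lder_premise)
  have "in_lang_ns Pr (concl d)" using d(1) by cases simp
  then have "\<forall>p\<in>#P + M0. item_ok Pr Fr (snd p)" using represents_item_ok[OF tr' _ \<sigma>] unfolding sim(1) by blast
  then have ok: "\<forall>p\<in>#Q + M0. item_ok Pr Fr (snd p)" using lrule_ok[OF sim(2) _ sim(3)] by auto
  \<comment> \<open>Here it matters that \<open>\<sigma>\<close> fixes the free variables of
    \<open>S'\<close>: only bound names have to change, so the derivation found is one of a variant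
    of \<open>S'\<close> itself.\<close>
  obtain S'' where S'': "alpha_ns S' S''" "represents_pure Fr S'' (E \<union> E') (Q + M0)"
    using represents_rename_bound[OF trS' _ inf(2)] by (auto simp: \<sigma>_def Fr_def)
  obtain d' where "pure_derivation Pr L n {} S'' d'"
    using lder_derivation[OF D S''(2) ok inf(1)] by blast
  then show "derivable_le Pr L n S'"
    using S''(1) unfolding derivable_le_def is_derivation_def pure_derivation_def by blast
qed

end
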